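(* Let $\Omega=\mathbb{Z}\omega_1+\mathbb{Z}\omega_2$ be a lattice in $\mathbb{C}$ with invariants $g_2,g_3$, Weierstrass functions $\wp,\zeta,\sigma$, Serre functions $f_u$ and associated elliptic curve $E$. Let $K\subset\mathbb{C}$ be a finitely generated extension of $\mathbb{Q}$. Let $t_1,\dots,t_r$ be complex numbers linearly independent over $\mathbb{Q}$. Let $u_1,\dots,u_s$ be complex numbers. Let $n\geqslant 1$. 1. Assume that $\omega_1,\omega_2,u_1,\dots,u_s$ are linearly independent over $\mathbb{Q}$. Then for almost all $n$-tuples $(z_1,\dots,z_n)$ of complex numbers, the $n(4+r+s)$ numbers $$z_i,\ \wp(z_i),\ \zeta(z_i),\ \sigma(z_i),\ e^{t_1z_i},\dots,e^{t_rz_i},\ f_{u_1}(z_i),\dots,f_{u_s}(z_i)\qquad(i=1,\dots,n)$$ are algebraically independent over $K(g_2,g_3)$. 2. Assume that the elliptic curve $E$ has complex multiplication; let $k$ be the field of endomorphisms of $E$. Let $\alpha_1,\dots,\alpha_s$ be elements of $\mathrm{End}(E)\smallsetminus\mathbb{Z}$. Assume that $\omega_1,u_1,\dots,u_s$ are linearly independent over $k$. Then for almost all $n$-tuples $(z_1,\dots,z_n)$ of complex numbers, the $n(4+r+2s)$ numbers $$z_i,\ \wp(z_i),\ \zeta(z_i),\ \sigma(z_i),\ e^{t_1z_i},\dots,e^{t_rz_i},\ f_{u_1}(z_i),\dots,f_{u_s}(z_i),\ f_{u_1}(\alpha_1z_i),\dots,f_{u_s}(\alpha_sz_i)\qquad(i=1,\dots,n)$$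 are algebraically independent over $K(g_2,g_3)$.
   Context: For a lattice $\Omega=\mathbb{Z}\omega_1+\mathbb{Z}\omega_2$ in $\mathbb{C}$, the Weierstrass sigma function is $\sigma(z)=z\prod_{\omega\in\Omega\smallsetminus\{0\}}\left(1-\frac z\omega\right)\exp\left(\frac z\omega+\frac{z^2}{2\omega^2}\right)$, the Weierstrass zeta function is $\zeta=\sigma'/\sigma$, and the Weierstrass elliptic function is $\wp=-\zeta'$; $g_2,g_3$ are the invariants, so that $\wp'^2=4\wp^3-g_2\wp-g_3$. For $u\in\mathbb{C}\smallsetminus\Omega$ the Serre function is $f_u(z)=\frac{\sigma(z+u)}{\sigma(z)\sigma(u)}e^{-\zeta(u)z}$. $E$ is the elliptic curve with period lattice $\Omega$. The ring $\mathrm{End}(E)$ is identified with $\{\alpha\in\mathbb{C}: \alpha\Omega\subset\Omega\}$, and $k=\mathrm{End}(E)\otimes_{\mathbb{Z}}\mathbb{Q}$ is the field of endomorphisms of $E$; $E$ has complex multiplication when $\mathrm{End}(E)\neq\mathbb{Z}$, in which case $k=\mathbb{Q}(\omega_2/\omega_1)$ is imaginary quadratic. "Almost all" means outside a subset of $\mathbb{C}^n$ of Lebesgue measure zero (in particular tuples where some function has a pole may be discarded). *)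

theory Defs
  imports
    "HOL-Analysis.Analysis"
    "HOL-Library.Poly_Mapping"
    "HOL-Algebra.Generated_Fields"
    "HOL-Algebra.Algebraic_Closure_Type"
begin

section \<open>Algebra over subfields of the complex numbers\<close>

text \<open>
  The subfield of the complex numbers generated by \<open>S\<close> is \<open>generate_field CC S\<close>; as it contains 1,
  it is the field generated by \<open>S\<close> over the rationals. For a subfield \<open>F\<close>, the linear independence
  over \<open>F\<close> of a family \<open>x\<^sub>1, \<dots>, x\<^sub>m\<close>, given as a list, is \<open>ring.independent CC F [x\<^sub>1, \<dots>, x\<^sub>m]\<close>
  (repetitions in the list make it dependent).
\<close>

abbreviation CC :: "complex ring" where
  "CC \<equiv> ring_of_type_algebra"

text \<open>
  A polynomial in variables indexed by \<open>'i\<close> is a finitely supported map from monomials to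
  coefficients, a monomial being a finitely supported map from variables to exponents.
\<close>

definition poly_eval :: "('i \<Rightarrow> complex) \<Rightarrow> (('i \<Rightarrow>\<^sub>0 nat) \<Rightarrow>\<^sub>0 complex) \<Rightarrow> complex" where
  "poly_eval x p =
     (\<Sum>m\<in>Poly_Mapping.keys p.
        Poly_Mapping.lookup p m * (\<Prod>i\<in>Poly_Mapping.keys m. x i ^ Poly_Mapping.lookup m i))"

definition algebraically_independent :: "complex set \<Rightarrow> 'i set \<Rightarrow> ('i \<Rightarrow> complex) \<Rightarrow> bool" where
  "algebraically_independent F I x \<longleftrightarrow>
     (\<forall>p :: ('i \<Rightarrow>\<^sub>0 nat) \<Rightarrow>\<^sub>0 complex.
        (\<forall>m\<in>Poly_Mapping.keys p. Poly_Mapping.lookup p m \<in> F \<and> Poly_Mapping.keys m \<subseteq> I) \<and>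
        poly_eval x p = 0 \<longrightarrow> p = 0)"

section \<open>Weierstrass and Serre functions of a lattice\<close>

definition period_lattice :: "complex \<Rightarrow> complex \<Rightarrow> complex set" where
  "period_lattice \<omega>1 \<omega>2 = {of_int a * \<omega>1 + of_int b * \<omega>2 | a b. True}"

text \<open>
  The product is taken unconditionally, as the limit of the products over finite sets of nonzero
  periods; it converges because the factors are \<open>1 + O(1 / \<bar>\<omega>\<bar>\<^sup>3)\<close>.
\<close>

definition weierstrass_sigma :: "complex set \<Rightarrow> complex \<Rightarrow> complex" where
  "weierstrass_sigma \<Omega> z =
     z * Lim (finite_subsets_at_top (\<Omega> - {0}))
           (\<lambda>A. \<Prod>\<omega>\<in>A. (1 - z / \<omega>) * exp (z / \<omega> + z\<^sup>2 / (2 * \<omega>\<^sup>2)))"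

text \<open>
  At their poles, and for \<open>u \<in> \<Omega>\<close> in the Serre functions, the definitions below yield arbitrary values.
\<close>

definition weierstrass_zeta :: "complex set \<Rightarrow> complex \<Rightarrow> complex" where
  "weierstrass_zeta \<Omega> z = deriv (weierstrass_sigma \<Omega>) z / weierstrass_sigma \<Omega> z"

definition weierstrass_wp :: "complex set \<Rightarrow> complex \<Rightarrow> complex" where
  "weierstrass_wp \<Omega> z = - deriv (weierstrass_zeta \<Omega>) z"

definition serre :: "complex set \<Rightarrow> complex \<Rightarrow> complex \<Rightarrow> complex" where
  "serre \<Omega> u z =
     weierstrass_sigma \<Omega> (z + u) / (weierstrass_sigma \<Omega> z * weierstrass_sigma \<Omega> u)
       * exp (- weierstrass_zeta \<Omega> u * z)"

text \<open>
  The invariants, in the normalisation for which \<open>\<wp>'\<^sup>2 = 4 \<wp>\<^sup>3 - g\<^sub>2 \<wp> - g\<^sub>3\<close>.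
\<close>

definition invariant_g2 :: "complex set \<Rightarrow> complex" where
  "invariant_g2 \<Omega> = 60 * (\<Sum>\<^sub>\<infinity>\<omega>\<in>\<Omega> - {0}. 1 / \<omega> ^ 4)"

definition invariant_g3 :: "complex set \<Rightarrow> complex" where
  "invariant_g3 \<Omega> = 140 * (\<Sum>\<^sub>\<infinity>\<omega>\<in>\<Omega> - {0}. 1 / \<omega> ^ 6)"

section \<open>Endomorphisms of the elliptic curve with period lattice \<open>\<Omega>\<close>\<close>

definition endomorphisms :: "complex set \<Rightarrow> complex set" where
  "endomorphisms \<Omega> = {\<alpha>. \<forall>\<omega>\<in>\<Omega>. \<alpha> * \<omega> \<in> \<Omega>}"

text \<open>
  The tensor product of the endomorphism ring with the rationals, realised inside the complex
  numbers: clearing denominators shows that each of its elements is a pure tensor.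
\<close>

definition endomorphism_field :: "complex set \<Rightarrow> complex set" where
  "endomorphism_field \<Omega> = {of_rat q * \<alpha> | q \<alpha>. \<alpha> \<in> endomorphisms \<Omega>}"

definition complex_multiplication :: "complex set \<Rightarrow> bool" where
  "complex_multiplication \<Omega> \<longleftrightarrow> endomorphisms \<Omega> \<noteq> \<int>"

end

theory Submission
  imports Defs "HOL-Complex_Analysis.Complex_Analysis"
begin

text \<open>
  Translation by a period \<open>v\<close> adds a constant \<open>\<eta> v\<close> to \<open>\<zeta>\<close>, multiplies \<open>\<sigma>\<close> by \<open>C exp(\<eta> v z)\<close> with
  \<open>C\<^sup>2 = exp(\<eta> v v)\<close>, and multiplies each of the functions \<open>exp(t z)\<close>, \<open>f\<^sub>u(z)\<close>, \<open>f\<^sub>u(\<alpha> z)\<close> by a constant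
  \<open>exp(A \<eta> v + B v)\<close>. A polynomial relation between the functions, evaluated along the translates of a point,
  is therefore a vanishing combination of Gaussians (from \<open>\<sigma>\<close>), exponentials and polynomials in the
  coordinates of the period, which must vanish term by term. The linear independence hypotheses make the
  exponentials of distinct monomials distinct: by the Legendre relation, a trivial character
  \<open>exp(A \<eta> v + B v)\<close> forces \<open>A\<close> into the rational span of the periods. So the functions are algebraically
  independent over the complex numbers. The coefficient field is countable, and each of the countably many
  polynomial relations defines an analytic set of measure zero, by Fubini and because a nonzero holomorphic
  function has countably many zeros.
\<close>

section \<open>Periods\<close>

text \<open>The value \<open>2 pi i\<close> of the Legendre determinant is never computed.
  Translating \<open>\<sigma>\<close> by two periods in either order shows that
  \<open>\<eta> v * w - \<eta> w * v\<close> is an integer multiple of \<open>2 pi i\<close>, and a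
  Liouville argument shows that it is nonzero; as only rational spans matter, this is enough. The
  Gaussians of \<open>\<sigma>\<close> along the multiples of \<open>v\<close> have base
  \<open>exp (\<eta> v * v / 2)\<close>. A base of modulus 1 separates nothing, so a period with
  \<open>Re (\<eta> v * v) \<noteq> 0\<close> has to be found. For \<open>f_u(\<alpha> z)\<close>
  the coefficient \<open>A\<close> is \<open>\<alpha>' * u\<close> with the conjugate
  \<open>\<alpha>'\<close> of \<open>\<alpha>\<close>. A trivial character thus puts a sum of terms
  \<open>(k + l \<alpha>') u\<close> into the rational span of the periods, and a nonintegral, hence
  nonreal, \<open>\<alpha>\<close> keeps \<open>k\<close> and \<open>l\<close> apart. Once these
  vanish, \<open>B\<close> is a combination of the \<open>t\<close> alone. All exceptional sets
  (poles, and zeros of the factors) are countable, which takes the place of any study of orders of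
  zeros and poles.\<close>

lemma summable_on_int_powr:
  "(\<lambda>a::int. max 1 \<bar>real_of_int a\<bar> powr (-3/2)) summable_on UNIV"
proof -
  have s: "summable (\<lambda>n::nat. max 1 (real n) powr (-3/2))"
  proof -
    have "\<forall>\<^sub>F n::nat in sequentially. max 1 (real n) powr (-3/2) = real n powr (-3/2)"
      using eventually_ge_at_top[of 1] by eventually_elim (auto simp: max_def)
    then have "summable (\<lambda>n::nat. max 1 (real n) powr (-3/2)) \<longleftrightarrow> summable (\<lambda>n. real n powr (-3/2))"
      by (rule summable_cong)
    then show ?thesis by (simp add: summable_real_powr_iff)
  qed
  then have n: "(\<lambda>n::nat. max 1 (real n) powr (-3/2)) summable_on UNIV"
    by (intro norm_summable_imp_summable_on) simp
  have 1: "(\<lambda>a::int. max 1 \<bar>real_of_int a\<bar> powr (-3/2)) summable_on range int"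
    by (subst summable_on_reindex) (use n in \<open>auto simp: o_def\<close>)
  have 2: "(\<lambda>a::int. max 1 \<bar>real_of_int a\<bar> powr (-3/2)) summable_on range (\<lambda>n. - int n)"
    by (subst summable_on_reindex) (use n in \<open>auto simp: o_def inj_on_def\<close>)
  have "UNIV = range int \<union> range (\<lambda>n. - int n)"
    by (auto simp: image_iff) (metis int_cases2)
  then show ?thesis using summable_on_union[OF 1 2] by simp
qed

text \<open>The exponent \<open>3/2\<close> is half of the \<open>3\<close> used over the lattice:
  with \<open>m\<close> the larger absolute coordinate, \<open>m powr (-3)\<close> is at most the
  product of one factor for each coordinate. The maximum with \<open>1\<close> is for vanishing
  coordinates, since \<open>0 powr (-3/2)\<close> is \<open>0\<close> and would spoil the
  comparison.\<close>

lemma summable_on_int_prod_powr: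
  "(\<lambda>(a::int, b::int). max 1 \<bar>real_of_int a\<bar> powr (-3/2) * max 1 \<bar>real_of_int b\<bar> powr (-3/2))
     summable_on UNIV"
proof -
  let ?h = "\<lambda>a::int. max 1 \<bar>real_of_int a\<bar> powr (-3/2)"
  have "(\<lambda>(a, b). ?h a * ?h b) summable_on UNIV \<times> UNIV"
    by (rule summable_on_SigmaI[where g = "\<lambda>a. ?h a * infsum ?h UNIV"])
      (use summable_on_int_powr in \<open>auto intro!: has_sum_cmult_right has_sum_infsum summable_on_cmult_left\<close>)
  then show ?thesis by simp
qed

locale complex_lattice =
  fixes \<omega>1 \<omega>2 :: complex and \<Omega> :: "complex set"
  assumes real_indep: "of_real a * \<omega>1 + of_real b * \<omega>2 = 0 \<Longrightarrow> a = 0 \<and> b = 0"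
    and lattice_eq: "\<Omega> = period_lattice \<omega>1 \<omega>2"
begin

lemma mem_lattice: "z \<in> \<Omega> \<longleftrightarrow> (\<exists>a b::int. z = of_int a * \<omega>1 + of_int b * \<omega>2)"
  by (auto simp: lattice_eq period_lattice_def)

lemma zero_mem [simp, intro]: "0 \<in> \<Omega>"
  unfolding mem_lattice by (intro exI[of _ 0]) simp

lemma gen1 [simp, intro]: "\<omega>1 \<in> \<Omega>"
  unfolding mem_lattice by (rule exI[of _ 1], rule exI[of _ 0]) simp

lemma gen2 [simp, intro]: "\<omega>2 \<in> \<Omega>"
  unfolding mem_lattice by (rule exI[of _ 0], rule exI[of _ 1]) simp

lemma add_mem [intro]: "x \<in> \<Omega> \<Longrightarrow> y \<in> \<Omega> \<Longrightarrow> x + y \<in> \<Omega>"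
proof -
  assume "x \<in> \<Omega>" "y \<in> \<Omega>"
  then obtain a b c d where "x = of_int a * \<omega>1 + of_int b * \<omega>2" "y = of_int c * \<omega>1 + of_int d * \<omega>2"
    unfolding mem_lattice by blast
  then have "x + y = of_int (a + c) * \<omega>1 + of_int (b + d) * \<omega>2" by (simp add: algebra_simps)
  then show ?thesis unfolding mem_lattice by blast
qed

lemma uminus_mem [intro]: "x \<in> \<Omega> \<Longrightarrow> - x \<in> \<Omega>"
proof -
  assume "x \<in> \<Omega>"
  then obtain a b where "x = of_int a * \<omega>1 + of_int b * \<omega>2"
    unfolding mem_lattice by blast
  then have "- x = of_int (- a) * \<omega>1 + of_int (- b) * \<omega>2" by (simp add: algebra_simps)
  then show ?thesis unfolding mem_lattice by blast
qed

lemma uminus_mem_iff [simp]: "- x \<in> \<Omega> \<longleftrightarrow> x \<in> \<Omega>"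
  using uminus_mem[of x] uminus_mem[of "- x"] by auto

lemma add_mem_iff: "w \<in> \<Omega> \<Longrightarrow> z + w \<in> \<Omega> \<longleftrightarrow> z \<in> \<Omega>"
  using add_mem[of "z + w" "- w"] add_mem[of z w] by auto

lemma diff_mem [intro]: "x \<in> \<Omega> \<Longrightarrow> y \<in> \<Omega> \<Longrightarrow> x - y \<in> \<Omega>"
  using add_mem[of x "- y"] by auto

lemma gen_nonzero: "\<omega>1 \<noteq> 0" "\<omega>2 \<noteq> 0"
  using real_indep[of 1 0] real_indep[of 0 1] by auto

text \<open>This is the signed area of the period parallelogram. If it vanished,
  \<open>cnj \<omega>1 * \<omega>2\<close> would be real, and multiplication by
  \<open>\<omega>1\<close> would give a real relation between the generators.\<close>

lemma Im_cnj_gen_nonzero: "Im (cnj \<omega>1 * \<omega>2) \<noteq> 0"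
proof
  assume 0: "Im (cnj \<omega>1 * \<omega>2) = 0"
  have "of_real (Re (cnj \<omega>1 * \<omega>2)) * \<omega>1 + of_real (- (cmod \<omega>1)\<^sup>2) * \<omega>2 = 0"
  proof -
    have "of_real (Re (cnj \<omega>1 * \<omega>2)) = cnj \<omega>1 * \<omega>2"
      using 0 by (simp add: complex_eq_iff)
    moreover have "of_real ((cmod \<omega>1)\<^sup>2) = cnj \<omega>1 * \<omega>1"
      by (metis complex_norm_square mult.commute)
    ultimately show ?thesis by (simp add: algebra_simps)
  qed
  from real_indep[OF this] show False using gen_nonzero by simp
qed

text \<open>By Cramer's rule each coordinate of a point is a signed area divided by that of the
  period parallelogram; adding the moduli of both generators gives one constant for both
  coordinates.\<close>

definition lattice_bound :: real where
  "lattice_bound = (cmod \<omega>1 + cmod \<omega>2) / \<bar>Im (cnj \<omega>1 * \<omega>2)\<bar>"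

lemma lattice_bound_pos: "lattice_bound > 0"
  unfolding lattice_bound_def using gen_nonzero Im_cnj_gen_nonzero by (simp add: add_pos_pos)

lemma coords_le:
  fixes a b :: int
  shows "\<bar>real_of_int a\<bar> \<le> lattice_bound * cmod (of_int a * \<omega>1 + of_int b * \<omega>2)"
    and "\<bar>real_of_int b\<bar> \<le> lattice_bound * cmod (of_int a * \<omega>1 + of_int b * \<omega>2)"
proof -
  define z where "z = of_int a * \<omega>1 + of_int b * \<omega>2"
  define D where "D = Im (cnj \<omega>1 * \<omega>2)"
  have D: "D \<noteq> 0" unfolding D_def by (rule Im_cnj_gen_nonzero)
  have "Im (cnj \<omega>1 * z) = b * D" "Im (cnj \<omega>2 * z) = - a * D"
    by (simp_all add: z_def D_def algebra_simps)
  moreover have "\<bar>Im (cnj \<omega>1 * z)\<bar> \<le> cmod \<omega>1 * cmod z" "\<bar>Im (cnj \<omega>2 * z)\<bar> \<le> cmod \<omega>2 * cmod z"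
    by (metis abs_Im_le_cmod complex_mod_cnj norm_mult)+
  ultimately have "\<bar>b\<bar> * \<bar>D\<bar> \<le> cmod \<omega>1 * cmod z" "\<bar>a\<bar> * \<bar>D\<bar> \<le> cmod \<omega>2 * cmod z"
    by (auto simp: abs_mult)
  moreover have "cmod \<omega>1 * cmod z \<le> (cmod \<omega>1 + cmod \<omega>2) * cmod z" "cmod \<omega>2 * cmod z \<le> (cmod \<omega>1 + cmod \<omega>2) * cmod z"
    by (simp_all add: mult_right_mono)
  ultimately have "\<bar>b\<bar> * \<bar>D\<bar> \<le> (cmod \<omega>1 + cmod \<omega>2) * cmod z" "\<bar>a\<bar> * \<bar>D\<bar> \<le> (cmod \<omega>1 + cmod \<omega>2) * cmod z"
    by linarith+
  then show "\<bar>real_of_int a\<bar> \<le> lattice_bound * cmod (of_int a * \<omega>1 + of_int b * \<omega>2)"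
    "\<bar>real_of_int b\<bar> \<le> lattice_bound * cmod (of_int a * \<omega>1 + of_int b * \<omega>2)"
    unfolding lattice_bound_def z_def[symmetric] D_def[symmetric] using D by (simp_all add: pos_le_divide_eq)
qed

lemma coords_unique:
  fixes a b c d :: int
  assumes "of_int a * \<omega>1 + of_int b * \<omega>2 = of_int c * \<omega>1 + of_int d * \<omega>2"
  shows "a = c \<and> b = d"
  using real_indep[of "a - c" "b - d"] assms by (simp add: algebra_simps)

lemma finite_lattice_ball: "finite {w \<in> \<Omega>. cmod w \<le> R}"
proof (rule finite_subset)
  define N where "N = \<lceil>lattice_bound * \<bar>R\<bar>\<rceil>"
  show "{w \<in> \<Omega>. cmod w \<le> R} \<subseteq> (\<lambda>(a, b). of_int a * \<omega>1 + of_int b * \<omega>2) ` ({-N..N} \<times> {-N..N})"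
  proof
    fix w assume "w \<in> {w \<in> \<Omega>. cmod w \<le> R}"
    then obtain a b :: int where w: "w = of_int a * \<omega>1 + of_int b * \<omega>2" "cmod w \<le> R"
      unfolding mem_lattice by blast
    have "lattice_bound * cmod w \<le> lattice_bound * \<bar>R\<bar>"
      using lattice_bound_pos w(2) by (intro mult_left_mono) auto
    then have "\<bar>real_of_int a\<bar> \<le> lattice_bound * \<bar>R\<bar>" "\<bar>real_of_int b\<bar> \<le> lattice_bound * \<bar>R\<bar>"
      using coords_le(1)[of a b] coords_le(2)[of b a] w(1) by auto
    then have "\<bar>a\<bar> \<le> N" "\<bar>b\<bar> \<le> N" unfolding N_def by linarith+
    then show "w \<in> (\<lambda>(a, b). of_int a * \<omega>1 + of_int b * \<omega>2) ` ({-N..N} \<times> {-N..N})"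
      using w(1) by (auto intro!: image_eqI[of _ _ "(a, b)"])
  qed
qed auto

lemma countable_lattice: "countable \<Omega>"
proof -
  have "\<Omega> = range (\<lambda>(a::int, b::int). of_int a * \<omega>1 + of_int b * \<omega>2)"
    by (fastforce simp: mem_lattice)
  then show ?thesis by (metis countable_image uncountable_def countableI_type)
qed

lemma closed_lattice: "closed \<Omega>"
proof -
  have "\<not> z islimpt \<Omega>" for z
  proof
    assume "z islimpt \<Omega>"
    then have "infinite (\<Omega> \<inter> ball z 1)" by (simp add: islimpt_eq_infinite_ball)
    moreover have "\<Omega> \<inter> ball z 1 \<subseteq> {w \<in> \<Omega>. cmod w \<le> cmod z + 1}"
      by (auto simp: dist_norm) (smt (verit) norm_triangle_ineq2 norm_minus_commute)
    ultimately show False using finite_lattice_ball finite_subset by blast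
  qed
  then show ?thesis by (simp add: closed_limpt)
qed

lemma open_compl_lattice: "open (- \<Omega>)"
  using closed_lattice by auto

text \<open>The exponent \<open>3\<close> is the order to which the factors of
  \<open>\<sigma>\<close> differ from 1, so this sum majorises the logarithms in the
  product.\<close>

lemma summable_lattice: "(\<lambda>w. 1 / cmod w ^ 3) summable_on (\<Omega> - {0})"
proof -
  let ?e = "\<lambda>(a::int, b::int). of_int a * \<omega>1 + of_int b * \<omega>2"
  let ?h = "\<lambda>(a::int, b::int). max 1 \<bar>real_of_int a\<bar> powr (-3/2) * max 1 \<bar>real_of_int b\<bar> powr (-3/2)"
  let ?X = "UNIV - {(0::int, 0::int)}"
  have inj: "inj_on ?e ?X"
    by (auto simp: inj_on_def dest: coords_unique)
  have im: "?e ` ?X = \<Omega> - {0}"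
  proof
    have "?e (a, b) \<noteq> 0" if "(a, b) \<noteq> (0, 0)" for a b
      using coords_unique[of a b 0 0] that by auto
    moreover have "?e x \<in> \<Omega>" for x by (cases x) (auto simp: mem_lattice)
    ultimately show "?e ` ?X \<subseteq> \<Omega> - {0}" by fastforce
    show "\<Omega> - {0} \<subseteq> ?e ` ?X"
    proof
      fix x assume x: "x \<in> \<Omega> - {0}"
      then obtain a b where "x = ?e (a, b)" by (auto simp: mem_lattice)
      moreover from this have "(a, b) \<noteq> (0, 0)" using x by auto
      ultimately show "x \<in> ?e ` ?X" by blast
    qed
  qed
  have "(\<lambda>x. lattice_bound ^ 3 * ?h x) summable_on UNIV"
    using summable_on_int_prod_powr by (rule summable_on_cmult_right)
  then have "(\<lambda>x. lattice_bound ^ 3 * ?h x) summable_on ?X"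
    by (rule summable_on_subset_banach) auto
  then have "(\<lambda>x. 1 / cmod (?e x) ^ 3) summable_on ?X"
  proof (rule summable_on_comparison_test)
    fix x assume x: "x \<in> ?X"
    obtain a b where ab: "x = (a, b)" by (cases x)
    define m where "m = max \<bar>real_of_int a\<bar> \<bar>real_of_int b\<bar>"
    have "a \<noteq> 0 \<or> b \<noteq> 0" using x ab by auto
    then have m: "m \<ge> 1" "max 1 \<bar>real_of_int a\<bar> \<le> m" "max 1 \<bar>real_of_int b\<bar> \<le> m"
      unfolding m_def by auto
    have mle: "m \<le> lattice_bound * cmod (?e x)"
      unfolding m_def ab using coords_le(1)[of a b] coords_le(2)[of b a] by auto
    then have pos: "cmod (?e x) > 0" using m(1) lattice_bound_pos
      by (smt (verit, best) mult_nonneg_nonpos norm_ge_zero)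
    have "m powr (-3/2) * m powr (-3/2) \<le> max 1 \<bar>real_of_int a\<bar> powr (-3/2) * max 1 \<bar>real_of_int b\<bar> powr (-3/2)"
      using m by (intro mult_mono powr_mono2') auto
    then have "m powr (-3) \<le> ?h x" unfolding ab by (simp add: powr_add[symmetric])
    moreover have "m powr (-3) = 1 / m ^ 3"
      using m by (simp add: powr_minus powr_numeral divide_inverse)
    ultimately have "1 / m ^ 3 \<le> ?h x" by simp
    moreover have "1 / cmod (?e x) ^ 3 \<le> lattice_bound ^ 3 * (1 / m ^ 3)"
    proof -
      have "m ^ 3 \<le> lattice_bound ^ 3 * cmod (?e x) ^ 3"
        using power_mono[OF mle, of 3] m by (simp add: power_mult_distrib)
      then show ?thesis using m pos by (simp add: field_simps)
    qed
    moreover have "lattice_bound ^ 3 * (1 / m ^ 3) \<le> lattice_bound ^ 3 * ?h x"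
      using lattice_bound_pos calculation(1) by (intro mult_left_mono) auto
    ultimately show "1 / cmod (?e x) ^ 3 \<le> lattice_bound ^ 3 * ?h x"
      by simp
  qed auto
  then show ?thesis
    unfolding im[symmetric] by (subst summable_on_reindex[OF inj]) (simp add: o_def)
qed

end

section \<open>The Weierstrass functions\<close>

text \<open>Serves to split finitely many factors off an unconditional product, and to pass between
  finite sets of periods and finite sets of nonzero periods.\<close>

lemma filterlim_diff_finite_subsets_at_top:
  "filterlim (\<lambda>A. A - B) (finite_subsets_at_top (U - B)) (finite_subsets_at_top U)"
  unfolding filterlim_finite_subsets_at_top
proof safe
  fix Y assume "finite Y" "Y \<subseteq> U - B"
  then show "\<forall>\<^sub>F A in finite_subsets_at_top U. finite (A - B) \<and> Y \<subseteq> A - B \<and> A - B \<subseteq> U - B"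
    unfolding eventually_finite_subsets_at_top by (intro exI[of _ Y]) auto
qed

lemma filterlim_image_finite_subsets_at_top:
  assumes "bij_betw h U Y"
  shows "filterlim ((`) h) (finite_subsets_at_top Y) (finite_subsets_at_top U)"
  using filtermap_image_finite_subsets_at_top[of h U] assms
  by (simp add: filterlim_def bij_betw_def)

context complex_lattice
begin

abbreviation \<sigma> :: "complex \<Rightarrow> complex" where "\<sigma> \<equiv> weierstrass_sigma \<Omega>"
abbreviation \<zeta> :: "complex \<Rightarrow> complex" where "\<zeta> \<equiv> weierstrass_zeta \<Omega>"
abbreviation wp :: "complex \<Rightarrow> complex" where "wp \<equiv> weierstrass_wp \<Omega>"

section \<open>The product for \<open>\<sigma>\<close>: uniform convergence, zeros, parity\<close>

text \<open>For \<open>cmod w > 2 * R\<close> the argument \<open>z / w\<close> stays in the disc of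
  radius 1/2, where the factor is close enough to 1 to have a principal logarithm. The product of
  these factors is the exponential of a uniformly convergent sum and has no zeros; the finitely many
  factors in \<open>A0\<close> carry all zeros in the disc.\<close>

lemma factor_product_uniform_limit:
  assumes "R > 0"
  obtains g where
    "uniform_limit (cball 0 R) (\<lambda>A z. \<Prod>w\<in>A. weierstrass_factor 2 (z / w)) g (finite_subsets_at_top (\<Omega> - {0}))"
    "continuous_on (cball 0 R) g"
    "\<And>z. z \<in> cball 0 R \<Longrightarrow> g z = 0 \<longleftrightarrow> z \<in> \<Omega> - {0}"
proof -
  let ?F = "weierstrass_factor 2"
  define A0 where "A0 = {w \<in> \<Omega>. cmod w \<le> 2 * R} - {0}"
  define U where "U = \<Omega> - {0} - A0"
  define l where "l = (\<lambda>w z. Ln (?F (z / w)))"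
  \<comment> \<open>The \<open>6\<close> is the \<open>3\<close> of the estimate of the genus 2
    factor times the \<open>2\<close> of the bound for \<open>Ln\<close> near 1.\<close>
  define M where "M = (\<lambda>w::complex. 6 * R ^ 3 * (1 / cmod w ^ 3))"
  define p where "p = (\<lambda>z. \<Prod>w\<in>A0. ?F (z / w))"
  define H where "H = (\<lambda>z. \<Sum>\<^sub>\<infinity>w\<in>U. l w z)"
  have finA0: "finite A0" unfolding A0_def using finite_lattice_ball by auto
  have bnd: "norm (?F (z / w) - 1) \<le> 3 * (R ^ 3 * (1 / cmod w ^ 3))" "norm (?F (z / w) - 1) < 1/2"
    if "w \<in> U" "z \<in> cball 0 R" for w z
  proof -
    have w: "cmod w > 2 * R" using that(1) by (auto simp: U_def A0_def)
    then have w0: "cmod w > 0" using assms by linarith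
    have z: "cmod z \<le> R" using that by simp
    have "norm (z / w) \<le> R / cmod w" using z w0 by (simp add: norm_divide divide_right_mono)
    moreover have "R / cmod w \<le> 1 / 2" using w w0 by (simp add: field_simps)
    ultimately have half: "norm (z / w) \<le> 1/2" by linarith
    have "norm (?F (z / w) - 1) \<le> 3 * norm (z / w) ^ 3"
      using weierstrass_factor_bound[OF half, of 2] by (simp add: numeral_3_eq_3 numeral_2_eq_2)
    moreover have "norm (z / w) ^ 3 \<le> (R / cmod w) ^ 3"
      using \<open>norm (z / w) \<le> R / cmod w\<close> by (intro power_mono) auto
    moreover have "norm (z / w) ^ 3 \<le> (1/2) ^ 3"
      using half by (intro power_mono) auto
    ultimately show "norm (?F (z / w) - 1) \<le> 3 * (R ^ 3 * (1 / cmod w ^ 3))" "norm (?F (z / w) - 1) < 1/2"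
      by (auto simp: power_divide)
  qed
  have lM: "norm (l w z) \<le> M w" if "w \<in> U" "z \<in> cball 0 R" for w z
    using norm_Ln_le[OF bnd(2)[OF that]] bnd(1)[OF that] by (simp add: l_def M_def)
  have expl: "exp (l w z) = ?F (z / w)" if "w \<in> U" "z \<in> cball 0 R" for w z
  proof -
    have "?F (z / w) \<noteq> 0" using bnd(2)[OF that] by (auto simp del: weierstrass_factor_eq_0_iff)
    then show ?thesis by (simp add: l_def exp_Ln del: weierstrass_factor_eq_0_iff)
  qed
  have sumM: "M summable_on U"
    unfolding M_def U_def
    by (rule summable_on_cmult_right, rule summable_on_subset_banach[OF summable_lattice]) auto
  have M0: "M w \<ge> 0" for w using assms by (simp add: M_def)
  have ulH: "uniform_limit (cball 0 R) (\<lambda>A z. \<Sum>w\<in>A. l w z) H (finite_subsets_at_top U)"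
    unfolding H_def by (rule Weierstrass_m_test_general[OF lM sumM])
  have ulE: "uniform_limit (cball 0 R) (\<lambda>A z. exp (\<Sum>w\<in>A. l w z)) (\<lambda>z. exp (H z)) (finite_subsets_at_top U)"
  proof (rule uniform_limit_compose_uniformly_continuous_on[OF ulH])
    \<comment> \<open>\<open>exp\<close> is uniformly continuous only on bounded sets; every partial
      sum stays in the disc whose radius is the total of the majorants.\<close>
    show "uniformly_continuous_on (cball (0::complex) (infsum M U)) exp"
      by (intro compact_uniformly_continuous continuous_intros) auto
    show "\<forall>\<^sub>F A in finite_subsets_at_top U. \<forall>z\<in>cball 0 R. (\<Sum>w\<in>A. l w z) \<in> cball 0 (infsum M U)"
    proof (rule eventually_finite_subsets_at_top_weakI, intro ballI)
      fix A z assume A: "finite A" "A \<subseteq> U" and z: "z \<in> cball (0::complex) R"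
      have "norm (\<Sum>w\<in>A. l w z) \<le> (\<Sum>w\<in>A. M w)"
        using A z by (intro sum_norm_le lM) auto
      also have "\<dots> \<le> infsum M U"
        using A sumM M0 by (intro finite_sum_le_infsum) auto
      finally show "(\<Sum>w\<in>A. l w z) \<in> cball 0 (infsum M U)" by simp
    qed
  qed auto
  have l_cont: "continuous_on (cball 0 R) (l w)" if "w \<in> U" for w
  proof -
    have "?F (z / w) \<notin> \<real>\<^sub>\<le>\<^sub>0" if "z \<in> cball 0 R" for z
    proof
      assume "?F (z / w) \<in> \<real>\<^sub>\<le>\<^sub>0"
      then have "Re (?F (z / w)) \<le> 0" by (auto simp: complex_nonpos_Reals_iff)
      moreover have "\<bar>Re (?F (z / w) - 1)\<bar> < 1/2"
        using bnd(2)[OF \<open>w \<in> U\<close> that] abs_Re_le_cmod[of "?F (z / w) - 1"] by linarith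
      ultimately show False by auto
    qed
    moreover have "w \<noteq> 0" using that by (auto simp: U_def)
    ultimately show ?thesis unfolding l_def by (intro continuous_intros) auto
  qed
  have H_cont: "continuous_on (cball 0 R) H"
  proof (rule uniform_limit_theorem[OF _ ulH])
    show "\<forall>\<^sub>F A in finite_subsets_at_top U. continuous_on (cball 0 R) (\<lambda>z. \<Sum>w\<in>A. l w z)"
      using l_cont by (intro eventually_finite_subsets_at_top_weakI continuous_on_sum) auto
  qed auto
  have p_cont: "continuous_on (cball 0 R) p"
    unfolding p_def A0_def by (intro continuous_intros) auto
  have ul: "uniform_limit (cball 0 R) (\<lambda>A z. p z * exp (\<Sum>w\<in>A. l w z)) (\<lambda>z. p z * exp (H z)) (finite_subsets_at_top U)"
    using p_cont H_cont
    by (intro uniform_lim_mult uniform_limit_const ulE compact_imp_bounded compact_continuous_image continuous_intros) auto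
  have fl: "filterlim (\<lambda>A. A - A0) (finite_subsets_at_top U) (finite_subsets_at_top (\<Omega> - {0}))"
    unfolding U_def by (rule filterlim_diff_finite_subsets_at_top)
  have ul2: "uniform_limit (cball 0 R) (\<lambda>A z. p z * exp (\<Sum>w\<in>A - A0. l w z)) (\<lambda>z. p z * exp (H z)) (finite_subsets_at_top (\<Omega> - {0}))"
    using filterlim_compose[OF ul fl] .
  have ev: "\<forall>\<^sub>F A in finite_subsets_at_top (\<Omega> - {0}). \<forall>z\<in>cball 0 R.
      p z * exp (\<Sum>w\<in>A - A0. l w z) = (\<Prod>w\<in>A. ?F (z / w))"
    unfolding eventually_finite_subsets_at_top
  proof (intro exI[of _ A0] conjI allI impI ballI)
    show "finite A0" "A0 \<subseteq> \<Omega> - {0}" using finA0 by (auto simp: A0_def)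
    fix A z assume A: "finite A \<and> A0 \<subseteq> A \<and> A \<subseteq> \<Omega> - {0}" and z: "z \<in> cball (0::complex) R"
    have "exp (\<Sum>w\<in>A - A0. l w z) = (\<Prod>w\<in>A - A0. ?F (z / w))"
      using A z by (subst exp_sum) (auto intro!: prod.cong expl simp: U_def)
    then show "p z * exp (\<Sum>w\<in>A - A0. l w z) = (\<Prod>w\<in>A. ?F (z / w))"
      unfolding p_def using A by (metis mult.commute prod.subset_diff)
  qed
  show thesis
  proof
    show "uniform_limit (cball 0 R) (\<lambda>A z. \<Prod>w\<in>A. ?F (z / w)) (\<lambda>z. p z * exp (H z)) (finite_subsets_at_top (\<Omega> - {0}))"
      using ul2 by (subst (asm) uniform_limit_cong[OF ev]) auto
    show "continuous_on (cball 0 R) (\<lambda>z. p z * exp (H z))"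
      by (intro continuous_intros p_cont H_cont)
    fix z assume z: "z \<in> cball (0::complex) R"
    have "p z = 0 \<longleftrightarrow> z \<in> A0"
      using finA0 by (auto simp: p_def prod_zero_iff) (auto simp: A0_def)
    also have "\<dots> \<longleftrightarrow> z \<in> \<Omega> - {0}" using z assms by (auto simp: A0_def)
    finally show "p z * exp (H z) = 0 \<longleftrightarrow> z \<in> \<Omega> - {0}" by simp
  qed
qed

lemma sigma_factor_eq:
  "(1 - z / w) * exp (z / w + z\<^sup>2 / (2 * w\<^sup>2)) = weierstrass_factor 2 (z / w)" for z w :: complex
proof -
  have "{Suc 0..2} = {1, 2::nat}" by auto
  then show ?thesis by (simp add: weierstrass_factor_def power_divide mult.commute)
qed

text \<open>The index sets range over the whole lattice, with \<open>z\<close> as the factor of the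
  period 0, because translation by a period does not preserve the set of nonzero periods.\<close>

definition sigma_part :: "complex set \<Rightarrow> complex \<Rightarrow> complex" where
  "sigma_part A z = z * (\<Prod>w\<in>A - {0}. weierstrass_factor 2 (z / w))"

lemma sigma_uniform_limit_and_zeros:
  assumes "R > 0"
  shows "uniform_limit (cball 0 R) sigma_part \<sigma> (finite_subsets_at_top \<Omega>)"
    and "\<And>z. z \<in> cball 0 R \<Longrightarrow> \<sigma> z = 0 \<longleftrightarrow> z \<in> \<Omega>"
proof -
  obtain g where g: "uniform_limit (cball 0 R) (\<lambda>A z. \<Prod>w\<in>A. weierstrass_factor 2 (z / w)) g (finite_subsets_at_top (\<Omega> - {0}))"
    "continuous_on (cball 0 R) g" "\<And>z. z \<in> cball 0 R \<Longrightarrow> g z = 0 \<longleftrightarrow> z \<in> \<Omega> - {0}"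
    using factor_product_uniform_limit[OF assms] by blast
  have \<sigma>: "\<sigma> z = z * g z" if "z \<in> cball 0 R" for z
  proof -
    have "((\<lambda>A. \<Prod>w\<in>A. weierstrass_factor 2 (z / w)) \<longlongrightarrow> g z) (finite_subsets_at_top (\<Omega> - {0}))"
      using tendsto_uniform_limitI[OF g(1) that] .
    then show ?thesis
      unfolding weierstrass_sigma_def sigma_factor_eq by (simp add: tendsto_Lim)
  qed
  then show "\<And>z. z \<in> cball 0 R \<Longrightarrow> \<sigma> z = 0 \<longleftrightarrow> z \<in> \<Omega>"
    using g(3) by auto
  have "uniform_limit (cball 0 R) (\<lambda>A z. z * (\<Prod>w\<in>A. weierstrass_factor 2 (z / w))) (\<lambda>z. z * g z) (finite_subsets_at_top (\<Omega> - {0}))"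
    using g by (intro uniform_lim_mult uniform_limit_const compact_imp_bounded compact_continuous_image continuous_intros) auto
  then have "uniform_limit (cball 0 R) (\<lambda>A z. z * (\<Prod>w\<in>A - {0}. weierstrass_factor 2 (z / w))) (\<lambda>z. z * g z) (finite_subsets_at_top \<Omega>)"
    using filterlim_compose[OF _ filterlim_diff_finite_subsets_at_top[of "{0}" \<Omega>]] by fast
  then show "uniform_limit (cball 0 R) sigma_part \<sigma> (finite_subsets_at_top \<Omega>)"
    by (subst uniform_limit_cong'[OF _ \<sigma>]) (auto simp: sigma_part_def)
qed

lemma sigma_eq_0_iff: "\<sigma> z = 0 \<longleftrightarrow> z \<in> \<Omega>"
  using sigma_uniform_limit_and_zeros(2)[of "cmod z + 1" z] add_nonneg_pos[of "cmod z" 1] by simp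

lemma sigma_part_holomorphic: "sigma_part A holomorphic_on UNIV"
  unfolding sigma_part_def by (intro holomorphic_intros) auto

text \<open>Locally uniform convergence of holomorphic functions passes to derivatives. Recording
  the limit of the derivatives gives the partial fractions of \<open>\<zeta>\<close> without a
  second convergence proof.\<close>

lemma sigma_derivative_limit:
  obtains g' where "\<And>z. (\<sigma> has_field_derivative g' z) (at z)"
    "\<And>z. ((\<lambda>A. deriv (sigma_part A) z) \<longlongrightarrow> g' z) (finite_subsets_at_top \<Omega>)"
proof -
  have "\<exists>g'. (\<sigma> has_field_derivative g') (at z) \<and>
      ((\<lambda>A. deriv (sigma_part A) z) \<longlongrightarrow> g') (finite_subsets_at_top \<Omega>)" for z
  proof -
    define R where "R = cmod z + 1"
    have R: "R > 0" unfolding R_def by (auto intro: add_nonneg_pos)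
    have z: "z \<in> ball 0 R" by (simp add: R_def)
    have ev: "\<forall>\<^sub>F A in finite_subsets_at_top \<Omega>. continuous_on (cball 0 R) (sigma_part A) \<and>
       (\<forall>w\<in>ball 0 R. (sigma_part A has_field_derivative deriv (sigma_part A) w) (at w))"
      by (intro always_eventually allI conjI ballI)
        (auto intro: holomorphic_on_imp_continuous_on holomorphic_on_subset[OF sigma_part_holomorphic]
          holomorphic_derivI[OF sigma_part_holomorphic])
    show ?thesis
      by (rule has_complex_derivative_uniform_limit[OF ev sigma_uniform_limit_and_zeros(1)[OF R] _ R]) (use z in auto)
  qed
  then show thesis using that by metis
qed

lemma sigma_holomorphic: "\<sigma> holomorphic_on A"
  using sigma_derivative_limit by (metis DERIV_subset UNIV_I holomorphic_on_def field_differentiable_def has_field_derivative_at_within)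

lemma sigma_part_tendsto: "((\<lambda>A. sigma_part A z) \<longlongrightarrow> \<sigma> z) (finite_subsets_at_top \<Omega>)"
  by (rule tendsto_uniform_limitI[OF sigma_uniform_limit_and_zeros(1)[of "cmod z + 1"]]) (auto intro: add_nonneg_pos)

text \<open>Reflection permutes the lattice and hence does not change the limit along finite
  subsets, while each partial product changes sign through its factor \<open>z\<close>.\<close>

lemma sigma_odd: "\<sigma> (- z) = - \<sigma> z"
proof -
  have bij: "bij_betw uminus \<Omega> \<Omega>"
    by (rule bij_betwI[of _ _ _ uminus]) auto
  have "((\<lambda>A. sigma_part (uminus ` A) z) \<longlongrightarrow> \<sigma> z) (finite_subsets_at_top \<Omega>)"
    using filterlim_compose[OF sigma_part_tendsto filterlim_image_finite_subsets_at_top[OF bij]] .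
  moreover have "sigma_part (uminus ` A) z = - sigma_part A (- z)" for A
  proof -
    have "uminus ` A - {0} = uminus ` (A - {0})" by auto
    then show ?thesis
      by (simp add: sigma_part_def prod.reindex inj_on_def)
  qed
  ultimately have "((\<lambda>A. - sigma_part A (- z)) \<longlongrightarrow> \<sigma> z) (finite_subsets_at_top \<Omega>)" by simp
  moreover have "((\<lambda>A. - sigma_part A (- z)) \<longlongrightarrow> - \<sigma> (- z)) (finite_subsets_at_top \<Omega>)"
    by (intro tendsto_intros sigma_part_tendsto)
  ultimately have "\<sigma> z = - \<sigma> (- z)" using tendsto_unique by (metis finite_subsets_at_top_neq_bot)
  then show ?thesis by simp
qed

section \<open>Partial fractions and quasi-periodicity of \<open>\<zeta>\<close>\<close>

text \<open>The logarithmic derivative of the factor of \<open>\<sigma>\<close> belonging to the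
  period \<open>w\<close>; summed over the lattice it is the Mittag-Leffler expansion of
  \<open>\<zeta>\<close>.\<close>

definition zeta_term :: "complex \<Rightarrow> complex \<Rightarrow> complex" where
  "zeta_term w z = (if w = 0 then 1 / z else 1 / (z - w) + 1 / w + z / w\<^sup>2)"

text \<open>Logarithmic differentiation turns the finite product into a sum;
  \<open>0 \<in> A\<close> lets the leading factor \<open>z\<close> of \<open>sigma_part\<close>
  account for the summand \<open>1 / z\<close>.\<close>

lemma sigma_part_deriv:
  assumes "z \<notin> \<Omega>" "A \<subseteq> \<Omega>" "finite A" "0 \<in> A"
  shows "deriv (sigma_part A) z / sigma_part A z = (\<Sum>w\<in>A. zeta_term w z)" "sigma_part A z \<noteq> 0"
proof -
  let ?F = "weierstrass_factor 2"
  define f where "f = (\<lambda>w u. if w = 0 then u else ?F (u / w))"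
  have z0: "z \<noteq> 0" using assms by auto
  have nz: "f w z \<noteq> 0" if "w \<in> A" for w
    using that assms z0 by (auto simp: f_def)
  have der: "(f w has_field_derivative f w z * zeta_term w z) (at z)" if "w \<in> A" for w
  proof (cases "w = 0")
    case True
    then show ?thesis using z0 by (simp add: f_def zeta_term_def)
  next
    case False
    have zw: "z - w \<noteq> 0" using that assms by auto
    have "((\<lambda>u. (1 - u / w) * exp (u / w + u\<^sup>2 / (2 * w\<^sup>2))) has_field_derivative
        (1 - z / w) * exp (z / w + z\<^sup>2 / (2 * w\<^sup>2)) * (1 / (z - w) + 1 / w + z / w\<^sup>2)) (at z)"
      using False zw by (auto intro!: derivative_eq_intros simp: field_simps power2_eq_square)
    then show ?thesis using False by (simp add: f_def zeta_term_def sigma_factor_eq)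
  qed
  have eq: "sigma_part A = (\<lambda>u. \<Prod>w\<in>A. f w u)"
  proof
    fix u
    have "(\<Prod>w\<in>A. f w u) = f 0 u * (\<Prod>w\<in>A - {0}. f w u)"
      using assms by (simp add: prod.remove)
    also have "(\<Prod>w\<in>A - {0}. f w u) = (\<Prod>w\<in>A - {0}. ?F (u / w))"
      by (intro prod.cong) (auto simp: f_def)
    finally show "sigma_part A u = (\<Prod>w\<in>A. f w u)" by (simp add: f_def sigma_part_def)
  qed
  show nz': "sigma_part A z \<noteq> 0" unfolding eq using nz assms(3) by simp
  have "(sigma_part A has_field_derivative sigma_part A z * (\<Sum>w\<in>A. (f w z * zeta_term w z) / f w z)) (at z)"
    unfolding eq by (rule has_field_derivative_prod'[OF nz der])
  then show "deriv (sigma_part A) z / sigma_part A z = (\<Sum>w\<in>A. zeta_term w z)"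
    using nz nz' by (simp add: DERIV_imp_deriv)
qed

lemma eventually_finite_subsets_containing_0:
  "\<forall>\<^sub>F A in finite_subsets_at_top \<Omega>. finite A \<and> 0 \<in> A \<and> A \<subseteq> \<Omega>"
  unfolding eventually_finite_subsets_at_top by (intro exI[of _ "{0}"]) auto

lemma zeta_limit:
  assumes "z \<notin> \<Omega>"
  shows "((\<lambda>A. \<Sum>w\<in>A. zeta_term w z) \<longlongrightarrow> \<zeta> z) (finite_subsets_at_top \<Omega>)"
proof -
  obtain g' where g': "\<And>z. (\<sigma> has_field_derivative g' z) (at z)"
    "\<And>z. ((\<lambda>A. deriv (sigma_part A) z) \<longlongrightarrow> g' z) (finite_subsets_at_top \<Omega>)"
    using sigma_derivative_limit by blast
  have "((\<lambda>A. deriv (sigma_part A) z / sigma_part A z) \<longlongrightarrow> g' z / \<sigma> z) (finite_subsets_at_top \<Omega>)"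
    using assms by (intro tendsto_divide g'(2) sigma_part_tendsto) (simp add: sigma_eq_0_iff)
  also have "g' z / \<sigma> z = \<zeta> z"
    using DERIV_imp_deriv[OF g'(1)[of z]] by (simp add: weierstrass_zeta_def)
  finally show ?thesis
    by (rule Lim_transform_eventually)
      (use eventually_finite_subsets_containing_0 in eventually_elim, simp add: sigma_part_deriv assms)
qed

lemma zeta_odd:
  assumes "z \<notin> \<Omega>" shows "\<zeta> (- z) = - \<zeta> z"
proof -
  have d: "(\<sigma> has_field_derivative deriv \<sigma> w) (at w)" for w
    by (rule holomorphic_derivI[OF sigma_holomorphic, of UNIV]) auto
  have "((\<lambda>u. - \<sigma> (- u)) has_field_derivative deriv \<sigma> (- z)) (at z)"
    by (auto intro!: derivative_eq_intros DERIV_chain2[OF d])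
  then have "deriv \<sigma> (- z) = deriv \<sigma> z"
    by (simp add: sigma_odd DERIV_imp_deriv)
  then show ?thesis by (simp add: weierstrass_zeta_def sigma_odd)
qed

text \<open>
  Shifting the argument of a single term by a period shifts its pole, up to a summand that is affine in
  \<open>z\<close>; being affine survives the passage to the limit, and oddness of \<open>\<zeta>\<close> kills the linear part.
\<close>

lemma zeta_quasi_periodic:
  assumes w0: "w0 \<in> \<Omega>"
  shows "\<exists>e. \<forall>z. z \<notin> \<Omega> \<longrightarrow> \<zeta> (z + w0) = \<zeta> z + e"
proof -
  define D where "D = (\<lambda>z. \<zeta> (z + w0) - \<zeta> z)"
  have bij: "bij_betw (\<lambda>w. w - w0) \<Omega> \<Omega>"
    by (rule bij_betwI[of _ _ _ "\<lambda>w. w + w0"]) (use w0 in auto)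
  define k1 where "k1 = (\<lambda>w::complex. (if w = 0 then 0 else 1 / w\<^sup>2))"
  define k0 where "k0 = (\<lambda>w::complex. (if w = 0 then 0 else 1 / w))"
  have zt_eq: "zeta_term w z = 1 / (z - w) + k0 w + k1 w * z" for w z
    by (simp add: zeta_term_def k0_def k1_def)
  define a where "a = (\<lambda>A. \<Sum>w\<in>A. k1 w - k1 (w - w0))"
  define b where "b = (\<lambda>A. \<Sum>w\<in>A. k0 w + k1 w * w0 - k0 (w - w0))"
  have lim: "((\<lambda>A. a A * z + b A) \<longlongrightarrow> D z) (finite_subsets_at_top \<Omega>)" if z: "z \<notin> \<Omega>" for z
  proof -
    have "((\<lambda>A. \<Sum>w\<in>(\<lambda>w. w - w0) ` A. zeta_term w z) \<longlongrightarrow> \<zeta> z) (finite_subsets_at_top \<Omega>)"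
      using filterlim_compose[OF zeta_limit[OF z] filterlim_image_finite_subsets_at_top[OF bij]] .
    moreover have "((\<lambda>A. \<Sum>w\<in>A. zeta_term w (z + w0)) \<longlongrightarrow> \<zeta> (z + w0)) (finite_subsets_at_top \<Omega>)"
      using z w0 by (intro zeta_limit) (simp add: add_mem_iff)
    ultimately have "((\<lambda>A. (\<Sum>w\<in>A. zeta_term w (z + w0)) - (\<Sum>w\<in>(\<lambda>w. w - w0) ` A. zeta_term w z)) \<longlongrightarrow> D z) (finite_subsets_at_top \<Omega>)"
      unfolding D_def by (intro tendsto_intros)
    moreover have "(\<Sum>w\<in>A. zeta_term w (z + w0)) - (\<Sum>w\<in>(\<lambda>w. w - w0) ` A. zeta_term w z) = a A * z + b A" for A
    proof -
      have "(\<Sum>w\<in>(\<lambda>w. w - w0) ` A. zeta_term w z) = (\<Sum>w\<in>A. zeta_term (w - w0) z)"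
        by (subst sum.reindex) (auto simp: inj_on_def)
      then have "(\<Sum>w\<in>A. zeta_term w (z + w0)) - (\<Sum>w\<in>(\<lambda>w. w - w0) ` A. zeta_term w z) =
          (\<Sum>w\<in>A. zeta_term w (z + w0) - zeta_term (w - w0) z)"
        by (simp add: sum_subtractf)
      also have "\<dots> = (\<Sum>w\<in>A. (k1 w - k1 (w - w0)) * z + (k0 w + k1 w * w0 - k0 (w - w0)))"
        by (intro sum.cong refl) (simp add: zt_eq algebra_simps)
      finally show ?thesis by (simp add: a_def b_def sum.distrib sum_distrib_right)
    qed
    ultimately show ?thesis by simp
  qed
  \<comment> \<open>Interpolation through two points expresses affineness as a linear identity
    between values. It passes to the limit even though nothing is known about the convergence of
    \<open>a A\<close> and \<open>b A\<close> separately.\<close>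
  have affine: "(z2 - z1) * D z = (z - z1) * D z2 + (z2 - z) * D z1"
    if "z \<notin> \<Omega>" "z1 \<notin> \<Omega>" "z2 \<notin> \<Omega>" for z z1 z2
  proof -
    have "((\<lambda>A. (z2 - z1) * (a A * z + b A)) \<longlongrightarrow> (z2 - z1) * D z) (finite_subsets_at_top \<Omega>)"
      by (intro tendsto_intros lim that)
    moreover have "((\<lambda>A. (z - z1) * (a A * z2 + b A) + (z2 - z) * (a A * z1 + b A)) \<longlongrightarrow>
        (z - z1) * D z2 + (z2 - z) * D z1) (finite_subsets_at_top \<Omega>)"
      by (intro tendsto_intros lim that)
    moreover have "(\<lambda>A. (z2 - z1) * (a A * z + b A)) = (\<lambda>A. (z - z1) * (a A * z2 + b A) + (z2 - z) * (a A * z1 + b A))"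
      by (auto simp: algebra_simps)
    ultimately show ?thesis using tendsto_unique by (metis finite_subsets_at_top_neq_bot)
  qed
  \<comment> \<open>The reflection takes \<open>z\<close> and \<open>z + w0\<close> to
    \<open>- (z + w0) + w0\<close> and \<open>- (z + w0)\<close>, so oddness of
    \<open>\<zeta>\<close> gives the same difference.\<close>
  have D_refl: "D (- z - w0) = D z" if "z \<notin> \<Omega>" for z
  proof -
    have "z + w0 \<notin> \<Omega>" using that w0 by (simp add: add_mem_iff)
    moreover have "- z - w0 = - (z + w0)" by simp
    ultimately have "\<zeta> (- z - w0) = - \<zeta> (z + w0)" using zeta_odd by metis
    then show ?thesis using zeta_odd[OF that] by (simp add: D_def)
  qed
  \<comment> \<open>The point \<open>- w0 / 2\<close> is the fixed point of the reflection. Away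
    from it, \<open>z0\<close> and its image are distinct points at which \<open>D\<close> agrees,
    which makes the affine function \<open>D\<close> constant.\<close>
  have "uncountable (- (\<Omega> \<union> {- w0 / 2}))"
    using countable_lattice by (simp add: uncountable_minus_countable Compl_eq_Diff_UNIV uncountable_UNIV_complex)
  then obtain z0 where z0: "z0 \<notin> \<Omega>" "z0 \<noteq> - w0 / 2"
    by (metis ComplI Un_iff all_not_in_conv countable_empty insertI1 ComplD)
  define z1 where "z1 = - z0 - w0"
  have z1: "z1 \<notin> \<Omega>"
    using z0(1) w0 add_mem_iff[of w0 z0] uminus_mem_iff[of "z0 + w0"] by (simp add: z1_def)
  have ne: "z1 - z0 \<noteq> 0" using z0(2) by (auto simp: z1_def field_simps)
  have "D z = D z0" if z: "z \<notin> \<Omega>" for z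
  proof -
    have "(z1 - z0) * D z = (z - z0) * D z1 + (z1 - z) * D z0"
      using affine[OF z z0(1) z1] .
    also have "D z1 = D z0" unfolding z1_def by (rule D_refl[OF z0(1)])
    finally have "(z1 - z0) * D z = (z1 - z0) * D z0" by (simp add: algebra_simps)
    then show ?thesis using ne by simp
  qed
  then show ?thesis by (intro exI[of _ "D z0"]) (auto simp: D_def algebra_simps)
qed

end

section \<open>Quasi-periods\<close>

lemma uncountable_open_complex:
  fixes A :: "complex set"
  assumes "open A" "z \<in> A"
  shows "uncountable A"
proof -
  obtain e where e: "e > 0" "ball z e \<subseteq> A" using assms open_contains_ball by blast
  have "uncountable (ball z e)"
    by (rule connected_uncountable[of _ z "z + of_real (e / 2)"]) (use e in \<open>auto simp: dist_norm\<close>)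
  then show ?thesis using e(2) countable_subset by blast
qed

context complex_lattice
begin

lemma connected_compl_countable:
  assumes "countable B" shows "connected (- \<Omega> - B)"
proof -
  have "- \<Omega> - B = UNIV - (\<Omega> \<union> B)" by auto
  then show ?thesis
    using connected_open_diff_countable[of UNIV "\<Omega> \<union> B"] countable_lattice assms
    by (simp add: convex_connected)
qed

text \<open>The quasi-period map of the lattice, meaningful only on periods. The choice is
  determined there, since any point off the lattice fixes the constant.\<close>

definition \<eta> :: "complex \<Rightarrow> complex" where
  "\<eta> w = (SOME e. \<forall>z. z \<notin> \<Omega> \<longrightarrow> \<zeta> (z + w) = \<zeta> z + e)"

lemma zeta_add:
  assumes "w \<in> \<Omega>" "z \<notin> \<Omega>"
  shows "\<zeta> (z + w) = \<zeta> z + \<eta> w"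
  using someI_ex[OF zeta_quasi_periodic[OF assms(1)]] assms(2) unfolding \<eta>_def by blast

lemma ex_not_lattice: "\<exists>z. z \<notin> \<Omega>"
  using countable_lattice uncountable_UNIV_complex by (metis UNIV_eq_I)

lemma eta_add:
  assumes "v \<in> \<Omega>" "w \<in> \<Omega>"
  shows "\<eta> (v + w) = \<eta> v + \<eta> w"
proof -
  obtain z where z: "z \<notin> \<Omega>" using ex_not_lattice by blast
  have "\<zeta> z + \<eta> (v + w) = \<zeta> (z + v + w)"
    using zeta_add[of "v + w" z] assms z by (simp add: add_mem add.assoc)
  also have "\<dots> = \<zeta> z + (\<eta> v + \<eta> w)"
    using zeta_add[of w "z + v"] zeta_add[of v z] assms z by (simp add: add_mem_iff)
  finally show ?thesis by simp
qed

lemma eta_0 [simp]: "\<eta> 0 = 0"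
  using eta_add[of 0 0] by simp

lemma eta_uminus: "w \<in> \<Omega> \<Longrightarrow> \<eta> (- w) = - \<eta> w"
  using eta_add[of w "- w"] by (auto simp: eq_neg_iff_add_eq_0 add.commute)

lemma of_nat_mult_mem: "w \<in> \<Omega> \<Longrightarrow> of_nat n * w \<in> \<Omega>"
  by (induction n) (auto simp: algebra_simps)

lemma of_int_mult_mem: "w \<in> \<Omega> \<Longrightarrow> of_int n * w \<in> \<Omega>"
  by (cases n rule: int_cases2) (use of_nat_mult_mem in auto)

lemma eta_of_nat_mult: "w \<in> \<Omega> \<Longrightarrow> \<eta> (of_nat n * w) = of_nat n * \<eta> w"
proof (induction n)
  case (Suc n)
  then show ?case using eta_add[of w "of_nat n * w"] of_nat_mult_mem[of w n]
    by (simp add: algebra_simps)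
qed auto

lemma eta_of_int_mult: "w \<in> \<Omega> \<Longrightarrow> \<eta> (of_int n * w) = of_int n * \<eta> w"
  by (cases n rule: int_cases2) (use eta_of_nat_mult eta_uminus of_nat_mult_mem in auto)

lemma eta_coords: "\<eta> (of_int a * \<omega>1 + of_int b * \<omega>2) = of_int a * \<eta> \<omega>1 + of_int b * \<eta> \<omega>2"
  by (simp add: eta_add eta_of_int_mult of_int_mult_mem)

lemma sigma_deriv: "(\<sigma> has_field_derivative deriv \<sigma> z) (at z)"
  by (rule holomorphic_derivI[OF sigma_holomorphic, of UNIV]) auto

section \<open>Translation of \<open>\<sigma>\<close> and the Legendre relation\<close>

text \<open>The quotient \<open>h\<close> has logarithmic derivative
  \<open>\<zeta> (z + w) - \<eta> w - \<zeta> z = 0\<close>, so it is constant on the connected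
  complement of the lattice. Using the relation at \<open>z - w\<close> and at \<open>- z\<close>
  together with oddness yields only the square of \<open>C\<close>; its sign depends on whether
  \<open>w / 2\<close> is a period.\<close>

lemma sigma_quasi_periodic:
  assumes w: "w \<in> \<Omega>"
  obtains C where "C\<^sup>2 = exp (\<eta> w * w)" "\<And>z. \<sigma> (z + w) = C * exp (\<eta> w * z) * \<sigma> z"
proof -
  define h where "h = (\<lambda>z. \<sigma> (z + w) * exp (- \<eta> w * z) / \<sigma> z)"
  have der: "(h has_field_derivative 0) (at z)" if z: "z \<notin> \<Omega>" for z
  proof -
    have nz: "\<sigma> z \<noteq> 0" "\<sigma> (z + w) \<noteq> 0" using z w by (auto simp: sigma_eq_0_iff add_mem_iff)
    have s: "((\<lambda>z. \<sigma> (z + w)) has_field_derivative deriv \<sigma> (z + w)) (at z)"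
      using DERIV_shift[of \<sigma> "deriv \<sigma> (z + w)" z w] sigma_deriv by simp
    have d: "deriv \<sigma> u = \<zeta> u * \<sigma> u" if "\<sigma> u \<noteq> 0" for u
      using that by (simp add: weierstrass_zeta_def)
    show ?thesis
      unfolding h_def
      by (rule derivative_eq_intros s sigma_deriv nz refl)+
        (use nz zeta_add[OF w z] in \<open>simp add: d field_simps\<close>)
  qed
  obtain C where C: "\<And>z. z \<in> - \<Omega> \<Longrightarrow> h z = C"
  proof (rule DERIV_zero_connected_constant[of "- \<Omega>" "{}" h])
    show "connected (- \<Omega>)" using connected_compl_countable[of "{}"] by simp
    show "continuous_on (- \<Omega>) h"
      using der by (intro continuous_at_imp_continuous_on ballI DERIV_isCont) auto
  qed (use der open_compl_lattice in auto)
  have eq: "\<sigma> (z + w) = C * exp (\<eta> w * z) * \<sigma> z" for z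
  proof (cases "z \<in> \<Omega>")
    case True
    then show ?thesis using w sigma_eq_0_iff[of z] sigma_eq_0_iff[of "z + w"] by (simp add: add_mem)
  next
    case False
    then show ?thesis using C[of z] sigma_eq_0_iff[of z]
      by (simp add: h_def exp_minus field_simps)
  qed
  obtain z where z: "z \<notin> \<Omega>" using ex_not_lattice by blast
  have "\<sigma> z = C * exp (\<eta> w * (z - w)) * \<sigma> (z - w)"
    using eq[of "z - w"] by simp
  also have "\<sigma> (z - w) = - \<sigma> (- z + w)"
    using sigma_odd[of "- z + w"] by simp
  also have "\<sigma> (- z + w) = - (C * exp (\<eta> w * (- z)) * \<sigma> z)"
    using eq[of "- z"] sigma_odd[of z] by simp
  finally have "\<sigma> z * (C\<^sup>2 * (exp (\<eta> w * (z - w)) * exp (\<eta> w * (- z)))) = \<sigma> z * 1"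
    by (simp add: power2_eq_square mult_ac)
  then have "C\<^sup>2 * (exp (\<eta> w * (z - w)) * exp (\<eta> w * (- z))) = 1"
    using z sigma_eq_0_iff by (metis mult_cancel_left)
  also have "exp (\<eta> w * (z - w)) * exp (\<eta> w * (- z)) = exp (- (\<eta> w * w))"
    by (simp add: exp_add[symmetric] algebra_simps)
  finally have "C\<^sup>2 = exp (\<eta> w * w)"
    by (simp add: exp_minus field_simps)
  then show thesis using eq that by blast
qed

text \<open>Translating \<open>\<sigma>\<close> by \<open>v\<close> and \<open>w\<close> in either
  order gives the same value. Hence \<open>\<eta> v * w - \<eta> w * v\<close> is an integer
  multiple of \<open>2 pi i\<close>: the integrality half of the Legendre relation.\<close>

lemma exp_eta_commute:
  assumes "v \<in> \<Omega>" "w \<in> \<Omega>"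
  shows "exp (\<eta> v * w) = exp (\<eta> w * v)"
proof -
  obtain C where C: "C\<^sup>2 = exp (\<eta> v * v)" "\<And>z. \<sigma> (z + v) = C * exp (\<eta> v * z) * \<sigma> z"
    using sigma_quasi_periodic[OF assms(1)] by blast
  obtain D where D: "D\<^sup>2 = exp (\<eta> w * w)" "\<And>z. \<sigma> (z + w) = D * exp (\<eta> w * z) * \<sigma> z"
    using sigma_quasi_periodic[OF assms(2)] by blast
  obtain z where z: "z \<notin> \<Omega>" using ex_not_lattice by blast
  have "C\<^sup>2 \<noteq> 0" "D\<^sup>2 \<noteq> 0" unfolding C(1) D(1) by simp_all
  then have nz: "C \<noteq> 0" "D \<noteq> 0" by auto
  have nz': "\<sigma> z \<noteq> 0" using z by (simp add: sigma_eq_0_iff)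
  have "\<sigma> (z + v + w) = D * exp (\<eta> w * (z + v)) * (C * exp (\<eta> v * z) * \<sigma> z)"
    using C(2) D(2) by simp
  moreover have "\<sigma> (z + w + v) = C * exp (\<eta> v * (z + w)) * (D * exp (\<eta> w * z) * \<sigma> z)"
    using C(2) D(2) by simp
  ultimately have "D * exp (\<eta> w * (z + v)) * (C * exp (\<eta> v * z) * \<sigma> z) =
      C * exp (\<eta> v * (z + w)) * (D * exp (\<eta> w * z) * \<sigma> z)"
    by (simp add: add_ac)
  then have "(D * C * \<sigma> z * exp (\<eta> w * z) * exp (\<eta> v * z)) * exp (\<eta> w * v) =
      (D * C * \<sigma> z * exp (\<eta> w * z) * exp (\<eta> v * z)) * exp (\<eta> v * w)"
    unfolding distrib_left exp_add by (simp only: mult_ac)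
  then show ?thesis using nz nz' by simp
qed

text \<open>Reduction to the period parallelogram: Cramer's rule gives the real coordinates of
  \<open>z\<close>, whose integer parts are subtracted.\<close>

lemma translate_into_ball:
  obtains w where "w \<in> \<Omega>" "cmod (z - w) \<le> cmod \<omega>1 + cmod \<omega>2"
proof -
  define D where "D = Im (cnj \<omega>1 * \<omega>2)"
  define b where "b = Im (cnj \<omega>1 * z) / D"
  define a where "a = - Im (cnj \<omega>2 * z) / D"
  have D: "D \<noteq> 0" unfolding D_def by (rule Im_cnj_gen_nonzero)
  have z: "z = of_real a * \<omega>1 + of_real b * \<omega>2"
  proof -
    have "of_real D * z = of_real (- Im (cnj \<omega>2 * z)) * \<omega>1 + of_real (Im (cnj \<omega>1 * z)) * \<omega>2"
      by (simp add: D_def complex_eq_iff algebra_simps)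
    then show ?thesis using D by (simp add: a_def b_def field_simps)
  qed
  define w where "w = of_int \<lfloor>a\<rfloor> * \<omega>1 + of_int \<lfloor>b\<rfloor> * \<omega>2"
  have "z - w = of_real (frac a) * \<omega>1 + of_real (frac b) * \<omega>2"
    unfolding w_def by (subst z) (simp add: frac_def algebra_simps)
  also have "cmod \<dots> \<le> cmod (of_real (frac a) * \<omega>1) + cmod (of_real (frac b) * \<omega>2)"
    by (rule norm_triangle_ineq)
  also have "\<dots> \<le> 1 * cmod \<omega>1 + 1 * cmod \<omega>2"
    unfolding norm_mult norm_of_real
    by (intro add_mono mult_right_mono) (auto simp: frac_ge_0 less_imp_le[OF frac_lt_1] abs_of_nonneg)
  finally have "cmod (z - w) \<le> cmod \<omega>1 + cmod \<omega>2" by simp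
  moreover have "w \<in> \<Omega>" unfolding w_def mem_lattice by blast
  ultimately show thesis using that by blast
qed

text \<open>
  A weak form of the Legendre relation. If it failed, \<open>\<sigma>(z)\<^sup>2 exp(- c z\<^sup>2)\<close> would be an entire elliptic
  function for a suitable \<open>c\<close>.
\<close>

lemma legendre_nonzero: "\<eta> \<omega>1 * \<omega>2 \<noteq> \<eta> \<omega>2 * \<omega>1"
proof
  assume eq: "\<eta> \<omega>1 * \<omega>2 = \<eta> \<omega>2 * \<omega>1"
  \<comment> \<open>With \<open>\<eta> w = c * w\<close> on all periods, the factor
    \<open>exp (- c * z\<^sup>2)\<close> cancels the multiplier of
    \<open>(\<sigma> z)\<^sup>2\<close>; the square is taken because only \<open>C\<^sup>2\<close>
    is known.\<close>
  define c where "c = \<eta> \<omega>1 / \<omega>1"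
  define \<theta> where "\<theta> = (\<lambda>z. (\<sigma> z)\<^sup>2 * exp (- c * z\<^sup>2))"
  have "\<eta> \<omega>1 = c * \<omega>1" "\<eta> \<omega>2 = c * \<omega>2"
    using eq gen_nonzero by (auto simp: c_def field_simps)
  then have eta: "\<eta> w = c * w" if "w \<in> \<Omega>" for w
    using that by (auto simp: mem_lattice eta_coords distrib_left)
  have per: "\<theta> (z + w) = \<theta> z" if "w \<in> \<Omega>" for z w
  proof -
    obtain C where C: "C\<^sup>2 = exp (\<eta> w * w)" "\<And>z. \<sigma> (z + w) = C * exp (\<eta> w * z) * \<sigma> z"
      using sigma_quasi_periodic[OF \<open>w \<in> \<Omega>\<close>] by blast
    have "\<theta> (z + w) = (\<sigma> z)\<^sup>2 * (exp (\<eta> w * w) * (exp (\<eta> w * z))\<^sup>2 * exp (- c * (z + w)\<^sup>2))"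
      by (simp add: \<theta>_def C power_mult_distrib)
    also have "exp (\<eta> w * w) * (exp (\<eta> w * z))\<^sup>2 * exp (- c * (z + w)\<^sup>2) = exp (- c * z\<^sup>2)"
      unfolding exp_double[symmetric] exp_add[symmetric] eta[OF that]
      by (simp add: algebra_simps power2_eq_square)
    finally show ?thesis by (simp add: \<theta>_def)
  qed
  have hol: "\<theta> holomorphic_on UNIV"
    unfolding \<theta>_def by (intro holomorphic_intros sigma_holomorphic)
  have "compact (\<theta> ` cball 0 (cmod \<omega>1 + cmod \<omega>2))"
    using holomorphic_on_imp_continuous_on[OF hol]
    by (intro compact_continuous_image) (auto intro: continuous_on_subset)
  moreover have "range \<theta> \<subseteq> \<theta> ` cball 0 (cmod \<omega>1 + cmod \<omega>2)"
  proof
    fix y assume "y \<in> range \<theta>"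
    then obtain z where z: "y = \<theta> z" by blast
    obtain w where w: "w \<in> \<Omega>" "cmod (z - w) \<le> cmod \<omega>1 + cmod \<omega>2"
      using translate_into_ball by blast
    have "y = \<theta> (z - w)" using per[OF w(1), of "z - w"] z by simp
    then show "y \<in> \<theta> ` cball 0 (cmod \<omega>1 + cmod \<omega>2)" using w(2) by auto
  qed
  ultimately have "bounded (range \<theta>)"
    using bounded_subset compact_imp_bounded by blast
  then obtain k where k: "\<And>z. \<theta> z = k"
    using Liouville_theorem[OF hol] unfolding constant_on_def by auto
  have "\<theta> 0 = 0" using sigma_eq_0_iff[of 0] by (simp add: \<theta>_def)
  then have "\<theta> z = 0" for z using k by simp
  then have "\<sigma> z = 0" for z by (simp add: \<theta>_def)
  then show False using ex_not_lattice sigma_eq_0_iff by blast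
qed

text \<open>\<open>Re (\<eta> v * v)\<close> is a quadratic form on the lattice. If it vanished at
  \<open>\<omega>1\<close>, \<open>\<omega>2\<close> and their sum, polarisation together with the
  symmetry that \<open>exp_eta_commute\<close> gives on moduli would make all four numbers
  \<open>Re (\<eta> \<omega>i * \<omega>j)\<close> zero. Then both quasi-periods would vanish,
  against the Legendre relation.\<close>

lemma ex_period_basis:
  obtains v w where "v \<in> \<Omega>" "w \<in> \<Omega>" "Re (\<eta> v * v) \<noteq> 0" "\<eta> v * w \<noteq> \<eta> w * v"
proof -
  let ?a = "\<omega>1 + \<omega>2"
  have a: "\<eta> ?a = \<eta> \<omega>1 + \<eta> \<omega>2" by (rule eta_add) auto
  have "Re (\<eta> \<omega>1 * \<omega>1) \<noteq> 0 \<or> Re (\<eta> \<omega>2 * \<omega>2) \<noteq> 0 \<or> Re (\<eta> ?a * ?a) \<noteq> 0"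
  proof (rule ccontr)
    assume "\<not> ?thesis"
    then have 0: "Re (\<eta> \<omega>1 * \<omega>1) = 0" "Re (\<eta> \<omega>2 * \<omega>2) = 0" "Re (\<eta> ?a * ?a) = 0" by auto
    have sum: "Re (\<eta> \<omega>1 * \<omega>2) + Re (\<eta> \<omega>2 * \<omega>1) = 0"
      using 0 unfolding a by (simp add: algebra_simps)
    have "cmod (exp (\<eta> \<omega>1 * \<omega>2)) = cmod (exp (\<eta> \<omega>2 * \<omega>1))"
      using exp_eta_commute[of \<omega>1 \<omega>2] by simp
    then have "Re (\<eta> \<omega>1 * \<omega>2) = Re (\<eta> \<omega>2 * \<omega>1)" by (simp only: norm_exp_eq_Re exp_inj_iff)
    with sum have 1: "Re (\<eta> \<omega>1 * \<omega>2) = 0" "Re (\<eta> \<omega>2 * \<omega>1) = 0" by linarith+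
    have Im_of_real_mult: "Im (of_real r * y) = r * Im y" for r y by simp
    \<comment> \<open>If \<open>e * \<omega>1\<close> and \<open>e * \<omega>2\<close> are both
      imaginary, then the product of one with the conjugate of the other is real, although it is
      \<open>(cmod e)\<^sup>2\<close> times the nonreal number
      \<open>cnj \<omega>1 * \<omega>2\<close>.\<close>
    have z: "e = 0" if "Re (e * \<omega>1) = 0" "Re (e * \<omega>2) = 0" for e
    proof -
      have "cnj (e * \<omega>1) * (e * \<omega>2) = of_real ((cmod e)\<^sup>2) * (cnj \<omega>1 * \<omega>2)"
        by (simp add: complex_norm_square mult_ac del: of_real_power)
      moreover have "Im (cnj (e * \<omega>1) * (e * \<omega>2)) = 0"
        using that unfolding times_complex.sel(2)[of "cnj _"] cnj.sel by simp
      ultimately have "(cmod e)\<^sup>2 * Im (cnj \<omega>1 * \<omega>2) = 0"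
        using Im_of_real_mult by metis
      then show ?thesis using Im_cnj_gen_nonzero by simp
    qed
    have "\<eta> \<omega>1 = 0" "\<eta> \<omega>2 = 0" using z 0 1 by blast+
    then show False using legendre_nonzero by simp
  qed
  then show thesis
  proof (elim disjE)
    assume "Re (\<eta> ?a * ?a) \<noteq> 0"
    moreover have "\<eta> ?a * \<omega>2 \<noteq> \<eta> \<omega>2 * ?a" unfolding a using legendre_nonzero by (simp add: algebra_simps)
    ultimately show thesis using that[of ?a \<omega>2] by auto
  qed (use that[of \<omega>1 \<omega>2] that[of \<omega>2 \<omega>1] legendre_nonzero in auto)
qed

section \<open>Holomorphy of \<open>\<zeta>\<close> and \<open>\<wp>\<close>; \<open>\<wp>\<close>
  is periodic and not constant\<close>

lemma zeta_holomorphic: "\<zeta> holomorphic_on - \<Omega>"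
proof -
  have "deriv \<sigma> holomorphic_on - \<Omega>"
    by (intro holomorphic_deriv sigma_holomorphic open_compl_lattice)
  moreover have "\<zeta> = (\<lambda>z. deriv \<sigma> z / \<sigma> z)"
    by (simp add: weierstrass_zeta_def fun_eq_iff)
  ultimately show ?thesis
    by (auto intro!: holomorphic_intros sigma_holomorphic simp: sigma_eq_0_iff)
qed

lemma wp_holomorphic: "wp holomorphic_on - \<Omega>"
proof -
  have "wp = (\<lambda>z. - deriv \<zeta> z)" by (simp add: weierstrass_wp_def fun_eq_iff)
  then show ?thesis
    by (auto intro!: holomorphic_intros holomorphic_deriv zeta_holomorphic open_compl_lattice)
qed

lemma zeta_deriv: "z \<notin> \<Omega> \<Longrightarrow> (\<zeta> has_field_derivative - wp z) (at z)"
  using holomorphic_derivI[OF zeta_holomorphic open_compl_lattice, of z] by (simp add: weierstrass_wp_def)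

lemma wp_add:
  assumes "w \<in> \<Omega>" "z \<notin> \<Omega>"
  shows "wp (z + w) = wp z"
proof -
  have "((\<lambda>u. \<zeta> (u + w)) has_field_derivative - wp (z + w)) (at z)"
    using zeta_deriv[of "z + w"] assms DERIV_shift[of \<zeta> "- wp (z + w)" z w] by (simp add: add_mem_iff)
  moreover have "((\<lambda>u. \<zeta> u + \<eta> w) has_field_derivative - wp z) (at z)"
    using zeta_deriv[OF assms(2)] by (auto intro!: derivative_eq_intros)
  then have "((\<lambda>u. \<zeta> (u + w)) has_field_derivative - wp z) (at z)"
    by (rule has_field_derivative_transform_within_open[OF _ open_compl_lattice])
      (use assms zeta_add in auto)
  ultimately have "- wp (z + w) = - wp z" by (rule DERIV_unique)
  then show ?thesis by simp
qed

text \<open>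
  If \<open>\<wp>\<close> were constant, \<open>\<zeta>\<close> would be affine, so that its quasi-periods would be proportional to the
  periods, contrary to the Legendre relation.
\<close>

lemma infinite_range_wp:
  assumes "countable B"
  shows "infinite (wp ` (- \<Omega> - B))"
proof
  let ?G = "- \<Omega> - B"
  assume fin: "finite (wp ` ?G)"
  have cont: "continuous_on ?G wp"
    by (rule continuous_on_subset[OF holomorphic_on_imp_continuous_on[OF wp_holomorphic]]) auto
  have "wp constant_on ?G"
    by (rule continuous_finite_range_constant[OF connected_compl_countable[OF assms] cont fin])
  then obtain c where c: "\<And>z. z \<in> ?G \<Longrightarrow> wp z = c" unfolding constant_on_def by blast
  \<comment> \<open>\<open>B\<close> need not be closed, so the value is extended across it by size:
    the set where \<open>\<wp>\<close> differs from \<open>c\<close> is open, and if nonempty it is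
    uncountable and cannot lie inside \<open>B\<close>.\<close>
  have wpc: "wp z = c" if z: "z \<notin> \<Omega>" for z
  proof (rule ccontr)
    assume "wp z \<noteq> c"
    have "open {u \<in> - \<Omega>. wp u \<in> - {c}}"
      using continuous_open_preimage[OF holomorphic_on_imp_continuous_on[OF wp_holomorphic] open_compl_lattice, of "- {c}"]
      by (auto simp: vimage_def Int_def)
    then have "uncountable {u \<in> - \<Omega>. wp u \<in> - {c}}"
      using z \<open>wp z \<noteq> c\<close> by (intro uncountable_open_complex) auto
    moreover have "{u \<in> - \<Omega>. wp u \<in> - {c}} \<subseteq> B" using c by auto
    ultimately show False using assms countable_subset by blast
  qed
  have "((\<lambda>u. \<zeta> u + c * u) has_field_derivative 0) (at z)" if "z \<notin> \<Omega>" for z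
    using zeta_deriv[OF that] wpc[OF that] by (auto intro!: derivative_eq_intros)
  then obtain k where k: "\<And>z. z \<in> - \<Omega> \<Longrightarrow> \<zeta> z + c * z = k"
  proof -
    assume d: "\<And>z. z \<notin> \<Omega> \<Longrightarrow> ((\<lambda>u. \<zeta> u + c * u) has_field_derivative 0) (at z)"
    show thesis
    proof (rule DERIV_zero_connected_constant[of "- \<Omega>" "{}" "\<lambda>u. \<zeta> u + c * u"])
      show "connected (- \<Omega>)" using connected_compl_countable[of "{}"] by simp
      show "continuous_on (- \<Omega>) (\<lambda>u. \<zeta> u + c * u)"
        using d by (intro continuous_at_imp_continuous_on ballI DERIV_isCont) auto
    qed (use d open_compl_lattice that in auto)
  qed
  obtain z where z: "z \<notin> \<Omega>" using ex_not_lattice by blast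
  have "\<eta> w = - c * w" if "w \<in> \<Omega>" for w
  proof -
    have "\<zeta> z + c * z = \<zeta> (z + w) + c * (z + w)"
      using k[of z] k[of "z + w"] z that by (simp add: add_mem_iff)
    then have "c * w + \<eta> w = 0"
      unfolding zeta_add[OF that z] by (simp add: distrib_left add.commute)
    then show ?thesis by (simp add: add_eq_0_iff)
  qed
  then show False using legendre_nonzero by simp
qed

end

section \<open>Exponential polynomials and Gaussians\<close>

text \<open>Decay faster than every geometric sequence. Gaussians with base of modulus below 1 have
  it, multiplication by polynomials and exponentials preserves it, and no nonzero exponential
  polynomial has it; together these facts separate Gaussians of different widths.\<close>

definition superexp_small :: "(nat \<Rightarrow> complex) \<Rightarrow> bool" where
  "superexp_small s \<longleftrightarrow> (\<forall>K>0. (\<lambda>n. norm (s n) * K ^ n) \<longlonglongrightarrow> 0)"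

lemma superexp_small_bound:
  assumes "superexp_small s" "\<And>n. norm (t n) \<le> norm (s n) * C ^ n" "C > 0"
  shows "superexp_small t"
  unfolding superexp_small_def
proof (intro allI impI)
  fix K :: real assume K: "K > 0"
  have "(\<lambda>n. norm (s n) * (C * K) ^ n) \<longlonglongrightarrow> 0"
    using assms(1,3) K unfolding superexp_small_def by simp
  then show "(\<lambda>n. norm (t n) * K ^ n) \<longlonglongrightarrow> 0"
  proof (rule Lim_null_comparison[rotated], intro always_eventually allI)
    fix n
    have "norm (t n) * K ^ n \<le> norm (s n) * C ^ n * K ^ n"
      using assms(2) K by (intro mult_right_mono) auto
    then show "norm (norm (t n) * K ^ n) \<le> norm (s n) * (C * K) ^ n"
      using K by (simp add: power_mult_distrib mult.assoc)
  qed
qed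

lemma superexp_small_zero: "superexp_small (\<lambda>n. 0)"
  by (simp add: superexp_small_def)

lemma superexp_small_add:
  assumes "superexp_small s" "superexp_small t"
  shows "superexp_small (\<lambda>n. s n + t n)"
  unfolding superexp_small_def
proof (intro allI impI)
  fix K :: real assume K: "K > 0"
  have "(\<lambda>n. norm (s n) * K ^ n + norm (t n) * K ^ n) \<longlonglongrightarrow> 0 + 0"
    using assms K unfolding superexp_small_def by (intro tendsto_add) auto
  then have lim: "(\<lambda>n. norm (s n) * K ^ n + norm (t n) * K ^ n) \<longlonglongrightarrow> 0" by simp
  show "(\<lambda>n. norm (s n + t n) * K ^ n) \<longlonglongrightarrow> 0"
  proof (rule Lim_null_comparison[OF _ lim], intro always_eventually allI)
    fix n
    have "norm (s n + t n) * K ^ n \<le> (norm (s n) + norm (t n)) * K ^ n"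
      using K by (intro mult_right_mono norm_triangle_ineq) auto
    then show "norm (norm (s n + t n) * K ^ n) \<le> norm (s n) * K ^ n + norm (t n) * K ^ n"
      using K by (simp add: distrib_right)
  qed
qed

lemma superexp_small_cmult:
  assumes "superexp_small s"
  shows "superexp_small (\<lambda>n. c * s n)"
  unfolding superexp_small_def
proof (intro allI impI)
  fix K :: real assume "K > 0"
  then have "(\<lambda>n. norm c * (norm (s n) * K ^ n)) \<longlonglongrightarrow> norm c * 0"
    using assms unfolding superexp_small_def by (intro tendsto_mult_left) auto
  then show "(\<lambda>n. norm (c * s n) * K ^ n) \<longlonglongrightarrow> 0" by (simp add: norm_mult mult.assoc)
qed

lemma superexp_small_sum:
  "(\<And>i. i \<in> I \<Longrightarrow> superexp_small (s i)) \<Longrightarrow> superexp_small (\<lambda>n. \<Sum>i\<in>I. s i n)"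
  by (induction I rule: infinite_finite_induct) (auto intro: superexp_small_zero superexp_small_add)

lemma superexp_small_Suc:
  assumes "superexp_small s"
  shows "superexp_small (\<lambda>n. s (Suc n))"
  unfolding superexp_small_def
proof (intro allI impI)
  fix K :: real assume K: "K > 0"
  then have "(\<lambda>n. norm (s (Suc n)) * K ^ Suc n) \<longlonglongrightarrow> 0"
    using assms unfolding superexp_small_def by (intro LIMSEQ_Suc[where f = "\<lambda>n. norm (s n) * K ^ n"]) auto
  then have "(\<lambda>n. norm (s (Suc n)) * K ^ Suc n / K) \<longlonglongrightarrow> 0 / K"
    using K by (intro tendsto_divide tendsto_const) auto
  then show "(\<lambda>n. norm (s (Suc n)) * K ^ n) \<longlonglongrightarrow> 0" using K by simp
qed

lemma superexp_small_mult_power: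
  assumes "superexp_small s"
  shows "superexp_small (\<lambda>n. c ^ n * s n)"
proof (rule superexp_small_bound[OF assms])
  fix n
  have "norm c ^ n \<le> (norm c + 1) ^ n" by (intro power_mono) auto
  then show "norm (c ^ n * s n) \<le> norm (s n) * (norm c + 1) ^ n"
    by (simp add: norm_mult norm_power mult.commute mult_left_mono)
qed (simp add: add_nonneg_pos)

lemma superexp_small_mult_poly:
  assumes "superexp_small s"
  shows "superexp_small (\<lambda>n. poly q (of_nat n) * s n)"
proof (induction q rule: pCons_induct)
  case 0
  then show ?case by (simp add: superexp_small_zero)
next
  case (pCons a q)
  have "superexp_small (\<lambda>n. of_nat n * (poly q (of_nat n) * s n))"
  proof (rule superexp_small_bound[OF pCons.IH, where C = 2])
    fix n :: nat
    have "real n \<le> 2 ^ n" using of_nat_less_two_power[of n, where 'a = real] by simp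
    then show "norm (of_nat n * (poly q (of_nat n) * s n)) \<le> norm (poly q (of_nat n) * s n) * 2 ^ n"
      by (simp add: norm_mult mult.commute mult_right_mono del: of_nat_less_two_power)
  qed simp
  from superexp_small_add[OF superexp_small_cmult[OF assms, of a] this] show ?case by (simp add: algebra_simps)
qed

text \<open>\<open>norm Q ^ (n * n) * K ^ n\<close> is the \<open>n\<close>-th power of
  \<open>K * norm Q ^ n\<close>, and this base is eventually below \<open>1/2\<close>.\<close>

lemma superexp_small_gaussian:
  fixes Q :: complex
  assumes "norm Q < 1" "k \<ge> 1"
  shows "superexp_small (\<lambda>n. Q ^ (k * n\<^sup>2))"
  unfolding superexp_small_def
proof (intro allI impI)
  fix K :: real assume K: "K > 0"
  have "(\<lambda>n. K * norm Q ^ n) \<longlonglongrightarrow> K * 0"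
    using assms by (intro tendsto_mult_left LIMSEQ_power_zero) auto
  then have "\<forall>\<^sub>F n in sequentially. K * norm Q ^ n < 1/2"
    by (rule order_tendstoD(2)) auto
  then have "\<forall>\<^sub>F n in sequentially. norm (norm (Q ^ (k * n\<^sup>2)) * K ^ n) \<le> (1/2) ^ n"
  proof eventually_elim
    case (elim n)
    have "norm (Q ^ (k * n\<^sup>2)) \<le> norm Q ^ (n * n)"
      unfolding norm_power using assms by (intro power_decreasing) (auto simp: power2_eq_square)
    then have "norm (Q ^ (k * n\<^sup>2)) * K ^ n \<le> norm Q ^ (n * n) * K ^ n"
      using K by (intro mult_right_mono) auto
    also have "\<dots> = (K * norm Q ^ n) ^ n" by (simp add: power_mult_distrib power_mult mult.commute)
    also have "\<dots> \<le> (1/2) ^ n" using elim K by (intro power_mono) auto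
    finally show ?case using K by simp
  qed
  moreover have "(\<lambda>n. (1/2::real) ^ n) \<longlonglongrightarrow> 0" by (rule LIMSEQ_power_zero) simp
  ultimately show "(\<lambda>n. norm (Q ^ (k * n\<^sup>2)) * K ^ n) \<longlonglongrightarrow> 0"
    by (rule Lim_null_comparison)
qed

section \<open>Exponential polynomials\<close>

lemma poly_eq_0_if_nat_roots:
  fixes p :: "complex poly"
  assumes "\<And>n::nat. poly p (of_nat n) = 0"
  shows "p = 0"
proof (rule ccontr)
  assume "p \<noteq> 0"
  then have "finite {x. poly p x = 0}" by (rule poly_roots_finite)
  moreover have "range (of_nat :: nat \<Rightarrow> complex) \<subseteq> {x. poly p x = 0}" using assms by auto
  ultimately have "finite (range (of_nat :: nat \<Rightarrow> complex))" using finite_subset by blast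
  then show False using infinite_UNIV_nat finite_imageD inj_of_nat by blast
qed

text \<open>The shift keeps degree and leading coefficient, so the top terms cancel; the hypothesis
  excludes constants, whose difference is 0.\<close>

lemma degree_shift_diff_less:
  fixes p :: "complex poly"
  assumes "pcompose p [:1, 1:] - p \<noteq> 0"
  shows "Polynomial.degree (pcompose p [:1, 1:] - p) < Polynomial.degree p"
proof -
  have d: "Polynomial.degree (pcompose p [:1, 1:]) = Polynomial.degree p"
    by (simp add: degree_pcompose)
  have "Polynomial.degree p \<noteq> 0"
  proof
    assume "Polynomial.degree p = 0"
    then obtain a where "p = [:a:]" using degree_eq_zeroE by blast
    then show False using assms by simp
  qed
  moreover have "Polynomial.coeff (pcompose p [:1, 1:] - p) (Polynomial.degree p) = 0"
    using lead_coeff_comp[of "[:1, 1:]" p] d by simp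
  moreover have "Polynomial.degree (pcompose p [:1, 1:] - p) \<le> Polynomial.degree p"
    using d by (intro degree_diff_le) auto
  ultimately show ?thesis
    using assms by (metis leading_coeff_0_iff le_neq_implies_less)
qed

text \<open>
  The operator \<open>s(n) \<mapsto> s(n + 1) - l0 * s(n)\<close> preserves superexponential smallness, lowers the degree of
  the polynomial coefficient of \<open>l0 ^ n\<close> and keeps the degrees of all others.
\<close>

lemma exponential_polynomial_zero:
  fixes p :: "complex \<Rightarrow> complex poly"
  assumes "finite L" "0 \<notin> L"
    and "superexp_small (\<lambda>n. \<Sum>l\<in>L. poly (p l) (of_nat n) * l ^ n)"
  shows "\<forall>l\<in>L. p l = 0"
  using assms(3)
\<comment> \<open>The measure counts degree plus one for each nonzero coefficient polynomial, so it
  drops even when the operator annihilates a constant.\<close>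
proof (induction "\<Sum>l\<in>L. if p l = 0 then 0 else Suc (Polynomial.degree (p l))" arbitrary: p rule: less_induct)
  case less
  let ?sz = "\<lambda>q :: complex poly. if q = 0 then 0 else Suc (Polynomial.degree q)"
  show ?case
  proof (rule ccontr)
    assume "\<not> ?thesis"
    then obtain l0 where l0: "l0 \<in> L" "p l0 \<noteq> 0" by blast
    have l00: "l0 \<noteq> 0" using l0 assms by auto
    define p' where "p' = (\<lambda>l. Polynomial.smult l (pcompose (p l) [:1, 1:]) - Polynomial.smult l0 (p l))"
    have "superexp_small (\<lambda>n. (\<Sum>l\<in>L. poly (p l) (of_nat (Suc n)) * l ^ Suc n) + (- l0) * (\<Sum>l\<in>L. poly (p l) (of_nat n) * l ^ n))"
      by (intro superexp_small_add superexp_small_cmult less.prems superexp_small_Suc[OF less.prems])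
    moreover have "(\<lambda>n. (\<Sum>l\<in>L. poly (p l) (of_nat (Suc n)) * l ^ Suc n) + (- l0) * (\<Sum>l\<in>L. poly (p l) (of_nat n) * l ^ n))
        = (\<lambda>n. \<Sum>l\<in>L. poly (p' l) (of_nat n) * l ^ n)"
      by (auto simp: fun_eq_iff p'_def poly_pcompose sum_distrib_left sum.distrib[symmetric] algebra_simps simp flip: sum_subtractf intro!: sum.cong)
    ultimately have small: "superexp_small (\<lambda>n. \<Sum>l\<in>L. poly (p' l) (of_nat n) * l ^ n)" by simp
    have le: "?sz (p' l) \<le> ?sz (p l)" for l
    proof -
      have "Polynomial.degree (p' l) \<le> Polynomial.degree (p l)"
        unfolding p'_def by (intro degree_diff_le order_trans[OF degree_smult_le]) (auto simp: degree_pcompose)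
      then show ?thesis by (auto simp: p'_def)
    qed
    have eq: "p' l0 = Polynomial.smult l0 (pcompose (p l0) [:1, 1:] - p l0)"
      by (simp add: p'_def smult_diff_right)
    have lt: "?sz (p' l0) < ?sz (p l0)"
      using degree_shift_diff_less[of "p l0"] l0(2) l00 by (auto simp: eq)
    have "(\<Sum>l\<in>L. ?sz (p' l)) < (\<Sum>l\<in>L. ?sz (p l))"
      by (rule sum_strict_mono_ex1) (use le lt l0 assms in auto)
    then have p'0: "\<forall>l\<in>L. p' l = 0" using less.hyps small by blast
    \<comment> \<open>At \<open>l \<noteq> l0\<close> the operator multiplies the leading
      coefficient by \<open>l - l0\<close>, so a vanishing result leaves no room for a nonzero
      polynomial.\<close>
    have others: "p l = 0" if "l \<in> L" "l \<noteq> l0" for l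
    proof -
      have "Polynomial.coeff (p' l) (Polynomial.degree (p l)) = (l - l0) * Polynomial.lead_coeff (p l)"
        using lead_coeff_comp[of "[:1, 1:]" "p l"] by (simp add: p'_def degree_pcompose algebra_simps)
      then show ?thesis using p'0 that by simp
    qed
    have shift: "pcompose (p l0) [:1, 1:] = p l0"
      using p'0 l0 l00 eq by simp
    have const: "poly (p l0) (of_nat n) = poly (p l0) 0" for n
    proof (induction n)
      case (Suc n)
      have "poly (pcompose (p l0) [:1, 1:]) (of_nat n) = poly (p l0) (of_nat (Suc n))"
        by (simp add: poly_pcompose add.commute)
      then show ?case using shift Suc by simp
    qed simp
    have "(\<Sum>l\<in>L. poly (p l) (of_nat n) * l ^ n) = poly (p l0) 0 * l0 ^ n" for n
    proof -
      have "(\<Sum>l\<in>L. poly (p l) (of_nat n) * l ^ n) = (\<Sum>l\<in>{l0}. poly (p l) (of_nat n) * l ^ n)"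
        using l0 others assms(1) by (intro sum.mono_neutral_right) auto
      then show ?thesis using const by simp
    qed
    then have "superexp_small (\<lambda>n. poly (p l0) 0 * l0 ^ n)" using less.prems by simp
    \<comment> \<open>Taking \<open>K = 1 / norm l0\<close> in the definition of smallness turns the
      one remaining term into a constant sequence, which tends to 0 only if it is 0.\<close>
    then have "(\<lambda>n. norm (poly (p l0) 0 * l0 ^ n) * (1 / norm l0) ^ n) \<longlonglongrightarrow> 0"
      unfolding superexp_small_def using l00 by auto
    moreover have "norm (poly (p l0) 0 * l0 ^ n) * (1 / norm l0) ^ n = norm (poly (p l0) 0)" for n
      using l00 by (simp add: norm_mult norm_power power_divide)
    ultimately have "poly (p l0) 0 = 0" by (simp add: LIMSEQ_const_iff)
    then have "p l0 = 0" using const by (intro poly_eq_0_if_nat_roots) simp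
    then show False using l0 by simp
  qed
qed

text \<open>Different indices may have the same base, so a relation determines only the sum of the
  coefficient polynomials over each class of equal bases.\<close>

lemma exponential_polynomial_classes_zero:
  fixes q :: "'m \<Rightarrow> complex poly"
  assumes "finite M" "\<And>m. m \<in> M \<Longrightarrow> l m \<noteq> 0"
    and "superexp_small (\<lambda>n. \<Sum>m\<in>M. poly (q m) (of_nat n) * l m ^ n)"
  shows "(\<Sum>m\<in>{m \<in> M. l m = x}. q m) = 0"
proof (cases "x \<in> l ` M")
  case True
  define p where "p = (\<lambda>x. \<Sum>m\<in>{m \<in> M. l m = x}. q m)"
  have "(\<Sum>m\<in>M. poly (q m) (of_nat n) * l m ^ n) = (\<Sum>y\<in>l ` M. poly (p y) (of_nat n) * y ^ n)" for n
    unfolding sum.image_gen[OF assms(1), of _ l]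
    by (intro sum.cong) (auto simp: p_def poly_sum sum_distrib_right)
  then have "superexp_small (\<lambda>n. \<Sum>y\<in>l ` M. poly (p y) (of_nat n) * y ^ n)" using assms(3) by simp
  then have "\<forall>y\<in>l ` M. p y = 0"
    by (intro exponential_polynomial_zero) (use assms in auto)
  then have "p x = 0" using True by blast
  then show ?thesis by (simp add: p_def)
next
  case False
  then have e: "{m \<in> M. l m = x} = {}" by auto
  show ?thesis unfolding e by simp
qed

lemma exponential_polynomial_small_imp_zero:
  fixes q :: "'m \<Rightarrow> complex poly"
  assumes "finite M" "\<And>m. m \<in> M \<Longrightarrow> l m \<noteq> 0"
    and "superexp_small (\<lambda>n. \<Sum>m\<in>M. poly (q m) (of_nat n) * l m ^ n)"
  shows "(\<Sum>m\<in>M. poly (q m) (of_nat n) * l m ^ n) = 0"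
  unfolding sum.image_gen[OF assms(1), of _ l]
proof (rule sum.neutral, rule ballI)
  fix y
  have "(\<Sum>m\<in>{m \<in> M. l m = y}. poly (q m) (of_nat n) * l m ^ n) = poly (\<Sum>m\<in>{m \<in> M. l m = y}. q m) (of_nat n) * y ^ n"
    by (simp add: poly_sum sum_distrib_right)
  then show "(\<Sum>m\<in>{m \<in> M. l m = y}. poly (q m) (of_nat n) * l m ^ n) = 0"
    by (simp add: exponential_polynomial_classes_zero[OF assms])
qed

section \<open>Separation of Gaussians\<close>

text \<open>After division by the Gaussian of least exponent \<open>D\<close>, all other terms decay
  superexponentially. The terms of exponent \<open>D\<close> thus form a superexponentially small
  exponential polynomial, which is 0; they are removed and the rest is treated by induction on the
  number of terms.\<close>

lemma gaussian_separation_lt_1: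
  fixes q :: "'m \<Rightarrow> complex poly" and Q :: complex and d :: "'m \<Rightarrow> nat"
  assumes "finite M" "\<And>m. m \<in> M \<Longrightarrow> l m \<noteq> 0" "norm Q < 1" "Q \<noteq> 0"
    and "\<And>n. (\<Sum>m\<in>M. poly (q m) (of_nat n) * l m ^ n * Q ^ (d m * n\<^sup>2)) = 0"
  shows "(\<Sum>m\<in>{m \<in> M. d m = k}. poly (q m) (of_nat n) * l m ^ n) = 0"
  using assms(1,2,5)
proof (induction "card M" arbitrary: M n k rule: less_induct)
  case less
  show ?case
  proof (cases "M = {}")
    case False
    define D where "D = Min (d ` M)"
    have D: "D \<in> d ` M" "\<And>m. m \<in> M \<Longrightarrow> D \<le> d m"
      unfolding D_def using less.prems(1) False by (auto intro: Min_in)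
    let ?T = "\<lambda>m n. poly (q m) (of_nat n) * l m ^ n"
    let ?A = "{m \<in> M. d m = D}" and ?B = "{m \<in> M. d m \<noteq> D}"
    have split: "(\<Sum>m\<in>M. f m) = (\<Sum>m\<in>?A. f m) + (\<Sum>m\<in>?B. f m)" for f :: "'m \<Rightarrow> complex"
      using less.prems(1) by (subst sum.union_disjoint[symmetric]) (auto intro!: sum.cong)
    have "(\<Sum>m\<in>?A. ?T m n) = - (\<Sum>m\<in>?B. ?T m n * Q ^ ((d m - D) * n\<^sup>2))" for n
    proof -
      have "(\<Sum>m\<in>M. ?T m n * Q ^ (d m * n\<^sup>2)) = Q ^ (D * n\<^sup>2) * (\<Sum>m\<in>M. ?T m n * Q ^ ((d m - D) * n\<^sup>2))"
        unfolding sum_distrib_left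
      proof (intro sum.cong refl)
        fix m assume "m \<in> M"
        then have "d m * n\<^sup>2 = D * n\<^sup>2 + (d m - D) * n\<^sup>2" using D(2) by (simp flip: add_mult_distrib)
        then show "?T m n * Q ^ (d m * n\<^sup>2) = Q ^ (D * n\<^sup>2) * (?T m n * Q ^ ((d m - D) * n\<^sup>2))"
          by (simp add: power_add mult_ac)
      qed
      then have "(\<Sum>m\<in>M. ?T m n * Q ^ ((d m - D) * n\<^sup>2)) = 0"
        using less.prems(3)[of n] assms(4) by simp
      then show ?thesis unfolding split by (simp add: add_eq_0_iff2)
    qed
    moreover have "superexp_small (\<lambda>n. (-1) * (\<Sum>m\<in>?B. poly (q m) (of_nat n) * (l m ^ n * Q ^ ((d m - D) * n\<^sup>2))))"
      using D(2) assms(3)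
      by (intro superexp_small_cmult superexp_small_sum superexp_small_mult_poly superexp_small_mult_power superexp_small_gaussian)
        (auto simp: Suc_le_eq order.not_eq_order_implies_strict)
    ultimately have "superexp_small (\<lambda>n. \<Sum>m\<in>?A. ?T m n)" by (simp add: mult.assoc)
    then have A0: "(\<Sum>m\<in>?A. ?T m n) = 0" for n
      using less.prems by (intro exponential_polynomial_small_imp_zero) auto
    have B: "(\<Sum>m\<in>?B. ?T m n * Q ^ (d m * n\<^sup>2)) = 0" for n
    proof -
      have "(\<Sum>m\<in>?A. ?T m n * Q ^ (d m * n\<^sup>2)) = (\<Sum>m\<in>?A. ?T m n) * Q ^ (D * n\<^sup>2)"
        by (simp add: sum_distrib_right)
      then show ?thesis using less.prems(3)[of n] A0 unfolding split by simp
    qed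
    have "card ?B < card M" using D(1) less.prems(1) by (intro psubset_card_mono) auto
    then have IH: "(\<Sum>m\<in>{m \<in> ?B. d m = k}. ?T m n) = 0"
      by (rule less.hyps) (use less.prems B in auto)
    show ?thesis
    proof (cases "k = D")
      case True
      then show ?thesis using A0 by simp
    next
      case False
      then have "{m \<in> ?B. d m = k} = {m \<in> M. d m = k}" by auto
      then show ?thesis using IH by simp
    qed
  qed auto
qed

text \<open>For \<open>norm Q > 1\<close> the relation is divided by the Gaussian of greatest
  exponent, which leaves powers of \<open>1 / Q\<close> with exponents
  \<open>D - d m\<close>.\<close>

lemma gaussian_separation:
  fixes q :: "'m \<Rightarrow> complex poly" and Q :: complex and d :: "'m \<Rightarrow> nat"
  assumes "finite M" "\<And>m. m \<in> M \<Longrightarrow> l m \<noteq> 0" "norm Q \<noteq> 1" "Q \<noteq> 0"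
    and "\<And>n. (\<Sum>m\<in>M. poly (q m) (of_nat n) * l m ^ n * Q ^ (d m * n\<^sup>2)) = 0"
  shows "(\<Sum>m\<in>{m \<in> M. d m = k}. poly (q m) (of_nat n) * l m ^ n) = 0"
proof (cases "norm Q < 1")
  case True
  then show ?thesis using gaussian_separation_lt_1[OF assms(1,2) _ assms(4,5)] by simp
next
  case False
  \<comment> \<open>Including \<open>k\<close> in the maximum makes the truncated subtraction from
    \<open>D\<close> injective on all exponents compared below.\<close>
  define D where "D = Max (insert k (d ` M))"
  have D: "k \<le> D" "\<And>m. m \<in> M \<Longrightarrow> d m \<le> D" unfolding D_def using assms(1) by auto
  have Q: "norm (1 / Q) < 1" using False assms(3,4) by (simp add: norm_divide)
  have rel: "(\<Sum>m\<in>M. poly (q m) (of_nat n) * l m ^ n * (1 / Q) ^ ((D - d m) * n\<^sup>2)) = 0" for n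
  proof -
    have "(\<Sum>m\<in>M. poly (q m) (of_nat n) * l m ^ n * (1 / Q) ^ ((D - d m) * n\<^sup>2)) =
        (1 / Q) ^ (D * n\<^sup>2) * (\<Sum>m\<in>M. poly (q m) (of_nat n) * l m ^ n * Q ^ (d m * n\<^sup>2))"
      unfolding sum_distrib_left
    proof (intro sum.cong refl)
      fix m assume "m \<in> M"
      then have "D * n\<^sup>2 = (D - d m) * n\<^sup>2 + d m * n\<^sup>2" using D(2) by (simp flip: add_mult_distrib)
      then have "(1 / Q) ^ (D * n\<^sup>2) * Q ^ (d m * n\<^sup>2) = (1 / Q) ^ ((D - d m) * n\<^sup>2)"
        using assms(4) by (simp add: power_add power_one_over)
      then show "poly (q m) (of_nat n) * l m ^ n * (1 / Q) ^ ((D - d m) * n\<^sup>2) =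
          (1 / Q) ^ (D * n\<^sup>2) * (poly (q m) (of_nat n) * l m ^ n * Q ^ (d m * n\<^sup>2))"
        by (simp add: mult_ac)
    qed
    then show ?thesis using assms(5) by simp
  qed
  have "(\<Sum>m\<in>{m \<in> M. D - d m = D - k}. poly (q m) (of_nat n) * l m ^ n) = 0"
    by (rule gaussian_separation_lt_1[OF assms(1,2) Q _ rel]) (use assms(4) in auto)
  moreover have "{m \<in> M. D - d m = D - k} = {m \<in> M. d m = k}"
  proof (intro Collect_cong conj_cong refl)
    fix m assume "m \<in> M"
    then show "(D - d m = D - k) = (d m = k)" using D(1) D(2)[of m] by auto
  qed
  ultimately show ?thesis by simp
qed

section \<open>Polynomial relations in free variables\<close>

lemma power_sum_classes_zero:
  fixes c :: "'m \<Rightarrow> complex" and a :: "'m \<Rightarrow> nat"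
  assumes "finite M" "infinite S" "\<And>x. x \<in> S \<Longrightarrow> (\<Sum>m\<in>M. c m * x ^ a m) = 0"
  shows "(\<Sum>m\<in>{m \<in> M. a m = k}. c m) = 0"
proof -
  define p where "p = (\<Sum>m\<in>M. Polynomial.monom (c m) (a m))"
  have "poly p x = 0" if "x \<in> S" for x
    using assms(3)[OF that] by (simp add: p_def poly_sum poly_monom)
  then have "S \<subseteq> {x. poly p x = 0}" by blast
  then have "p = 0" using assms(2) poly_roots_finite finite_subset by blast
  then have "0 = Polynomial.coeff p k" by simp
  also have "\<dots> = (\<Sum>m\<in>M. if a m = k then c m else 0)"
    by (simp add: p_def coeff_sum)
  also have "\<dots> = (\<Sum>m\<in>{m \<in> M. a m = k}. c m)"
    using assms(1) by (simp add: sum.inter_filter)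
  finally show ?thesis by simp
qed

text \<open>The variables are peeled off one at a time. Only \<open>w\<close> is confined to
  \<open>S\<close>, which stands for the infinite set of values of \<open>\<wp>\<close>;
  \<open>x\<close> and \<open>y\<close> are the variables freed from \<open>z\<close> and
  \<open>\<zeta> z\<close>.\<close>

lemma power_sum3_zero:
  fixes c :: "'m \<Rightarrow> complex" and a b d :: "'m \<Rightarrow> nat"
  assumes "finite M" "infinite S"
    and "\<And>x y w. w \<in> S \<Longrightarrow> (\<Sum>m\<in>M. c m * x ^ a m * y ^ b m * w ^ d m) = 0"
    and "inj_on (\<lambda>m. (a m, b m, d m)) M" "m \<in> M"
  shows "c m = 0"
proof -
  have 1: "(\<Sum>m\<in>{m \<in> M. d m = k}. c m * x ^ a m * y ^ b m) = 0" for x y k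
    by (rule power_sum_classes_zero[OF assms(1,2)]) (use assms(3) in auto)
  have 2: "(\<Sum>m\<in>{m \<in> {m \<in> M. d m = k}. b m = j}. c m * x ^ a m) = 0" for x j k
    by (rule power_sum_classes_zero[where S = UNIV]) (use assms(1) 1 infinite_UNIV_char_0 in auto)
  have 3: "(\<Sum>m\<in>{m \<in> {m \<in> {m \<in> M. d m = k}. b m = j}. a m = i}. c m) = 0" for i j k
    by (rule power_sum_classes_zero[where S = UNIV]) (use assms(1) 2 infinite_UNIV_char_0 in auto)
  have "{m' \<in> {m' \<in> {m' \<in> M. d m' = d m}. b m' = b m}. a m' = a m} = {m}"
    using assms(4,5) by (auto simp: inj_on_def)
  then show ?thesis using 3[where i = "a m" and j = "b m" and k = "d m"] by simp
qed

text \<open>In each class the coefficient of the exponential in \<open>n1\<close>, and then in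
  \<open>n2\<close>, is a zero polynomial, so the integers may be replaced by arbitrary complex
  numbers \<open>u\<close> and \<open>v\<close>. The determinant condition makes the resulting
  affine map of the plane onto, so the bases of the powers become arbitrary.\<close>

lemma shift_relation_classes:
  fixes c :: "'m \<Rightarrow> complex" and a b :: "'m \<Rightarrow> nat"
  assumes "finite M" "\<And>m. m \<in> M \<Longrightarrow> x1 m \<noteq> 0" "\<And>m. m \<in> M \<Longrightarrow> x2 m \<noteq> 0"
    and rel: "\<And>n1 n2 :: nat. (\<Sum>m\<in>M. c m * (z + of_nat n1 * w1 + of_nat n2 * w2) ^ a m
       * (y + of_nat n1 * e1 + of_nat n2 * e2) ^ b m * x1 m ^ n1 * x2 m ^ n2) = 0"
    and det: "w1 * e2 \<noteq> w2 * e1"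
  shows "(\<Sum>m\<in>{m \<in> M. x1 m = l1 \<and> x2 m = l2}. c m * s ^ a m * t ^ b m) = 0"
proof -
  have zero: "superexp_small f" if "\<And>n. f n = 0" for f
    using that superexp_small_zero by presburger
  let ?M1 = "{m \<in> M. x1 m = l1}"
  have 1: "(\<Sum>m\<in>?M1. c m * (z + u * w1 + of_nat n2 * w2) ^ a m * (y + u * e1 + of_nat n2 * e2) ^ b m * x2 m ^ n2) = 0"
    for u and n2 :: nat
  proof -
    define q where "q = (\<lambda>m. Polynomial.smult (c m * x2 m ^ n2) ([:z + of_nat n2 * w2, w1:] ^ a m * [:y + of_nat n2 * e2, e1:] ^ b m))"
    have "(\<Sum>m\<in>M. poly (q m) (of_nat n1) * x1 m ^ n1) = 0" for n1
      using rel[of n1 n2] by (simp add: q_def mult_ac add_ac)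
    then have "(\<Sum>m\<in>?M1. q m) = 0"
      by (intro exponential_polynomial_classes_zero zero) (use assms(1,2) in auto)
    then have "poly (\<Sum>m\<in>?M1. q m) u = 0" by simp
    then show ?thesis by (simp add: q_def poly_sum mult_ac add_ac)
  qed
  have 2: "(\<Sum>m\<in>{m \<in> ?M1. x2 m = l2}. c m * (z + u * w1 + v * w2) ^ a m * (y + u * e1 + v * e2) ^ b m) = 0"
    for u v
  proof -
    define q where "q = (\<lambda>m. Polynomial.smult (c m) ([:z + u * w1, w2:] ^ a m * [:y + u * e1, e2:] ^ b m))"
    have "(\<Sum>m\<in>?M1. poly (q m) (of_nat n2) * x2 m ^ n2) = 0" for n2
      using 1[of u n2] by (simp add: q_def mult_ac add_ac)
    then have "(\<Sum>m\<in>{m \<in> ?M1. x2 m = l2}. q m) = 0"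
      by (intro exponential_polynomial_classes_zero zero) (use assms(1,3) in auto)
    then have "poly (\<Sum>m\<in>{m \<in> ?M1. x2 m = l2}. q m) v = 0" by simp
    then show ?thesis by (simp add: q_def poly_sum mult_ac add_ac)
  qed
  define D where "D = w1 * e2 - w2 * e1"
  \<comment> \<open>Cramer's rule for \<open>u * w1 + v * w2 = s - z\<close> and
    \<open>u * e1 + v * e2 = t - y\<close>.\<close>
  define u where "u = ((s - z) * e2 - (t - y) * w2) / D"
  define v where "v = ((t - y) * w1 - (s - z) * e1) / D"
  have D: "D \<noteq> 0" using det by (simp add: D_def)
  have "D * (u * w1 + v * w2) = D * (s - z)" "D * (u * e1 + v * e2) = D * (t - y)"
    using D by (simp_all add: u_def v_def distrib_left) (simp_all add: D_def algebra_simps)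
  then have "u * w1 + v * w2 = s - z" "u * e1 + v * e2 = t - y" using D by (auto simp: mult_cancel_left)
  then have "z + u * w1 + v * w2 = s" "y + u * e1 + v * e2 = t" by (simp_all add: add.assoc)
  with 2[of u v] show ?thesis by (simp add: conj_commute Collect_conj_eq Int_ac)
qed

context complex_lattice
begin

text \<open>Iterated translation collects \<open>exp (\<eta> v * v)\<close> to the power
  \<open>n (n - 1) / 2\<close>, that is, \<open>Q\<close> to the power \<open>n\<^sup>2 - n\<close>;
  the quotient \<open>C / Q\<close> absorbs the \<open>- n\<close>.\<close>

lemma sigma_add_of_nat:
  assumes C: "C\<^sup>2 = exp (\<eta> v * v)" "\<And>z. \<sigma> (z + v) = C * exp (\<eta> v * z) * \<sigma> z"
    and Q: "Q = exp (\<eta> v * v / 2)"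
  shows "\<sigma> (z + of_nat n * v) = (C / Q * exp (\<eta> v * z)) ^ n * Q ^ n\<^sup>2 * \<sigma> z"
proof (induction n)
  case (Suc n)
  have Q0: "Q \<noteq> 0" by (simp add: Q)
  have QQ: "exp (\<eta> v * (of_nat n * v)) = Q ^ (2 * n)"
    unfolding Q by (simp add: mult_ac flip: exp_of_nat_mult)
  have sq: "(Suc n)\<^sup>2 = n\<^sup>2 + 2 * n + 1" by (simp add: power2_eq_square)
  have "\<sigma> (z + of_nat (Suc n) * v) = \<sigma> ((z + of_nat n * v) + v)" by (simp add: algebra_simps)
  also have "\<dots> = C * exp (\<eta> v * z) * Q ^ (2 * n) * \<sigma> (z + of_nat n * v)"
    by (simp only: C(2) distrib_left exp_add QQ mult.assoc)
  also have "\<dots> = (C / Q * exp (\<eta> v * z)) ^ Suc n * Q ^ (Suc n)\<^sup>2 * \<sigma> z"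
    unfolding Suc sq power_add using Q0 by simp
  finally show ?case .
qed simp

lemma zeta_add_of_nat:
  assumes "v \<in> \<Omega>" "z \<notin> \<Omega>"
  shows "\<zeta> (z + of_nat n * v) = \<zeta> z + of_nat n * \<eta> v"
  using zeta_add[OF of_nat_mult_mem[OF assms(1)] assms(2)] eta_of_nat_mult[OF assms(1)] by simp

text \<open>
  Translating by multiples of a period \<open>v\<close> with \<open>Re (\<eta> v * v) \<noteq> 0\<close> separates the powers of \<open>\<sigma>\<close>, which grow or
  decay like Gaussians. Translating by a rank two lattice then separates the multiplicative characters of
  the factors \<open>h (g m)\<close>, and turns \<open>z\<close> and \<open>\<zeta> z\<close> into free variables by the Legendre relation.
\<close>

lemma functional_independence:
  fixes c :: "'m \<Rightarrow> complex" and a b d e :: "'m \<Rightarrow> nat" and g :: "'m \<Rightarrow> 'x" and h ch :: "'x \<Rightarrow> complex \<Rightarrow> complex"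
  assumes "finite M" and B: "countable B"
    and G_add: "\<And>z v. z \<in> - \<Omega> - B \<Longrightarrow> v \<in> \<Omega> \<Longrightarrow> z + v \<in> - \<Omega> - B"
    and h_add: "\<And>m z v. m \<in> M \<Longrightarrow> z \<in> - \<Omega> - B \<Longrightarrow> v \<in> \<Omega> \<Longrightarrow> h (g m) (z + v) = ch (g m) v * h (g m) z"
    and h_nz: "\<And>m z. m \<in> M \<Longrightarrow> z \<in> - \<Omega> - B \<Longrightarrow> h (g m) z \<noteq> 0"
    and sep: "\<And>m m' v w. m \<in> M \<Longrightarrow> m' \<in> M \<Longrightarrow> v \<in> \<Omega> \<Longrightarrow> w \<in> \<Omega> \<Longrightarrow> \<eta> v * w \<noteq> \<eta> w * v \<Longrightarrow>
       ch (g m) v = ch (g m') v \<Longrightarrow> ch (g m) w = ch (g m') w \<Longrightarrow> g m = g m'"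
    and inj: "inj_on (\<lambda>m. (a m, b m, d m, e m, g m)) M"
    and rel: "\<And>z. z \<in> - \<Omega> - B \<Longrightarrow> (\<Sum>m\<in>M. c m * z ^ a m * \<zeta> z ^ b m * wp z ^ d m * \<sigma> z ^ e m * h (g m) z) = 0"
    and m0: "m0 \<in> M"
  shows "c m0 = 0"
proof -
  let ?G = "- \<Omega> - B"
  obtain v w where vw: "v \<in> \<Omega>" "w \<in> \<Omega>" "Re (\<eta> v * v) \<noteq> 0" "\<eta> v * w \<noteq> \<eta> w * v"
    using ex_period_basis .
  have h_add_n: "h (g m) (z + of_nat n * u) = ch (g m) u ^ n * h (g m) z" if "m \<in> M" "z \<in> ?G" "u \<in> \<Omega>" for m z u n
  proof (induction n)
    case (Suc n)
    have "z + of_nat n * u \<in> ?G" using G_add[OF that(2)] of_nat_mult_mem[OF that(3)] by blast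
    then have "h (g m) ((z + of_nat n * u) + u) = ch (g m) u * h (g m) (z + of_nat n * u)"
      using h_add that by blast
    then show ?case using Suc by (simp add: algebra_simps)
  qed simp
  have ch_nz: "ch (g m) u \<noteq> 0" if "m \<in> M" "u \<in> \<Omega>" for m u
  proof -
    have "infinite (wp ` ?G)" by (rule infinite_range_wp[OF B])
    then obtain z where z: "z \<in> ?G" by (metis all_not_in_conv finite.emptyI image_empty)
    then show ?thesis using h_add[OF that(1) z that(2)] h_nz[OF that(1) G_add[OF z that(2)]] by auto
  qed
  have A: "(\<Sum>m\<in>{m \<in> M. e m = k}. c m * wp z ^ d m * h (g m) z * z ^ a m * \<zeta> z ^ b m) = 0"
    if z: "z \<in> ?G" for k z
  proof -
    obtain C where C: "C\<^sup>2 = exp (\<eta> v * v)" "\<And>z. \<sigma> (z + v) = C * exp (\<eta> v * z) * \<sigma> z"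
      using sigma_quasi_periodic[OF vw(1)] by blast
    define Q where "Q = exp (\<eta> v * v / 2)"
    have "C\<^sup>2 \<noteq> 0" unfolding C(1) by simp
    then have C0: "C \<noteq> 0" by auto
    have Q: "Q \<noteq> 0" "norm Q \<noteq> 1" using vw(3) by (auto simp: Q_def)
    \<comment> \<open>Along \<open>z + n v\<close> both the argument and \<open>\<zeta>\<close> are
      linear in \<open>n\<close>, and \<open>\<wp>\<close> is constant; what varies exponentially or
      as a Gaussian goes into \<open>l\<close> and \<open>Q\<close>.\<close>
    define q where "q = (\<lambda>m. Polynomial.smult (c m * wp z ^ d m * h (g m) z * \<sigma> z ^ e m) ([:z, v:] ^ a m * [:\<zeta> z, \<eta> v:] ^ b m))"
    define l where "l = (\<lambda>m. ch (g m) v * (C / Q * exp (\<eta> v * z)) ^ e m)"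
    have "(\<Sum>m\<in>M. poly (q m) (of_nat n) * l m ^ n * Q ^ (e m * n\<^sup>2)) = 0" for n
    proof -
      have zn: "z + of_nat n * v \<in> ?G" using G_add[OF z] of_nat_mult_mem[OF vw(1)] by blast
      have "poly (q m) (of_nat n) * l m ^ n * Q ^ (e m * n\<^sup>2) =
          c m * (z + of_nat n * v) ^ a m * \<zeta> (z + of_nat n * v) ^ b m * wp (z + of_nat n * v) ^ d m *
          \<sigma> (z + of_nat n * v) ^ e m * h (g m) (z + of_nat n * v)" if m: "m \<in> M" for m
      proof -
        have e1: "\<sigma> (z + of_nat n * v) ^ e m = (C / Q * exp (\<eta> v * z)) ^ (n * e m) * Q ^ (e m * n\<^sup>2) * \<sigma> z ^ e m"
          unfolding sigma_add_of_nat[OF C Q_def]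
          by (simp only: power_mult_distrib power_mult[symmetric] mult.commute[of "e m"])
        have e2: "l m ^ n = ch (g m) v ^ n * (C / Q * exp (\<eta> v * z)) ^ (n * e m)"
          by (simp only: l_def power_mult_distrib power_mult[symmetric] mult.commute[of "e m"])
        have e3: "\<zeta> (z + of_nat n * v) = \<zeta> z + of_nat n * \<eta> v" "wp (z + of_nat n * v) = wp z"
          using zeta_add_of_nat[OF vw(1)] wp_add[OF of_nat_mult_mem[OF vw(1)]] z by auto
        have e4: "poly (q m) (of_nat n) = c m * wp z ^ d m * h (g m) z * \<sigma> z ^ e m *
            ((z + of_nat n * v) ^ a m * (\<zeta> z + of_nat n * \<eta> v) ^ b m)"
          by (simp add: q_def)
        show ?thesis
          unfolding e1 e2 e3 e4 h_add_n[OF m z vw(1)] by (simp only: mult_ac)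
      qed
      then show ?thesis using rel[OF zn] by (simp cong: sum.cong)
    qed
    \<comment> \<open>Taking \<open>n = 0\<close> returns to the values at \<open>z\<close> itself,
      and the common factor \<open>\<sigma> z ^ k\<close> is nonzero off the lattice.\<close>
    then have "(\<Sum>m\<in>{m \<in> M. e m = k}. poly (q m) (of_nat 0) * l m ^ 0) = 0"
      by (intro gaussian_separation[OF assms(1) _ Q(2,1)]) (use ch_nz vw(1) C0 Q(1) in \<open>auto simp: l_def\<close>)
    also have "(\<Sum>m\<in>{m \<in> M. e m = k}. poly (q m) (of_nat 0) * l m ^ 0) =
        \<sigma> z ^ k * (\<Sum>m\<in>{m \<in> M. e m = k}. c m * wp z ^ d m * h (g m) z * z ^ a m * \<zeta> z ^ b m)"
      unfolding sum_distrib_left by (intro sum.cong) (auto simp: q_def)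
    finally show ?thesis using z by (simp add: sigma_eq_0_iff)
  qed
  \<comment> \<open>The terms with the power of \<open>\<sigma>\<close> and both multipliers of
    \<open>m0\<close>. By \<open>sep\<close> they share \<open>g m0\<close>, so the nonzero factor
    \<open>h (g m0) z\<close> can be divided out, leaving a polynomial relation in three
    variables.\<close>
  define L where "L = {m \<in> {m \<in> M. e m = e m0}. ch (g m) v = ch (g m0) v \<and> ch (g m) w = ch (g m0) w}"
  have Lg: "g m = g m0" if "m \<in> L" for m
    using sep[of m m0 v w] that m0 vw by (auto simp: L_def)
  have L_rel: "(\<Sum>m\<in>L. c m * x ^ a m * y ^ b m * u ^ d m) = 0" if u: "u \<in> wp ` ?G" for x y u
  proof -
    obtain z where z: "z \<in> ?G" "u = wp z" using u by auto
    have "(\<Sum>m\<in>{m \<in> {m \<in> M. e m = e m0}. ch (g m) v = ch (g m0) v \<and> ch (g m) w = ch (g m0) w}.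
        (c m * wp z ^ d m * h (g m) z) * x ^ a m * y ^ b m) = 0"
    proof (rule shift_relation_classes[where z = z and y = "\<zeta> z" and ?w1.0 = v and ?w2.0 = w and ?e1.0 = "\<eta> v" and ?e2.0 = "\<eta> w"])
      show "v * \<eta> w \<noteq> w * \<eta> v" using vw(4) by (simp add: mult.commute)
      fix n1 n2 :: nat
      let ?u = "of_nat n1 * v + of_nat n2 * w"
      have u: "?u \<in> \<Omega>" "of_nat n1 * v \<in> \<Omega>" "of_nat n2 * w \<in> \<Omega>" using vw of_nat_mult_mem by auto
      have zn: "z + of_nat n1 * v \<in> ?G" "z + of_nat n1 * v + of_nat n2 * w \<in> ?G"
        using G_add[OF z(1) u(2)] G_add[OF G_add[OF z(1) u(2)] u(3)] by auto
      have e1: "\<zeta> (z + of_nat n1 * v + of_nat n2 * w) = \<zeta> z + of_nat n1 * \<eta> v + of_nat n2 * \<eta> w"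
        using zeta_add_of_nat[OF vw(2)] zeta_add_of_nat[OF vw(1)] z(1) zn(1) by simp
      have e2: "wp (z + of_nat n1 * v + of_nat n2 * w) = wp z"
        using wp_add[OF u(3)] wp_add[OF u(2)] z(1) zn(1) by simp
      have e3: "h (g m) (z + of_nat n1 * v + of_nat n2 * w) = ch (g m) v ^ n1 * ch (g m) w ^ n2 * h (g m) z" if "m \<in> M" for m
        using h_add_n[OF that zn(1) vw(2)] h_add_n[OF that z(1) vw(1)] by simp
      have "(\<Sum>m\<in>{m \<in> M. e m = e m0}. c m * wp z ^ d m * (ch (g m) v ^ n1 * ch (g m) w ^ n2 * h (g m) z) * (z + of_nat n1 * v + of_nat n2 * w) ^ a m *
          (\<zeta> z + of_nat n1 * \<eta> v + of_nat n2 * \<eta> w) ^ b m) =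
          (\<Sum>m\<in>{m \<in> M. e m = e m0}. c m * wp z ^ d m * h (g m) (z + of_nat n1 * v + of_nat n2 * w) * (z + of_nat n1 * v + of_nat n2 * w) ^ a m *
          (\<zeta> z + of_nat n1 * \<eta> v + of_nat n2 * \<eta> w) ^ b m)"
        by (rule sum.cong) (auto simp: e3)
      also have "\<dots> = 0" using A[OF zn(2), of "e m0"] unfolding e1 e2 .
      finally have "(\<Sum>m\<in>{m \<in> M. e m = e m0}. c m * wp z ^ d m * (ch (g m) v ^ n1 * ch (g m) w ^ n2 * h (g m) z) * (z + of_nat n1 * v + of_nat n2 * w) ^ a m *
          (\<zeta> z + of_nat n1 * \<eta> v + of_nat n2 * \<eta> w) ^ b m) = 0" .
      then show "(\<Sum>m\<in>{m \<in> M. e m = e m0}. c m * wp z ^ d m * h (g m) z * (z + of_nat n1 * v + of_nat n2 * w) ^ a m *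
          (\<zeta> z + of_nat n1 * \<eta> v + of_nat n2 * \<eta> w) ^ b m * ch (g m) v ^ n1 * ch (g m) w ^ n2) = 0"
        by (simp only: mult_ac)
    qed (use assms(1) ch_nz vw in auto)
    then have "(\<Sum>m\<in>L. h (g m0) z * (c m * x ^ a m * y ^ b m * u ^ d m)) = 0"
      unfolding L_def[symmetric] z(2) using Lg by (simp add: mult_ac cong: sum.cong)
    then show ?thesis using h_nz[OF m0 z(1)] by (simp flip: sum_distrib_left)
  qed
  have L_inj: "inj_on (\<lambda>m. (a m, b m, d m)) L"
  proof (rule inj_onI)
    fix x y assume xy: "x \<in> L" "y \<in> L" "(a x, b x, d x) = (a y, b y, d y)"
    moreover have "e x = e y" "x \<in> M" "y \<in> M" using xy by (auto simp: L_def)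
    moreover have "g x = g y" using Lg xy(1,2) by simp
    ultimately show "x = y" using inj_onD[OF inj, of x y] by simp
  qed
  have L: "finite L" "m0 \<in> L" using assms(1) m0 by (auto simp: L_def)
  show ?thesis
    by (rule power_sum3_zero[OF L(1) infinite_range_wp[OF B] L_rel L_inj L(2)])
qed

end

section \<open>From functions to almost all tuples of values\<close>

text \<open>Fubini without a choice of coordinates: translation invariance makes the measure of
  \<open>N\<close> equal to its average over the translates along \<open>v\<close>, with a parameter
  in the unit interval. With the order of integration exchanged, the inner integral is over a
  countable set of parameters and vanishes.\<close>

lemma null_set_of_countable_lines:
  fixes N :: "'a::euclidean_space set" and v :: 'a
  assumes N: "N \<in> sets borel" and lines: "\<And>z. countable {x::real. z + x *\<^sub>R v \<in> N}"
  shows "N \<in> null_sets lborel"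
proof -
  let ?f = "\<lambda>(x::real, z). indicator {0..1} x * indicator N (z + x *\<^sub>R v) :: ennreal"
  have meas: "?f \<in> borel_measurable (lborel \<Otimes>\<^sub>M lborel)"
    using N by measurable
  have shift: "(\<integral>\<^sup>+z. indicator N (z + c) \<partial>lborel) = emeasure lborel N" for c :: 'a
  proof -
    have "emeasure lborel N = (\<integral>\<^sup>+z. indicator N z \<partial>distr lborel borel ((+) c))"
      using N by (simp add: lborel_distr_plus)
    also have "\<dots> = (\<integral>\<^sup>+z. indicator N (c + z) \<partial>lborel)"
      using N by (intro nn_integral_distr) auto
    finally show ?thesis by (simp add: add.commute)
  qed
  have "emeasure lborel N = (\<integral>\<^sup>+x. indicator {0..1::real} x * emeasure lborel N \<partial>lborel)"
    by (subst nn_integral_multc) auto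
  also have "\<dots> = (\<integral>\<^sup>+x. \<integral>\<^sup>+z. ?f (x, z) \<partial>lborel \<partial>lborel)"
    using N by (intro nn_integral_cong) (simp add: nn_integral_cmult shift)
  also have "\<dots> = (\<integral>\<^sup>+z. \<integral>\<^sup>+x. ?f (x, z) \<partial>lborel \<partial>lborel)"
    using lborel_pair.Fubini[OF meas] by simp
  also have "\<dots> = (\<integral>\<^sup>+z. 0 \<partial>(lborel :: 'a measure))"
  proof (rule nn_integral_cong)
    fix z :: 'a
    have "AE x in lborel. x \<notin> {x::real. z + x *\<^sub>R v \<in> N}"
      by (rule AE_not_in) (rule countable_imp_null_set_lborel[OF lines])
    then have "AE x in lborel. ?f (x, z) = 0" by eventually_elim auto
    then have "(\<integral>\<^sup>+x. ?f (x, z) \<partial>lborel) = (\<integral>\<^sup>+x. 0 \<partial>(lborel :: real measure))"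
      by (rule nn_integral_cong_AE)
    then show "(\<integral>\<^sup>+x. ?f (x, z) \<partial>lborel) = 0" by simp
  qed
  finally show ?thesis using N by (intro null_setsI) auto
qed

text \<open>Provides the topological hypothesis of the theorem on countability of the zeros of a
  holomorphic function.\<close>

lemma open_imp_fsigma:
  fixes S :: "'a::euclidean_space set"
  assumes "open S"
  shows "fsigma S"
proof -
  obtain D where D: "countable D" "\<And>Y. Y \<in> D \<Longrightarrow> \<exists>a b. Y = cbox a b" "\<Union>D = S"
    using open_countable_Union_open_cbox[OF assms] by metis
  show ?thesis
  proof (cases "D = {}")
    case True
    then show ?thesis using D(3) fsigma.intros[of "\<lambda>_. {}"] by simp
  next
    case False
    have "closed (from_nat_into D n)" for n
      using D(2)[OF from_nat_into[OF False, of n]] by auto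
    then have "fsigma (\<Union> (range (from_nat_into D)))" by (rule fsigma.intros)
    then show ?thesis using range_from_nat_into[OF False D(1)] D(3) by simp
  qed
qed

lemma open_product_set:
  fixes G :: "complex set"
  assumes "open G"
  shows "open {z :: complex ^ 'n. \<forall>i. z $ i \<in> G}"
proof -
  have "{z :: complex ^ 'n. \<forall>i. z $ i \<in> G} = (\<Inter>i. (\<lambda>z. z $ i) -` G)" by auto
  then show ?thesis
    using assms by (auto intro!: open_INT open_vimage continuous_intros)
qed

lemma zero_set_borel:
  fixes F :: "'a::topological_space \<Rightarrow> complex"
  assumes "open U" "continuous_on U F"
  shows "{z \<in> U. F z = 0} \<in> sets borel"
proof -
  have "open (U \<inter> F -` (- {0}))"
    using assms by (intro continuous_open_preimage) auto
  moreover have "{z \<in> U. F z = 0} = U - (U \<inter> F -` (- {0}))" by auto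
  ultimately show ?thesis using assms(1) by (metis borel_open sets.Diff)
qed

text \<open>
  Induction on the set \<open>S\<close> of active coordinates: fixing all coordinates but one leaves a combination of the
  \<open>\<phi> k\<close> in one complex variable, which has countably many zeros unless all its coefficients vanish; the
  coefficients involve one coordinate less.
\<close>

lemma tensor_zero_set_null:
  fixes \<phi> :: "'k \<Rightarrow> complex \<Rightarrow> complex" and c :: "('n::finite \<Rightarrow> 'k) \<Rightarrow> complex"
  assumes G: "open G" "connected G"
    and hol: "\<And>k. k \<in> KK \<Longrightarrow> \<phi> k holomorphic_on G"
    and indep: "\<And>M a k. finite M \<Longrightarrow> M \<subseteq> KK \<Longrightarrow> (\<And>z. z \<in> G \<Longrightarrow> (\<Sum>k\<in>M. a k * \<phi> k z) = 0) \<Longrightarrow> k \<in> M \<Longrightarrow> a k = 0"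
    and "finite M" "\<And>\<kappa> i. \<kappa> \<in> M \<Longrightarrow> \<kappa> i \<in> KK" "inj_on (\<lambda>\<kappa>. restrict \<kappa> S) M" "\<kappa>0 \<in> M" "c \<kappa>0 \<noteq> 0"
  shows "{z :: complex ^ 'n. (\<forall>i. z $ i \<in> G) \<and> (\<Sum>\<kappa>\<in>M. c \<kappa> * (\<Prod>i\<in>S. \<phi> (\<kappa> i) (z $ i))) = 0} \<in> null_sets lborel"
proof -
  have "finite S" by simp
  then show ?thesis using assms(5-)
  proof (induction S arbitrary: M \<kappa>0 rule: finite_induct)
    case empty
    \<comment> \<open>With no active coordinate all restrictions coincide, so injectivity leaves a
      single term; its product is empty, and the sum is the nonzero constant
      \<open>c \<kappa>0\<close>.\<close>
    then have "M = {\<kappa>0}" by (auto simp: inj_on_def restrict_def)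
    then show ?case using empty by simp
  next
    case (insert i0 S)
    define GG where "GG = {z :: complex ^ 'n. \<forall>i. z $ i \<in> G}"
    define F where "F = (\<lambda>z :: complex ^ 'n. \<Sum>\<kappa>\<in>M. c \<kappa> * (\<Prod>i\<in>insert i0 S. \<phi> (\<kappa> i) (z $ i)))"
    define A where "A = (\<lambda>k (z :: complex ^ 'n). \<Sum>\<kappa>\<in>{\<kappa> \<in> M. \<kappa> i0 = k}. c \<kappa> * (\<Prod>i\<in>S. \<phi> (\<kappa> i) (z $ i)))"
    have GG: "open GG" unfolding GG_def by (rule open_product_set[OF G(1)])
    have \<phi>_cont: "continuous_on GG (\<lambda>z. \<phi> k (z $ i))" if "k \<in> KK" for k i
      by (rule continuous_on_compose2[OF holomorphic_on_imp_continuous_on[OF hol[OF that]]])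
        (auto intro!: continuous_intros simp: GG_def)
    have F_cont: "continuous_on GG F" unfolding F_def
      using insert.prems(2) by (intro continuous_on_sum continuous_on_mult continuous_on_prod \<phi>_cont continuous_on_const) auto
    have A_cont: "continuous_on GG (A k)" for k unfolding A_def
      using insert.prems(2) by (intro continuous_on_sum continuous_on_mult continuous_on_prod \<phi>_cont continuous_on_const) auto
    let ?k0 = "\<kappa>0 i0"
    have A_null: "{z \<in> GG. A ?k0 z = 0} \<in> null_sets lborel"
      unfolding A_def GG_def mem_Collect_eq
    proof (rule insert.IH)
      show "inj_on (\<lambda>\<kappa>. restrict \<kappa> S) {\<kappa> \<in> M. \<kappa> i0 = ?k0}"
      proof (rule inj_onI)
        fix x y assume xy: "x \<in> {\<kappa> \<in> M. \<kappa> i0 = ?k0}" "y \<in> {\<kappa> \<in> M. \<kappa> i0 = ?k0}" "restrict x S = restrict y S"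
        then have "restrict x (insert i0 S) = restrict y (insert i0 S)"
          by (auto simp: restrict_def fun_eq_iff) metis
        then show "x = y" using inj_onD[OF insert.prems(3)] xy by blast
      qed
    qed (use insert.prems in auto)
    \<comment> \<open>Off the zeros of the coefficient \<open>A ?k0\<close>, a null set by
      induction, each line in the real direction of coordinate \<open>i0\<close> meets the zero set
      in countably many points.\<close>
    define N where "N = {z \<in> GG. F z = 0} - {z \<in> GG. A ?k0 z = 0}"
    have "N \<in> null_sets lborel"
    proof (rule null_set_of_countable_lines[where v = "axis i0 1"])
      show "N \<in> sets borel" unfolding N_def
        by (intro sets.Diff zero_set_borel GG F_cont A_cont)
      fix z :: "complex ^ 'n"
      have coord: "(z + x *\<^sub>R axis i0 1) $ i = (if i = i0 then z $ i0 + of_real x else z $ i)" for x i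
        by (simp add: axis_def of_real_def)
      define K where "K = (\<lambda>\<kappa>. \<kappa> i0) ` M"
      define g where "g = (\<lambda>u. \<Sum>k\<in>K. A k z * \<phi> k u)"
      have K: "finite K" "K \<subseteq> KK" "?k0 \<in> K" using insert.prems by (auto simp: K_def)
      have A_line: "A k (z + x *\<^sub>R axis i0 1) = A k z" for k x
        unfolding A_def coord using insert.hyps(2) by (intro sum.cong prod.cong arg_cong2[of _ _ _ _ "(*)"] refl) auto
      have F_split: "F y = (\<Sum>k\<in>K. A k y * \<phi> k (y $ i0))" for y
        unfolding F_def K_def A_def sum.image_gen[OF insert.prems(1), of _ "\<lambda>\<kappa>. \<kappa> i0"] sum_distrib_right
        using insert.hyps by (intro sum.cong refl) (auto simp: mult_ac)
      have F_line: "F (z + x *\<^sub>R axis i0 1) = g (z $ i0 + of_real x)" for x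
        unfolding F_split A_line g_def coord by simp
      show "countable {x. z + x *\<^sub>R axis i0 1 \<in> N}"
      proof (cases "A ?k0 z = 0")
        case True
        then have "{x. z + x *\<^sub>R axis i0 1 \<in> N} = {}" by (auto simp: N_def A_line)
        then show ?thesis by simp
      next
        case False
        have g_hol: "g holomorphic_on G"
          unfolding g_def using K(2) by (intro holomorphic_on_sum holomorphic_on_mult holomorphic_on_const hol) auto
        have "\<not> (\<forall>u\<in>G. g u = 0)"
          using indep[OF K(1,2), of "\<lambda>k. A k z" ?k0] K(3) False unfolding g_def by blast
        then obtain u0 where u0: "u0 \<in> G" "g u0 \<noteq> 0" by blast
        have "countable {u \<in> G. g u = 0}"
        \<comment> \<open>Countability of zeros is available for nonconstant functions; a constant
          \<open>g\<close> has no zeros because of \<open>u0\<close>.\<close>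
        proof (cases "g constant_on G")
          case True
          then have e: "{u \<in> G. g u = 0} = {}" using u0 unfolding constant_on_def by auto
          show ?thesis unfolding e by simp
        next
          case False
          show ?thesis
            by (rule holomorphic_countable_zeros[OF g_hol G _ False]) (rule open_imp_fsigma[OF G(1)])
        qed
        then have "countable ((\<lambda>x::real. z $ i0 + of_real x) ` {x. z + x *\<^sub>R axis i0 1 \<in> N})"
        proof (rule countable_subset[rotated], intro image_subsetI)
          fix x assume "x \<in> {x. z + x *\<^sub>R axis i0 1 \<in> N}"
          then have "z + x *\<^sub>R axis i0 1 \<in> GG" "F (z + x *\<^sub>R axis i0 1) = 0" by (auto simp: N_def)
          then have "(z + x *\<^sub>R axis i0 1) $ i0 \<in> G" "g (z $ i0 + of_real x) = 0"
            by (auto simp only: F_line GG_def mem_Collect_eq)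
          then show "z $ i0 + of_real x \<in> {u \<in> G. g u = 0}" unfolding coord by simp
        qed
        then show ?thesis by (rule countable_image_inj_on) (auto simp: inj_on_def)
      qed
    qed
    from null_sets.Un[OF this A_null]
    have "N \<union> {z \<in> GG. A ?k0 z = 0} \<in> null_sets lborel" .
    moreover have "{z \<in> GG. F z = 0} \<in> sets lborel" using zero_set_borel[OF GG F_cont] by simp
    moreover have "{z \<in> GG. F z = 0} \<subseteq> N \<union> {z \<in> GG. A ?k0 z = 0}" by (auto simp: N_def)
    ultimately have "{z \<in> GG. F z = 0} \<in> null_sets lborel" by (rule null_sets_subset)
    then show ?case by (simp add: GG_def F_def)
  qed
qed

text \<open>A finitely supported map is determined by its graph over the support, a finite subset of
  \<open>A \<times> B\<close>. This is applied to monomials and then to polynomials.\<close>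

lemma countable_poly_mapping:
  fixes A :: "'a set" and B :: "'b::zero set"
  assumes "countable A" "countable B"
  shows "countable {p :: 'a \<Rightarrow>\<^sub>0 'b. \<forall>k\<in>Poly_Mapping.keys p. k \<in> A \<and> Poly_Mapping.lookup p k \<in> B}" (is "countable ?P")
proof (rule countable_image_inj_on)
  let ?g = "\<lambda>p :: 'a \<Rightarrow>\<^sub>0 'b. (\<lambda>k. (k, Poly_Mapping.lookup p k)) ` Poly_Mapping.keys p"
  have "?g ` ?P \<subseteq> {E. finite E \<and> E \<subseteq> A \<times> B}" by auto
  moreover have "countable {E. finite E \<and> E \<subseteq> A \<times> B}"
    using assms by (intro countable_Collect_finite_subset) auto
  ultimately show "countable (?g ` ?P)" using countable_subset by blast
  show "inj_on ?g ?P"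
  proof (rule inj_onI, rule poly_mapping_eqI)
    fix p q :: "'a \<Rightarrow>\<^sub>0 'b" and k assume eq: "?g p = ?g q"
    have *: "Poly_Mapping.lookup p k = Poly_Mapping.lookup q k"
      if "?g p \<subseteq> ?g q" "k \<in> Poly_Mapping.keys p" for p q :: "'a \<Rightarrow>\<^sub>0 'b"
      using that by auto
    show "Poly_Mapping.lookup p k = Poly_Mapping.lookup q k"
      using *[of p q] *[of q p] eq by (metis in_keys_iff subset_refl)
  qed
qed

text \<open>The generated field is covered by countably many rounds of the field operations, each of
  which keeps a set countable. Two elements are brought into a common round by monotonicity.\<close>

lemma countable_generate_field:
  assumes "countable H"
  shows "countable (generate_field CC H)"
proof -
  define step :: "complex set \<Rightarrow> complex set" where
    "step = (\<lambda>Y. Y \<union> (\<lambda>x. - x) ` Y \<union> inverse ` Y \<union> (\<lambda>(x, y). x + y) ` (Y \<times> Y) \<union> (\<lambda>(x, y). x * y) ` (Y \<times> Y))"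
  define E where "E = (\<lambda>n. (step ^^ n) (insert 1 H))"
  have cnt: "countable (E n)" for n
    by (induction n) (use assms in \<open>auto simp: E_def step_def\<close>)
  have E_Suc: "E (Suc n) = step (E n)" for n by (simp add: E_def)
  have mono: "m \<le> n \<Longrightarrow> E m \<subseteq> E n" for m n
    by (rule lift_Suc_mono_le[of E]) (auto simp: E_Suc step_def)
  interpret CC: Ring.field CC by (rule field_from_type_algebra)
  have sub: "x \<in> (\<Union>n. E n)" if "x \<in> generate_field CC H" for x
    using that
  proof (induction rule: generate_field.induct)
    case one
    then show ?case by (auto simp: E_def ring_of_type_algebra_def intro: exI[of _ 0])
  next
    case (incl h)
    then show ?case by (auto simp: E_def intro: exI[of _ 0])
  next
    case (a_inv h)
    then obtain n where "h \<in> E n" by blast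
    then have "- h \<in> E (Suc n)" by (auto simp: E_Suc step_def)
    moreover have "\<ominus>\<^bsub>CC\<^esub> h = - h"
      by (rule CC.minus_equality) (auto simp: ring_of_type_algebra_def)
    ultimately show ?case by auto
  next
    case (m_inv h)
    then obtain n where "h \<in> E n" by blast
    then have "inverse h \<in> E (Suc n)" by (auto simp: E_Suc step_def)
    moreover have "inv\<^bsub>CC\<^esub> h = inverse h"
      using m_inv by (intro CC.inv_char) (auto simp: ring_of_type_algebra_def)
    ultimately show ?case by auto
  next
    case (eng_add h1 h2)
    then obtain m n where "h1 \<in> E m" "h2 \<in> E n" by blast
    then have "h1 \<in> E (max m n)" "h2 \<in> E (max m n)" using mono by (meson max.cobounded1 max.cobounded2 subsetD)+
    then have "h1 + h2 \<in> E (Suc (max m n))" by (auto simp: E_Suc step_def)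
    then show ?case by (auto simp: ring_of_type_algebra_def)
  next
    case (eng_mult h1 h2)
    then obtain m n where "h1 \<in> E m" "h2 \<in> E n" by blast
    then have "h1 \<in> E (max m n)" "h2 \<in> E (max m n)" using mono by (meson max.cobounded1 max.cobounded2 subsetD)+
    then have "h1 * h2 \<in> E (Suc (max m n))" by (auto simp: E_Suc step_def)
    then show ?case by (auto simp: ring_of_type_algebra_def)
  qed
  then have "generate_field CC H \<subseteq> (\<Union>n. E n)" by blast
  then show ?thesis using cnt by (meson countable_UN countable_subset countableI_type)
qed

text \<open>A polynomial in the values at all coordinates is a combination of tensor products of the
  one-variable monomials in \<open>f\<close>, so independence of these monomials on \<open>G\<close>
  makes each zero set null. Countability of \<open>F\<close> leaves countably many polynomials to
  exclude.\<close>

lemma AE_algebraically_independent: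
  fixes f :: "nat \<Rightarrow> complex \<Rightarrow> complex"
  assumes F: "countable F" and G: "open G" "connected G" "countable (- G)"
    and hol: "\<And>l. l < L \<Longrightarrow> f l holomorphic_on G"
    and indep: "\<And>M a k. finite M \<Longrightarrow> (\<And>k l. k \<in> M \<Longrightarrow> L \<le> l \<Longrightarrow> k l = 0) \<Longrightarrow>
       (\<And>z. z \<in> G \<Longrightarrow> (\<Sum>k\<in>M. a k * (\<Prod>l<L. f l z ^ k l)) = 0) \<Longrightarrow> k \<in> M \<Longrightarrow> a k = 0"
  shows "AE z :: complex ^ 'n in lebesgue. algebraically_independent F (UNIV \<times> {..<L}) (\<lambda>(i, l). f l (z $ i))"
proof -
  let ?x = "\<lambda>(z :: complex ^ 'n) (i, l). f l (z $ i)"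
  define KK where "KK = {k :: nat \<Rightarrow> nat. \<forall>l\<ge>L. k l = 0}"
  define \<phi> where "\<phi> = (\<lambda>k z. \<Prod>l<L. f l z ^ k l)"
  define Ps where "Ps = {p :: (('n \<times> nat) \<Rightarrow>\<^sub>0 nat) \<Rightarrow>\<^sub>0 complex.
     \<forall>m\<in>Poly_Mapping.keys p. Poly_Mapping.lookup p m \<in> F \<and> Poly_Mapping.keys m \<subseteq> UNIV \<times> {..<L}}"
  have "countable (UNIV :: (('n \<times> nat) \<Rightarrow>\<^sub>0 nat) set)"
    using countable_poly_mapping[of "UNIV :: ('n \<times> nat) set" "UNIV :: nat set"] by simp
  then have "countable {p :: (('n \<times> nat) \<Rightarrow>\<^sub>0 nat) \<Rightarrow>\<^sub>0 complex. \<forall>m\<in>Poly_Mapping.keys p. m \<in> UNIV \<and> Poly_Mapping.lookup p m \<in> F}"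
    using F by (rule countable_poly_mapping)
  then have Ps: "countable Ps" by (rule countable_subset[rotated]) (auto simp: Ps_def)
  have bad: "AE z in lebesgue. (\<forall>i. z $ i \<in> G) \<longrightarrow> poly_eval (?x z) p \<noteq> 0" if p: "p \<in> Ps" "p \<noteq> 0" for p
  proof -
    \<comment> \<open>A monomial is read as a family of exponent vectors, one for each
      coordinate.\<close>
    define \<kappa> where "\<kappa> = (\<lambda>m :: ('n \<times> nat) \<Rightarrow>\<^sub>0 nat. \<lambda>i l. Poly_Mapping.lookup m (i, l))"
    let ?K = "Poly_Mapping.keys p"
    have inj: "inj \<kappa>"
      by (rule injI, rule poly_mapping_eqI) (auto simp: \<kappa>_def fun_eq_iff)
    obtain m0 where m0: "m0 \<in> ?K" using p(2) by (metis all_not_in_conv keys_eq_empty)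
    define c where "c = (\<lambda>k. Poly_Mapping.lookup p (inv_into UNIV \<kappa> k))"
    have mono: "(\<Prod>i\<in>Poly_Mapping.keys m. ?x z i ^ Poly_Mapping.lookup m i) = (\<Prod>i\<in>UNIV. \<phi> (\<kappa> m i) (z $ i))"
      if "m \<in> ?K" for m z
    proof -
      have "(\<Prod>i\<in>Poly_Mapping.keys m. ?x z i ^ Poly_Mapping.lookup m i) =
          (\<Prod>i\<in>UNIV \<times> {..<L}. ?x z i ^ Poly_Mapping.lookup m i)"
        using that p(1) by (intro prod.mono_neutral_left) (auto simp: Ps_def in_keys_iff)
      also have "\<dots> = (\<Prod>i\<in>UNIV. \<Prod>l<L. ?x z (i, l) ^ Poly_Mapping.lookup m (i, l))"
        by (subst prod.cartesian_product) (simp add: case_prod_unfold)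
      finally show ?thesis by (simp add: \<phi>_def \<kappa>_def)
    qed
    have ev: "poly_eval (?x z) p = (\<Sum>k\<in>\<kappa> ` ?K. c k * (\<Prod>i\<in>UNIV. \<phi> (k i) (z $ i)))" for z
      using inj unfolding poly_eval_def
      by (subst sum.reindex) (auto intro!: sum.cong simp: mono c_def inj_on_def inv_f_f dest: injD)
    have "{z :: complex ^ 'n. (\<forall>i. z $ i \<in> G) \<and> (\<Sum>k\<in>\<kappa> ` ?K. c k * (\<Prod>i\<in>UNIV. \<phi> (k i) (z $ i))) = 0} \<in> null_sets lborel"
    proof (rule tensor_zero_set_null[OF G(1,2)])
      show "\<phi> k holomorphic_on G" for k
        unfolding \<phi>_def by (intro holomorphic_on_prod holomorphic_on_power hol) auto
      show "a k = 0" if "finite M" "M \<subseteq> KK" "\<And>z. z \<in> G \<Longrightarrow> (\<Sum>k\<in>M. a k * \<phi> k z) = 0" "k \<in> M" for M a k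
        by (rule indep[OF that(1) _ _ that(4)]) (use that(2,3) in \<open>auto simp: KK_def \<phi>_def\<close>)
      show "\<kappa> m0 \<in> \<kappa> ` ?K" using m0 by simp
      show "c (\<kappa> m0) \<noteq> 0" using m0 inj by (simp add: c_def inv_f_f in_keys_iff)
      show "k i \<in> KK" if k: "k \<in> \<kappa> ` ?K" for k i
      proof -
        obtain m where m: "m \<in> ?K" "k = \<kappa> m" using k by blast
        then have "Poly_Mapping.keys m \<subseteq> UNIV \<times> {..<L}" using p(1) by (auto simp: Ps_def)
        then have "(i, l) \<notin> Poly_Mapping.keys m" if "L \<le> l" for l using that by auto
        then show ?thesis by (auto simp: KK_def m(2) \<kappa>_def in_keys_iff)
      qed
    qed (auto simp: restrict_UNIV)
    then have "{z :: complex ^ 'n. (\<forall>i. z $ i \<in> G) \<and> poly_eval (?x z) p = 0} \<in> null_sets lebesgue"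
      unfolding ev by (rule null_sets_completionI)
    then show ?thesis by (rule AE_I') auto
  qed
  have good: "AE z :: complex ^ 'n in lebesgue. z $ i \<in> G" for i
  proof -
    have "{z :: complex ^ 'n. z $ i \<notin> G} \<in> null_sets lborel"
    proof (rule null_set_of_countable_lines[where v = "axis i 1"])
      have "{z :: complex ^ 'n. z $ i \<notin> G} = (\<lambda>z. z $ i) -` (- G)" by auto
      moreover have "closed \<dots>" using G(1) by (intro closed_vimage continuous_intros) auto
      ultimately show "{z :: complex ^ 'n. z $ i \<notin> G} \<in> sets borel" by (metis borel_closed)
      fix z :: "complex ^ 'n"
      have "(\<lambda>x::real. z $ i + of_real x) ` {x. z + x *\<^sub>R axis i 1 \<in> {z. z $ i \<notin> G}} \<subseteq> - G"
        by (auto simp: axis_def of_real_def)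
      then have "countable ((\<lambda>x::real. z $ i + of_real x) ` {x. z + x *\<^sub>R axis i 1 \<in> {z. z $ i \<notin> G}})"
        using G(3) countable_subset by blast
      then show "countable {x. z + x *\<^sub>R axis i 1 \<in> {z. z $ i \<notin> G}}"
        by (rule countable_image_inj_on) (auto simp: inj_on_def)
    qed
    then have "{z :: complex ^ 'n. z $ i \<notin> G} \<in> null_sets lebesgue" by (rule null_sets_completionI)
    then show ?thesis by (rule AE_I') auto
  qed
  have "AE z :: complex ^ 'n in lebesgue. \<forall>i\<in>UNIV. z $ i \<in> G"
    using good by (intro AE_finite_allI) auto
  moreover have "AE z :: complex ^ 'n in lebesgue. \<forall>p\<in>Ps - {0}. (\<forall>i. z $ i \<in> G) \<longrightarrow> poly_eval (?x z) p \<noteq> 0"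
    by (subst AE_ball_countable) (use Ps bad in auto)
  ultimately show ?thesis
  proof eventually_elim
    case (elim z)
    then show ?case unfolding algebraically_independent_def Ps_def by auto
  qed
qed

section \<open>Families of functions with multipliers\<close>

lemma sum_lessThan_append:
  fixes F :: "nat \<Rightarrow> 'a \<Rightarrow> complex"
  shows "(\<Sum>j<length (xs @ ys). F j ((xs @ ys) ! j)) =
    (\<Sum>j<length xs. F j (xs ! j)) + (\<Sum>j<length ys. F (length xs + j) (ys ! j))"
proof (induction ys rule: rev_induct)
  case (snoc y ys)
  have "(\<Sum>j<length (xs @ ys @ [y]). F j ((xs @ ys @ [y]) ! j)) =
      (\<Sum>j<length (xs @ ys). F j ((xs @ ys @ [y]) ! j)) + F (length xs + length ys) y"
    by (simp add: nth_append)
  also have "(\<Sum>j<length (xs @ ys). F j ((xs @ ys @ [y]) ! j)) = (\<Sum>j<length (xs @ ys). F j ((xs @ ys) ! j))"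
    by (intro sum.cong refl) (auto simp: nth_append)
  finally show ?case by (simp only: snoc) (simp add: nth_append)
qed simp

lemma prod_lessThan_add:
  fixes F :: "nat \<Rightarrow> complex"
  shows "(\<Prod>l<m + n. F l) = (\<Prod>l<m. F l) * (\<Prod>j<n. F (m + j))"
  by (induction n) (simp_all add: mult.assoc)

text \<open>\<open>ring.independent\<close> says inductively that the head lies outside the span of
  the tail. A relation with nonzero head coefficient can be solved for the head, and closure of
  \<open>F\<close> under \<open>- x / y\<close> keeps the new coefficients in
  \<open>F\<close>.\<close>

lemma independent_imp_coeffs_zero:
  assumes "ring.independent CC F us"
    and F: "\<And>x y. x \<in> F \<Longrightarrow> y \<in> F \<Longrightarrow> y \<noteq> 0 \<Longrightarrow> - x / y \<in> F"
    and "\<And>i. i < length us \<Longrightarrow> c i \<in> F" "(\<Sum>i<length us. c i * us ! i) = 0"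
  shows "\<forall>i<length us. c i = 0"
proof -
  interpret CC: Ring.ring CC by (rule ring_from_type_algebra)
  have CC_ops: "\<zero>\<^bsub>CC\<^esub> = 0" "\<And>x y. x \<otimes>\<^bsub>CC\<^esub> y = x * y" "\<And>x y. x \<oplus>\<^bsub>CC\<^esub> y = x + y"
    by (simp_all add: ring_of_type_algebra_def)
  have Span: "(\<Sum>i<length vs. d i * vs ! i) \<in> CC.Span F vs" if "\<And>i. i < length vs \<Longrightarrow> d i \<in> F" for d vs
    using that
  proof (induction vs arbitrary: d)
    case Nil
    then show ?case by (simp add: CC_ops)
  next
    case (Cons v vs)
    have "(\<Sum>i<length vs. d (Suc i) * vs ! i) \<in> CC.Span F vs"
      by (rule Cons.IH) (use Cons.prems in auto)
    moreover have "d 0 \<in> F" using Cons.prems by auto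
    ultimately have "(\<Sum>i<length (v # vs). d i * (v # vs) ! i) \<in> CC.line_extension F v (CC.Span F vs)"
      unfolding CC.line_extension_mem_iff
      by (intro bexI[of _ "d 0"] bexI[of _ "\<Sum>i<length vs. d (Suc i) * vs ! i"])
        (simp_all add: sum.lessThan_Suc_shift CC_ops del: sum.lessThan_Suc CC.Span.simps)
    then show ?case by simp
  qed
  show ?thesis using assms(1,3,4)
  proof (induction us arbitrary: c rule: list.induct)
    case (Cons v vs)
    from Cons.prems(1) have v: "v \<notin> CC.Span F vs" "CC.independent F vs"
      by (auto elim: CC.independent.cases)
    have sum: "c 0 * v + (\<Sum>i<length vs. c (Suc i) * vs ! i) = 0"
      using Cons.prems(3) by (simp add: sum.lessThan_Suc_shift del: sum.lessThan_Suc)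
    have c0: "c 0 = 0"
    proof (rule ccontr)
      assume nz: "c 0 \<noteq> 0"
      have "v = (\<Sum>i<length vs. (- c (Suc i) / c 0) * vs ! i)"
        using sum nz by (simp add: sum_negf field_simps flip: sum_divide_distrib) (simp add: eq_neg_iff_add_eq_0)
      moreover have "\<dots> \<in> CC.Span F vs"
        by (rule Span) (use Cons.prems(2) F nz in auto)
      ultimately show False using v by simp
    qed
    have "\<forall>i<length vs. c (Suc i) = 0"
      by (rule Cons.IH) (use v Cons.prems sum c0 in auto)
    then show ?case using c0 by (auto simp: less_Suc_eq_0_disj)
  qed simp
qed

lemma independent_pair_over_reals:
  fixes x y :: complex
  assumes "ring.independent CC \<real> [x, y]" "of_real a * x + of_real b * y = 0"
  shows "a = 0 \<and> b = 0"
proof -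
  let ?c = "\<lambda>i. if i = 0 then of_real a else of_real b :: complex"
  have "\<forall>i<length [x, y]. ?c i = 0"
    by (rule independent_imp_coeffs_zero[OF assms(1)])
      (use assms(2) in \<open>auto simp: Reals_divide lessThan_Suc add.commute\<close>)
  then show ?thesis by (auto simp: less_Suc_eq all_conj_distrib numeral_2_eq_2 dest: spec[of _ 0] spec[of _ 1])
qed

context complex_lattice
begin

text \<open>The lattice tensored with the rationals: its elements represent the torsion points of
  the elliptic curve.\<close>

definition rational_span :: "complex set" where
  "rational_span = {of_rat p * \<omega>1 + of_rat q * \<omega>2 | p q. True}"

lemma rational_spanI:
  assumes "v \<in> \<Omega>" "w \<in> \<Omega>" "n0 \<noteq> 0" "of_int n0 * y = of_int n1 * w - of_int n2 * v"
  shows "y \<in> rational_span"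
proof -
  have "of_int n1 * w - of_int n2 * v \<in> \<Omega>" using assms(1,2) by (intro diff_mem of_int_mult_mem)
  then obtain a b where ab: "of_int n0 * y = of_int a * \<omega>1 + of_int b * \<omega>2"
    unfolding assms(4)[symmetric] mem_lattice by blast
  then have "y = of_rat (of_int a / of_int n0) * \<omega>1 + of_rat (of_int b / of_int n0) * \<omega>2"
    using assms(3) by (simp add: of_rat_divide field_simps)
  then show ?thesis unfolding rational_span_def by blast
qed

lemma lattice_subset_rational_span: "\<Omega> \<subseteq> rational_span"
  using rational_spanI[of 0 _ 1 _ 1 0] by auto

lemma zero_mem_rational_span: "0 \<in> rational_span"
  using lattice_subset_rational_span by blast

text \<open>Eliminating \<open>B\<close> gives \<open>A * (\<eta> v * w - \<eta> w * v) = 2 pi i *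
  (n1 * w - n2 * v)\<close>. The determinant is \<open>2 pi i * n0\<close> with a nonzero integer
  \<open>n0\<close>, so \<open>2 pi i\<close> cancels. If \<open>A = 0\<close>, applying
  \<open>\<eta>\<close> to \<open>n1 * w = n2 * v\<close> gives a second relation, and the
  determinant forces \<open>n1 = 0\<close>, hence \<open>B * v = 0\<close>.\<close>

lemma trivial_character:
  assumes vw: "v \<in> \<Omega>" "w \<in> \<Omega>" "\<eta> v * w \<noteq> \<eta> w * v"
    and triv: "A * \<eta> v + B * v = of_int n1 * (2 * of_real pi * \<i>)" "A * \<eta> w + B * w = of_int n2 * (2 * of_real pi * \<i>)"
  shows "A \<in> rational_span" "A = 0 \<Longrightarrow> B = 0"
proof -
  let ?p = "2 * of_real pi * \<i> :: complex"
  obtain n0 where n0: "\<eta> v * w = \<eta> w * v + of_int (2 * n0) * (of_real pi * \<i>)"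
    using exp_eta_commute[OF vw(1,2)] unfolding exp_eq by auto
  have n0': "\<eta> v * w - \<eta> w * v = of_int n0 * ?p" using n0 by simp
  have "n0 \<noteq> 0" using n0 vw(3) by auto
  have "A * (\<eta> v * w - \<eta> w * v) = (A * \<eta> v + B * v) * w - (A * \<eta> w + B * w) * v"
    by (simp add: algebra_simps)
  also have "\<dots> = ?p * (of_int n1 * w - of_int n2 * v)"
    unfolding triv by (simp add: algebra_simps)
  finally have "?p * (of_int n0 * A) = ?p * (of_int n1 * w - of_int n2 * v)"
    unfolding n0' by (simp add: mult_ac)
  then have A: "of_int n0 * A = of_int n1 * w - of_int n2 * v" by simp
  show "A \<in> rational_span" by (rule rational_spanI[OF vw(1,2) \<open>n0 \<noteq> 0\<close> A])
  show "B = 0" if "A = 0"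
  proof -
    have eq: "of_int n1 * w = of_int n2 * v" using A that by simp
    have "of_int n1 * \<eta> w = of_int n2 * \<eta> v"
      using arg_cong[OF eq, of \<eta>] eta_of_int_mult vw(1,2) by simp
    then have "of_int n1 * (\<eta> v * w - \<eta> w * v) = 0"
    proof -
      have "of_int n1 * (\<eta> v * w - \<eta> w * v) = \<eta> v * (of_int n1 * w) - (of_int n1 * \<eta> w) * v"
        by (simp add: algebra_simps)
      also have "\<dots> = 0" unfolding eq \<open>of_int n1 * \<eta> w = of_int n2 * \<eta> v\<close> by simp
      finally show ?thesis .
    qed
    then have "n1 = 0" using vw(3) by simp
    then have "B * v = 0" using triv(1) that by simp
    moreover have "v \<noteq> 0" using vw(3) by auto
    ultimately show ?thesis by simp
  qed
qed

text \<open>An entry \<open>(g, A, B)\<close> is a function with the multiplier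
  \<open>exp (A * \<eta> v + B * v)\<close>. Equal multipliers of two monomials give a trivial
  character: \<open>trivial_character\<close> puts its \<open>A\<close> into the rational span,
  \<open>C1\<close> makes it 0, \<open>B\<close> is then 0 as well, and \<open>C2\<close> identifies
  the exponents.\<close>

lemma AE_independent_family:
  fixes ds :: "((complex \<Rightarrow> complex) \<times> complex \<times> complex) list"
  assumes F: "countable F"
    and bad: "\<Omega> \<subseteq> bad" "countable bad" "closed bad" "\<And>z v. v \<in> \<Omega> \<Longrightarrow> z + v \<in> bad \<Longrightarrow> z \<in> bad"
    and hol: "\<And>g A B. (g, A, B) \<in> set ds \<Longrightarrow> g holomorphic_on - bad"
    and zeros: "\<And>g A B. (g, A, B) \<in> set ds \<Longrightarrow> countable {z. z \<notin> bad \<and> g z = 0}"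
    and trans: "\<And>g A B z v. (g, A, B) \<in> set ds \<Longrightarrow> z \<notin> bad \<Longrightarrow> v \<in> \<Omega> \<Longrightarrow> g (z + v) = exp (A * \<eta> v + B * v) * g z"
    and C1: "\<And>k :: nat \<Rightarrow> int. (\<Sum>j<length ds. of_int (k j) * fst (snd (ds ! j))) \<in> rational_span \<Longrightarrow>
       (\<Sum>j<length ds. of_int (k j) * fst (snd (ds ! j))) = 0"
    and C2: "\<And>(k :: nat \<Rightarrow> int) j. (\<Sum>j<length ds. of_int (k j) * fst (snd (ds ! j))) = 0 \<Longrightarrow>
       (\<Sum>j<length ds. of_int (k j) * snd (snd (ds ! j))) = 0 \<Longrightarrow> j < length ds \<Longrightarrow> k j = 0"
    and fs: "fs = [\<lambda>z. z, weierstrass_wp \<Omega>, weierstrass_zeta \<Omega>, weierstrass_sigma \<Omega>] @ map fst ds"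
  shows "AE z :: complex ^ 'n in lebesgue. algebraically_independent F (UNIV \<times> {..<length fs}) (\<lambda>(i, l). (fs ! l) (z $ i))"
proof (rule AE_algebraically_independent[where f = "\<lambda>l. fs ! l", OF F, where G = "- bad"])
  let ?N = "length ds"
  have len: "length fs = 4 + ?N" by (simp add: fs)
  show "open (- bad)" "countable (- (- bad))" using bad by auto
  have "- bad = - \<Omega> - bad" using bad(1) by auto
  then show "connected (- bad)" using connected_compl_countable[OF bad(2)] by simp
  have d: "(fs ! (4 + j), fst (snd (ds ! j)), snd (snd (ds ! j))) \<in> set ds" if "j < ?N" for j
    using nth_mem[OF that] that by (simp add: fs)
  have fs4: "fs ! 0 = (\<lambda>z. z)" "fs ! 1 = wp" "fs ! 2 = \<zeta>" "fs ! 3 = \<sigma>" by (simp_all add: fs numeral_3_eq_3 numeral_2_eq_2)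
  show "fs ! l holomorphic_on - bad" if "l < length fs" for l
  proof -
    have sub: "- bad \<subseteq> - \<Omega>" using bad(1) by auto
    have "l = 0 \<or> l = 1 \<or> l = 2 \<or> l = 3 \<or> l = 4 + (l - 4) \<and> l - 4 < ?N"
      using that len by auto
    then consider "l = 0" | "l = 1" | "l = 2" | "l = 3" | j where "l = 4 + j" "j < ?N"
      by blast
    then show ?thesis
    proof cases
      case 5
      then show ?thesis using hol[OF d] by simp
    qed (use holomorphic_on_subset[OF zeta_holomorphic sub] holomorphic_on_subset[OF wp_holomorphic sub] sigma_holomorphic
        in \<open>auto simp: fs4 fs4(2)[simplified]\<close>)
  qed
  fix M :: "(nat \<Rightarrow> nat) set" and a :: "(nat \<Rightarrow> nat) \<Rightarrow> complex" and k0
  assume M: "finite M" "\<And>k l. k \<in> M \<Longrightarrow> length fs \<le> l \<Longrightarrow> k l = 0"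
    and rel: "\<And>z. z \<in> - bad \<Longrightarrow> (\<Sum>k\<in>M. a k * (\<Prod>l<length fs. (fs ! l) z ^ k l)) = 0" and k0: "k0 \<in> M"
  \<comment> \<open>The zeros of the factors are removed too, since functional independence divides
    by them; being countable, they may be excluded here although tuples may still hit them.\<close>
  define B where "B = bad \<union> (\<Union>j<?N. {z. z \<notin> bad \<and> (fs ! (4 + j)) z = 0})"
  have cB: "countable B" unfolding B_def using bad(2) zeros[OF d] by auto
  have G: "z \<in> - \<Omega> - B \<longleftrightarrow> z \<notin> bad \<and> (\<forall>j<?N. (fs ! (4 + j)) z \<noteq> 0)" for z
  proof -
    have "z \<in> - \<Omega> - B \<longleftrightarrow> z \<notin> \<Omega> \<and> z \<notin> bad \<and> (\<forall>j<?N. \<not> (z \<notin> bad \<and> (fs ! (4 + j)) z = 0))"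
      unfolding B_def by blast
    then show ?thesis using bad(1) by blast
  qed
  define g where "g = (\<lambda>(k :: nat \<Rightarrow> nat) j. k (4 + j))"
  define h where "h = (\<lambda>(\<kappa> :: nat \<Rightarrow> nat) z. \<Prod>j<?N. (fs ! (4 + j)) z ^ \<kappa> j)"
  define Ex where "Ex = (\<lambda>(\<kappa> :: nat \<Rightarrow> nat) v. \<Sum>j<?N. of_nat (\<kappa> j) * (fst (snd (ds ! j)) * \<eta> v + snd (snd (ds ! j)) * v))"
  show "a k0 = 0"
  proof (rule functional_independence[where M = M and B = B and c = a and a = "\<lambda>k. k 0" and b = "\<lambda>k. k 2" and d = "\<lambda>k. k 1"
        and e = "\<lambda>k. k 3" and g = g and h = h and ch = "\<lambda>\<kappa> v. exp (Ex \<kappa> v)"])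
    show "z + v \<in> - \<Omega> - B" if "z \<in> - \<Omega> - B" "v \<in> \<Omega>" for z v
    proof -
      have z: "z \<notin> bad" "\<And>j. j < ?N \<Longrightarrow> (fs ! (4 + j)) z \<noteq> 0" using that(1) unfolding G by blast+
      have "(fs ! (4 + j)) (z + v) \<noteq> 0" if "j < ?N" for j
        unfolding trans[OF d[OF that] z(1) \<open>v \<in> \<Omega>\<close>] using z(2)[OF that] by simp
      moreover have "z + v \<notin> bad" using bad(4)[OF that(2)] z(1) by blast
      ultimately show ?thesis unfolding G by blast
    qed
    show "h (g m) (z + v) = exp (Ex (g m) v) * h (g m) z" if "z \<in> - \<Omega> - B" "v \<in> \<Omega>" for m z v
    proof -
      have "h (g m) (z + v) = (\<Prod>j<?N. (exp (fst (snd (ds ! j)) * \<eta> v + snd (snd (ds ! j)) * v) * (fs ! (4 + j)) z) ^ g m j)"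
        unfolding h_def
      proof (rule prod.cong[OF refl], rule arg_cong[where f = "\<lambda>x. x ^ _"])
        fix j assume "j \<in> {..<?N}"
        then have j: "j < ?N" by simp
        have z: "z \<notin> bad" using that(1) unfolding G by blast
        show "(fs ! (4 + j)) (z + v) = exp (fst (snd (ds ! j)) * \<eta> v + snd (snd (ds ! j)) * v) * (fs ! (4 + j)) z"
          by (rule trans[OF d[OF j] z that(2)])
      qed
      also have "\<dots> = exp (Ex (g m) v) * h (g m) z"
        unfolding power_mult_distrib prod.distrib h_def Ex_def exp_sum[OF finite_lessThan] exp_of_nat_mult ..
      finally show ?thesis .
    qed
    show "h (g m) z \<noteq> 0" if "z \<in> - \<Omega> - B" for m z
      using that unfolding G h_def by (simp add: prod_zero_iff)
    show "g m = g m'" if m: "m \<in> M" "m' \<in> M" and vw: "v \<in> \<Omega>" "w \<in> \<Omega>" "\<eta> v * w \<noteq> \<eta> w * v"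
      and eq: "exp (Ex (g m) v) = exp (Ex (g m') v)" "exp (Ex (g m) w) = exp (Ex (g m') w)" for m m' v w
    proof -
      \<comment> \<open>The difference of two exponent vectors may have entries of either sign,
        which is why \<open>C1\<close> and \<open>C2\<close> concern integer coefficients.\<close>
      define k where "k = (\<lambda>j. int (g m j) - int (g m' j))"
      let ?A = "\<Sum>j<?N. of_int (k j) * fst (snd (ds ! j))" and ?B = "\<Sum>j<?N. of_int (k j) * snd (snd (ds ! j))"
      have diff: "?A * \<eta> x + ?B * x = Ex (g m) x - Ex (g m') x" for x
      proof -
        have "?A * \<eta> x + ?B * x = (\<Sum>j<?N. of_int (k j) * (fst (snd (ds ! j)) * \<eta> x + snd (snd (ds ! j)) * x))"
          by (simp add: sum_distrib_right sum.distrib distrib_left mult.assoc)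
        then show ?thesis by (simp add: Ex_def k_def sum_subtractf left_diff_distrib)
      qed
      have triv: "\<exists>n. ?A * \<eta> x + ?B * x = of_int n * (2 * of_real pi * \<i>)" if eq: "exp (Ex (g m) x) = exp (Ex (g m') x)" for x
      proof -
        obtain n where "Ex (g m) x = Ex (g m') x + of_int (2 * n) * (of_real pi * \<i>)"
          using eq unfolding exp_eq by auto
        then have "?A * \<eta> x + ?B * x = of_int n * (2 * of_real pi * \<i>)" unfolding diff by simp
        then show ?thesis by blast
      qed
      obtain n1 n2 where "?A * \<eta> v + ?B * v = of_int n1 * (2 * of_real pi * \<i>)" "?A * \<eta> w + ?B * w = of_int n2 * (2 * of_real pi * \<i>)"
        using triv[OF eq(1)] triv[OF eq(2)] by blast
      from trivial_character[OF vw this] have "?A = 0" "?B = 0" using C1[of k] by auto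
      then have k: "k j = 0" if "j < ?N" for j using C2 that by blast
      show ?thesis
      proof
        fix j
        show "g m j = g m' j"
        proof (cases "j < ?N")
          case True
          then show ?thesis using k[of j] by (simp add: k_def)
        next
          case False
          then show ?thesis using M(2)[OF m(1), of "4 + j"] M(2)[OF m(2), of "4 + j"] by (simp add: g_def len)
        qed
      qed
    qed
    show "inj_on (\<lambda>k. (k 0, k 2, k 1, k 3, g k)) M"
    proof (rule inj_onI, rule ext)
      fix x y :: "nat \<Rightarrow> nat" and l
      assume "(x 0, x 2, x 1, x 3, g x) = (y 0, y 2, y 1, y 3, g y)"
      then have 1: "x 0 = y 0" "x 2 = y 2" "x 1 = y 1" "x 3 = y 3" "g x (l - 4) = g y (l - 4)" by auto
      then show "x l = y l"
      proof (cases "l \<ge> 4")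
        case True
        then show ?thesis using 1(5) by (simp add: g_def)
      next
        case False
        then have "l = 0 \<or> l = 1 \<or> l = 2 \<or> l = 3" by auto
        then show ?thesis using 1 by auto
      qed
    qed
    fix z assume z: "z \<in> - \<Omega> - B"
    have "(\<Prod>l<length fs. (fs ! l) z ^ k l) = z ^ k 0 * wp z ^ k 1 * \<zeta> z ^ k 2 * \<sigma> z ^ k 3 * h (g k) z" for k
    proof -
      have "(\<Prod>l<length fs. (fs ! l) z ^ k l) = (\<Prod>l<4. (fs ! l) z ^ k l) * (\<Prod>j<?N. (fs ! (4 + j)) z ^ k (4 + j))"
        unfolding len by (rule prod_lessThan_add)
      moreover have "{..<4::nat} = {0, 1, 2, 3}" by auto
      ultimately show ?thesis by (simp add: fs4[simplified] h_def g_def)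
    qed
    then show "(\<Sum>k\<in>M. a k * z ^ k 0 * \<zeta> z ^ k 2 * wp z ^ k 1 * \<sigma> z ^ k 3 * h (g k) z) = 0"
      using rel[of z] z unfolding G by (simp add: mult_ac)
  qed (use M(1) cB k0 in auto)
qed

section \<open>Serre functions and endomorphisms\<close>

text \<open>The factors \<open>C\<close> and \<open>exp (\<eta> v * z)\<close> cancel between
  \<open>\<sigma> (z + u)\<close> and \<open>\<sigma> z\<close>. The offset \<open>u\<close> leaves
  \<open>exp (u * \<eta> v)\<close> and the exponential factor leaves
  \<open>exp (- \<zeta> u * v)\<close>. At the poles both sides have the default value 0.\<close>

lemma serre_add:
  assumes "v \<in> \<Omega>"
  shows "serre \<Omega> u (z + v) = exp (u * \<eta> v - \<zeta> u * v) * serre \<Omega> u z"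
proof -
  obtain C where C: "C\<^sup>2 = exp (\<eta> v * v)" "\<And>z. \<sigma> (z + v) = C * exp (\<eta> v * z) * \<sigma> z"
    using sigma_quasi_periodic[OF assms] by blast
  have "C\<^sup>2 \<noteq> 0" unfolding C(1) by simp
  then have C0: "C \<noteq> 0" by auto
  have 1: "\<sigma> (z + v + u) = C * exp (\<eta> v * z) * exp (u * \<eta> v) * \<sigma> (z + u)"
  proof -
    have "\<sigma> (z + v + u) = \<sigma> ((z + u) + v)" by (simp add: add_ac)
    also have "\<dots> = C * exp (\<eta> v * (z + u)) * \<sigma> (z + u)" by (rule C(2))
    also have "exp (\<eta> v * (z + u)) = exp (\<eta> v * z) * exp (u * \<eta> v)"
      by (simp only: distrib_left exp_add mult.commute[of u])
    finally show ?thesis by (simp add: mult.assoc)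
  qed
  have 2: "exp (- \<zeta> u * (z + v)) = exp (- \<zeta> u * z) * exp (- (\<zeta> u * v))"
    by (simp add: distrib_left flip: exp_add)
  have 3: "exp (u * \<eta> v - \<zeta> u * v) = exp (u * \<eta> v) * exp (- (\<zeta> u * v))"
    by (simp flip: exp_add)
  show ?thesis
    unfolding serre_def 1 2 3 C(2) using C0 by simp
qed

lemma serre_holomorphic:
  assumes "u \<notin> \<Omega>"
  shows "serre \<Omega> u holomorphic_on - \<Omega>"
proof -
  have s: "(\<lambda>z. \<sigma> (z + u)) holomorphic_on - \<Omega>"
    using holomorphic_on_compose_gen[OF _ sigma_holomorphic, of "\<lambda>z. z + u" "- \<Omega>" UNIV]
    by (simp add: o_def holomorphic_intros)
  have "(\<lambda>z. \<sigma> (z + u) / (\<sigma> z * \<sigma> u) * exp (- \<zeta> u * z)) holomorphic_on - \<Omega>"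
    using assms by (intro holomorphic_intros s sigma_holomorphic) (auto simp: sigma_eq_0_iff)
  then show ?thesis unfolding serre_def .
qed

lemma serre_zeros:
  assumes "u \<notin> \<Omega>"
  shows "{z. z \<notin> \<Omega> \<and> serre \<Omega> u z = 0} \<subseteq> (\<lambda>w. w - u) ` \<Omega>"
proof
  fix z assume "z \<in> {z. z \<notin> \<Omega> \<and> serre \<Omega> u z = 0}"
  then have "z + u \<in> \<Omega>" using assms by (auto simp: serre_def sigma_eq_0_iff)
  then show "z \<in> (\<lambda>w. w - u) ` \<Omega>" by (auto intro!: image_eqI[of _ _ "z + u"])
qed

section \<open>The endomorphism ring and its field\<close>

lemma endomorphism_mult_mem: "\<alpha> \<in> endomorphisms \<Omega> \<Longrightarrow> w \<in> \<Omega> \<Longrightarrow> \<alpha> * w \<in> \<Omega>"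
  by (simp add: endomorphisms_def)

lemma of_int_endomorphism: "of_int n \<in> endomorphisms \<Omega>"
  by (simp add: endomorphisms_def of_int_mult_mem)

lemma endomorphism_add: "\<alpha> \<in> endomorphisms \<Omega> \<Longrightarrow> \<beta> \<in> endomorphisms \<Omega> \<Longrightarrow> \<alpha> + \<beta> \<in> endomorphisms \<Omega>"
  by (auto simp: endomorphisms_def distrib_right)

lemma endomorphism_mult: "\<alpha> \<in> endomorphisms \<Omega> \<Longrightarrow> \<beta> \<in> endomorphisms \<Omega> \<Longrightarrow> \<alpha> * \<beta> \<in> endomorphisms \<Omega>"
  by (auto simp: endomorphisms_def mult.assoc)

text \<open>
  \<open>\<alpha>'\<close> is the conjugate of \<open>\<alpha>\<close>, computed from the integral matrix of \<open>\<alpha>\<close>. The last property expresses that the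
  real linear extension of \<open>\<eta>\<close> has the form \<open>v \<mapsto> p * v + q * cnj v\<close>.
\<close>

lemma endomorphism_conjugate:
  assumes "\<alpha> \<in> endomorphisms \<Omega>"
  obtains \<alpha>' \<kappa> and T N :: int where
    "\<alpha>' = of_int T - \<alpha>" "\<alpha> * \<alpha>' = of_int N" "\<alpha> \<noteq> 0 \<Longrightarrow> N \<noteq> 0" "\<And>v. v \<in> \<Omega> \<Longrightarrow> \<eta> (\<alpha> * v) = \<alpha>' * \<eta> v + \<kappa> * v"
proof -
  have "\<alpha> * \<omega>1 \<in> \<Omega>" "\<alpha> * \<omega>2 \<in> \<Omega>" using assms endomorphism_mult_mem by auto
  then obtain a b c d :: int where m: "\<alpha> * \<omega>1 = of_int a * \<omega>1 + of_int b * \<omega>2" "\<alpha> * \<omega>2 = of_int c * \<omega>1 + of_int d * \<omega>2"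
    unfolding mem_lattice by blast
  \<comment> \<open>The integers \<open>a + d\<close> and \<open>a * d - b * c\<close> are trace and
    determinant of the matrix of \<open>\<alpha>\<close>. The constant \<open>\<kappa>\<close> is
    chosen so that the formula for \<open>\<eta>\<close> holds at \<open>\<omega>1\<close>; at
    \<open>\<omega>2\<close> it then follows from \<open>e1\<close> and \<open>e2\<close>.\<close>
  define \<alpha>' where "\<alpha>' = of_int (a + d) - \<alpha>"
  define N where "N = a * d - b * c"
  define \<kappa> where "\<kappa> = (of_int b * \<eta> \<omega>2 + (\<alpha> - of_int d) * \<eta> \<omega>1) / \<omega>1"
  have e1: "(\<alpha> - of_int a) * \<omega>1 = of_int b * \<omega>2" and e2: "(\<alpha> - of_int d) * \<omega>2 = of_int c * \<omega>1"
    using m by (simp_all add: algebra_simps)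
  have "(\<alpha> - of_int a) * (\<alpha> - of_int d) * (\<omega>1 * \<omega>2) = ((\<alpha> - of_int a) * \<omega>1) * ((\<alpha> - of_int d) * \<omega>2)"
    by (simp only: mult_ac)
  also have "\<dots> = of_int b * of_int c * (\<omega>1 * \<omega>2)" unfolding e1 e2 by (simp only: mult_ac)
  finally have char_eq: "(\<alpha> - of_int a) * (\<alpha> - of_int d) = of_int b * of_int c" using gen_nonzero by simp
  then have norm: "\<alpha> * \<alpha>' = of_int N" by (simp add: \<alpha>'_def N_def algebra_simps)
  \<comment> \<open>A vanishing determinant makes a nonzero \<open>\<alpha>\<close> equal to its
    trace; comparing real coordinates then gives \<open>a = d = 0\<close>, so the trace is
    0.\<close>
  have nz: "N \<noteq> 0" if "\<alpha> \<noteq> 0"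
  proof
    assume "N = 0"
    then have "\<alpha> = of_int (a + d)" using norm that by (simp add: \<alpha>'_def)
    then have "of_int d * \<omega>1 = of_int b * \<omega>2" "of_int a * \<omega>2 = of_int c * \<omega>1"
      using e1 e2 by simp_all
    then have "d = 0" "a = 0"
      using real_indep[of "of_int d" "- of_int b"] real_indep[of "- of_int c" "of_int a"] by simp_all
    then show False using \<open>\<alpha> = of_int (a + d)\<close> that by simp
  qed
  have k1: "\<eta> (\<alpha> * \<omega>1) = \<alpha>' * \<eta> \<omega>1 + \<kappa> * \<omega>1"
    unfolding m eta_coords using gen_nonzero by (simp add: \<kappa>_def \<alpha>'_def algebra_simps)
  have "\<kappa> * \<omega>2 * \<omega>1 = of_int b * \<omega>2 * \<eta> \<omega>2 + (\<alpha> - of_int d) * \<omega>2 * \<eta> \<omega>1"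
    using gen_nonzero by (simp add: \<kappa>_def field_simps)
  also have "\<dots> = ((\<alpha> - of_int a) * \<eta> \<omega>2 + of_int c * \<eta> \<omega>1) * \<omega>1"
    unfolding e1[symmetric] e2 by (simp add: algebra_simps)
  finally have "\<kappa> * \<omega>2 = (\<alpha> - of_int a) * \<eta> \<omega>2 + of_int c * \<eta> \<omega>1" using gen_nonzero by simp
  then have k2: "\<eta> (\<alpha> * \<omega>2) = \<alpha>' * \<eta> \<omega>2 + \<kappa> * \<omega>2"
    unfolding m eta_coords by (simp add: \<alpha>'_def algebra_simps)
  have k: "\<eta> (\<alpha> * v) = \<alpha>' * \<eta> v + \<kappa> * v" if v: "v \<in> \<Omega>" for v
  proof -
    obtain x y :: int where xy: "v = of_int x * \<omega>1 + of_int y * \<omega>2" using v unfolding mem_lattice by blast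
    have "\<alpha> * v = of_int x * (\<alpha> * \<omega>1) + of_int y * (\<alpha> * \<omega>2)" by (simp add: xy algebra_simps)
    then have "\<eta> (\<alpha> * v) = of_int x * \<eta> (\<alpha> * \<omega>1) + of_int y * \<eta> (\<alpha> * \<omega>2)"
      using \<open>\<alpha> * \<omega>1 \<in> \<Omega>\<close> \<open>\<alpha> * \<omega>2 \<in> \<Omega>\<close> by (simp add: eta_add eta_of_int_mult of_int_mult_mem)
    then show ?thesis unfolding k1 k2 xy eta_coords by (simp add: algebra_simps)
  qed
  show thesis by (rule that[OF \<alpha>'_def norm nz k])
qed

text \<open>A real multiple of \<open>\<omega>1\<close> that is a period has second coordinate 0.
  Hence the endomorphisms outside the integers are nonreal.\<close>

lemma real_endomorphism_integer:
  assumes "\<alpha> \<in> endomorphisms \<Omega>" "\<alpha> = of_real x"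
  shows "\<alpha> \<in> \<int>"
proof -
  obtain a b :: int where m: "\<alpha> * \<omega>1 = of_int a * \<omega>1 + of_int b * \<omega>2"
    using endomorphism_mult_mem[OF assms(1) gen1] unfolding mem_lattice by blast
  then have "x = of_int a"
    using real_indep[of "x - of_int a" "- of_int b"] assms(2) by (simp add: algebra_simps)
  then show ?thesis using assms(2) by simp
qed

text \<open>Clearing denominators moves closure questions for the field into the endomorphism
  ring.\<close>

lemma endomorphism_field_iff:
  "x \<in> endomorphism_field \<Omega> \<longleftrightarrow> (\<exists>n::int. n \<noteq> 0 \<and> of_int n * x \<in> endomorphisms \<Omega>)"
proof
  assume "x \<in> endomorphism_field \<Omega>"
  then obtain q \<alpha> where x: "x = of_rat q * \<alpha>" "\<alpha> \<in> endomorphisms \<Omega>" unfolding endomorphism_field_def by blast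
  obtain a b where q: "q = Rat.Fract a b" "b > 0" by (cases q) auto
  have "of_int b * x = of_int a * \<alpha>" using x(1) q by (simp add: of_rat_rat)
  then show "\<exists>n::int. n \<noteq> 0 \<and> of_int n * x \<in> endomorphisms \<Omega>"
    using q(2) x(2) endomorphism_mult[OF of_int_endomorphism] by (intro exI[of _ b]) auto
next
  assume "\<exists>n::int. n \<noteq> 0 \<and> of_int n * x \<in> endomorphisms \<Omega>"
  then obtain n :: int where n: "n \<noteq> 0" "of_int n * x \<in> endomorphisms \<Omega>" by blast
  have "x = of_rat (1 / of_int n) * (of_int n * x)" using n(1) by (simp add: of_rat_divide)
  then show "x \<in> endomorphism_field \<Omega>" unfolding endomorphism_field_def using n(2) by blast
qed

lemma endomorphism_in_field: "\<alpha> \<in> endomorphisms \<Omega> \<Longrightarrow> \<alpha> \<in> endomorphism_field \<Omega>"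
  unfolding endomorphism_field_iff by (rule exI[of _ 1]) simp

lemma of_rat_endomorphism_field: "of_rat q \<in> endomorphism_field \<Omega>"
  unfolding endomorphism_field_def using of_int_endomorphism[of 1] by force

lemma endomorphism_field_add:
  assumes "x \<in> endomorphism_field \<Omega>" "y \<in> endomorphism_field \<Omega>"
  shows "x + y \<in> endomorphism_field \<Omega>"
proof -
  obtain n m :: int where nm: "n \<noteq> 0" "of_int n * x \<in> endomorphisms \<Omega>" "m \<noteq> 0" "of_int m * y \<in> endomorphisms \<Omega>"
    using assms unfolding endomorphism_field_iff by blast
  have "of_int (n * m) * (x + y) = of_int m * (of_int n * x) + of_int n * (of_int m * y)"
    by (simp add: algebra_simps)
  also have "\<dots> \<in> endomorphisms \<Omega>"
    by (intro endomorphism_add endomorphism_mult of_int_endomorphism nm)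
  finally show ?thesis unfolding endomorphism_field_iff using nm(1,3) by (intro exI[of _ "n * m"]) simp
qed

lemma endomorphism_field_mult:
  assumes "x \<in> endomorphism_field \<Omega>" "y \<in> endomorphism_field \<Omega>"
  shows "x * y \<in> endomorphism_field \<Omega>"
proof -
  obtain n m :: int where nm: "n \<noteq> 0" "of_int n * x \<in> endomorphisms \<Omega>" "m \<noteq> 0" "of_int m * y \<in> endomorphisms \<Omega>"
    using assms unfolding endomorphism_field_iff by blast
  have "of_int (n * m) * (x * y) = (of_int n * x) * (of_int m * y)"
    by (simp add: algebra_simps)
  also have "\<dots> \<in> endomorphisms \<Omega>"
    by (intro endomorphism_mult nm)
  finally show ?thesis unfolding endomorphism_field_iff using nm(1,3) by (intro exI[of _ "n * m"]) simp
qed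

text \<open>Rationalising the denominator: the inverse of a nonzero endomorphism is its conjugate
  divided by the integer norm.\<close>

lemma endomorphism_field_inverse:
  assumes "x \<in> endomorphism_field \<Omega>" "x \<noteq> 0"
  shows "1 / x \<in> endomorphism_field \<Omega>"
proof -
  obtain n :: int where n: "n \<noteq> 0" "of_int n * x \<in> endomorphisms \<Omega>"
    using assms unfolding endomorphism_field_iff by blast
  obtain \<beta> \<kappa> and T N :: int where \<beta>: "\<beta> = of_int T - of_int n * x" "of_int n * x * \<beta> = of_int N" "of_int n * x \<noteq> 0 \<Longrightarrow> N \<noteq> 0"
    using endomorphism_conjugate[OF n(2)] by metis
  have N: "N \<noteq> 0" using \<beta>(3) n(1) assms(2) by simp
  have "\<beta> = of_int T + of_int (-1) * (of_int n * x)" using \<beta>(1) by simp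
  then have "\<beta> \<in> endomorphisms \<Omega>" using n(2) by (metis endomorphism_add endomorphism_mult of_int_endomorphism)
  moreover have "of_int N * (1 / x) = of_int n * \<beta>"
    using \<beta>(2) assms(2) by (simp add: field_simps)
  ultimately show ?thesis
    unfolding endomorphism_field_iff using N by (metis endomorphism_mult of_int_endomorphism)
qed

lemma endomorphism_field_uminus_divide:
  assumes "x \<in> endomorphism_field \<Omega>" "y \<in> endomorphism_field \<Omega>" "y \<noteq> 0"
  shows "- x / y \<in> endomorphism_field \<Omega>"
proof -
  have "- x / y = of_rat (-1) * (x * (1 / y))" by simp
  also have "\<dots> \<in> endomorphism_field \<Omega>"
    by (intro endomorphism_field_mult endomorphism_field_inverse of_rat_endomorphism_field assms)
  finally show ?thesis .
qed

text \<open>The image of \<open>\<omega>1\<close> under a nonintegral endomorphism involves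
  \<open>\<omega>2\<close>, which can be solved for. Thus the rational span of the periods lies on
  the line of \<open>\<omega>1\<close> over the field.\<close>

lemma gen2_in_field_multiple:
  assumes "complex_multiplication \<Omega>"
  obtains \<theta> where "\<theta> \<in> endomorphism_field \<Omega>" "\<omega>2 = \<theta> * \<omega>1"
proof -
  have "\<int> \<subseteq> endomorphisms \<Omega>" using of_int_endomorphism by (auto elim: Ints_cases)
  then obtain \<alpha> where \<alpha>: "\<alpha> \<in> endomorphisms \<Omega>" "\<alpha> \<notin> \<int>" using assms unfolding complex_multiplication_def by blast
  obtain a b :: int where m: "\<alpha> * \<omega>1 = of_int a * \<omega>1 + of_int b * \<omega>2"
    using endomorphism_mult_mem[OF \<alpha>(1) gen1] unfolding mem_lattice by blast
  have "b \<noteq> 0"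
  proof
    assume "b = 0"
    then have "\<alpha> = of_int a" using m gen_nonzero by simp
    then show False using \<alpha>(2) by simp
  qed
  then have "\<omega>2 = (of_rat (1 / of_int b) * (\<alpha> + of_int (- a))) * \<omega>1"
    using m by (simp add: of_rat_divide field_simps)
  moreover have "of_rat (1 / of_int b) * (\<alpha> + of_int (- a)) \<in> endomorphism_field \<Omega>"
    by (intro endomorphism_field_mult of_rat_endomorphism_field endomorphism_in_field endomorphism_add \<alpha> of_int_endomorphism)
  ultimately show thesis using that by blast
qed

text \<open>The common form of both statements, with \<open>s' = 0\<close> and
  \<open>s' = s\<close>. The pairs \<open>(A, B)\<close> are \<open>(0, t)\<close>,
  \<open>(u, - \<zeta> u)\<close> and
  \<open>(\<alpha>' u, \<kappa> u - \<zeta> u * \<alpha>)\<close>; \<open>ind\<close> is integral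
  independence of the nonexponential \<open>A\<close> modulo the rational span.\<close>

lemma AE_independent_serre:
  fixes t u \<alpha> \<alpha>' \<kappa> :: "nat \<Rightarrow> complex" and r s s' :: nat
  assumes F: "countable F"
    and t: "\<And>(k :: nat \<Rightarrow> int) i. (\<Sum>i<r. of_int (k i) * t (Suc i)) = 0 \<Longrightarrow> i < r \<Longrightarrow> k i = 0"
    and u: "\<And>i. i < s \<Longrightarrow> u (Suc i) \<notin> \<Omega>" "s' \<le> s"
    and \<alpha>: "\<And>i. i < s' \<Longrightarrow> \<alpha> (Suc i) \<in> endomorphisms \<Omega>" "\<And>i. i < s' \<Longrightarrow> \<alpha> (Suc i) \<noteq> 0"
    and \<alpha>': "\<And>i v. i < s' \<Longrightarrow> v \<in> \<Omega> \<Longrightarrow> \<eta> (\<alpha> (Suc i) * v) = \<alpha>' (Suc i) * \<eta> v + \<kappa> (Suc i) * v"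
    and ind: "\<And>k l :: nat \<Rightarrow> int. (\<Sum>i<s. of_int (k i) * u (Suc i)) + (\<Sum>i<s'. of_int (l i) * (\<alpha>' (Suc i) * u (Suc i))) \<in> rational_span \<Longrightarrow>
       (\<forall>i<s. k i = 0) \<and> (\<forall>i<s'. l i = 0)"
    and fs: "fs = [\<lambda>z. z, weierstrass_wp \<Omega>, weierstrass_zeta \<Omega>, weierstrass_sigma \<Omega>]
                  @ map (\<lambda>j z. exp (t j * z)) [1..<Suc r]
                  @ map (\<lambda>j z. serre \<Omega> (u j) z) [1..<Suc s]
                  @ map (\<lambda>j z. serre \<Omega> (u j) (\<alpha> j * z)) [1..<Suc s']"
  shows "AE z :: complex ^ 'n in lebesgue. algebraically_independent F (UNIV \<times> {..<length fs}) (\<lambda>(i, l). (fs ! l) (z $ i))"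
proof -
  define es where "es = map (\<lambda>j. (\<lambda>z. exp (t j * z), 0 :: complex, t j)) [1..<Suc r]"
  define us where "us = map (\<lambda>j. (\<lambda>z. serre \<Omega> (u j) z, u j, - \<zeta> (u j))) [1..<Suc s]"
  define vs where "vs = map (\<lambda>j. (\<lambda>z. serre \<Omega> (u j) (\<alpha> j * z), \<alpha>' j * u j, \<kappa> j * u j - \<zeta> (u j) * \<alpha> j)) [1..<Suc s']"
  \<comment> \<open>The poles of \<open>f_u(\<alpha> z)\<close> lie where \<open>\<alpha> z\<close>
    is a period; \<open>\<alpha> \<noteq> 0\<close> keeps this set countable.\<close>
  define bad where "bad = \<Omega> \<union> (\<Union>i<s'. {z. \<alpha> (Suc i) * z \<in> \<Omega>})"
  have len: "length es = r" "length us = s" "length vs = s'" by (simp_all add: es_def us_def vs_def)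
  have nth: "\<And>i. i < r \<Longrightarrow> es ! i = (\<lambda>z. exp (t (Suc i) * z), 0, t (Suc i))"
    "\<And>i. i < s \<Longrightarrow> us ! i = (\<lambda>z. serre \<Omega> (u (Suc i)) z, u (Suc i), - \<zeta> (u (Suc i)))"
    "\<And>i. i < s' \<Longrightarrow> vs ! i = (\<lambda>z. serre \<Omega> (u (Suc i)) (\<alpha> (Suc i) * z), \<alpha>' (Suc i) * u (Suc i), \<kappa> (Suc i) * u (Suc i) - \<zeta> (u (Suc i)) * \<alpha> (Suc i))"
    by (simp_all add: es_def us_def vs_def del: upt_Suc)
  have cases: P if "(g, A, B) \<in> set (es @ us @ vs)"
    and "\<And>i. i < r \<Longrightarrow> g = (\<lambda>z. exp (t (Suc i) * z)) \<Longrightarrow> A = 0 \<Longrightarrow> B = t (Suc i) \<Longrightarrow> P"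
    and "\<And>i. i < s \<Longrightarrow> g = serre \<Omega> (u (Suc i)) \<Longrightarrow> A = u (Suc i) \<Longrightarrow> B = - \<zeta> (u (Suc i)) \<Longrightarrow> P"
    and "\<And>i. i < s' \<Longrightarrow> g = (\<lambda>z. serre \<Omega> (u (Suc i)) (\<alpha> (Suc i) * z)) \<Longrightarrow> A = \<alpha>' (Suc i) * u (Suc i) \<Longrightarrow>
       B = \<kappa> (Suc i) * u (Suc i) - \<zeta> (u (Suc i)) * \<alpha> (Suc i) \<Longrightarrow> P" for g A B P
  proof -
    from that(1) consider i where "i < r" "es ! i = (g, A, B)" | i where "i < s" "us ! i = (g, A, B)" | i where "i < s'" "vs ! i = (g, A, B)"
      by (auto simp: in_set_conv_nth len)
    then show P by cases (use that(2-) nth in auto)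
  qed
  have sumA: "(\<Sum>j<length (es @ us @ vs). of_int (k j) * fst (snd ((es @ us @ vs) ! j))) =
      (\<Sum>i<s. of_int (k (r + i)) * u (Suc i)) + (\<Sum>i<s'. of_int (k (r + (s + i))) * (\<alpha>' (Suc i) * u (Suc i)))" for k :: "nat \<Rightarrow> int"
    using sum_lessThan_append[of "\<lambda>j d. of_int (k j) * fst (snd d)" es "us @ vs"]
      sum_lessThan_append[of "\<lambda>j d. of_int (k (r + j)) * fst (snd d)" us vs]
    by (simp add: len nth)
  have sumB: "(\<Sum>j<length (es @ us @ vs). of_int (k j) * snd (snd ((es @ us @ vs) ! j))) =
      (\<Sum>i<r. of_int (k i) * t (Suc i)) + ((\<Sum>i<s. of_int (k (r + i)) * (- \<zeta> (u (Suc i)))) +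
        (\<Sum>i<s'. of_int (k (r + (s + i))) * (\<kappa> (Suc i) * u (Suc i) - \<zeta> (u (Suc i)) * \<alpha> (Suc i))))" for k :: "nat \<Rightarrow> int"
    using sum_lessThan_append[of "\<lambda>j d. of_int (k j) * snd (snd d)" es "us @ vs"]
      sum_lessThan_append[of "\<lambda>j d. of_int (k (r + j)) * snd (snd d)" us vs]
    by (simp add: len nth)
  have preimage: "{z. a * z \<in> S} \<subseteq> (\<lambda>w. w / a) ` S" if "a \<noteq> 0" for a :: complex and S
    using that by (auto intro!: image_eqI[where x = "a * _"])
  show ?thesis
  proof (rule AE_independent_family[where ds = "es @ us @ vs" and bad = bad, OF F])
    show "\<Omega> \<subseteq> bad" by (simp add: bad_def)
    show "countable bad"
    proof -
      have "countable {z. \<alpha> (Suc i) * z \<in> \<Omega>}" if "i < s'" for i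
        by (rule countable_subset[OF preimage[OF \<alpha>(2)[OF that]] countable_image[OF countable_lattice]])
      then show ?thesis unfolding bad_def using countable_lattice by (intro countable_Un countable_UN) auto
    qed
    have "closed ((\<lambda>z. a * z) -` \<Omega>)" for a
      by (intro closed_vimage closed_lattice continuous_intros)
    then show "closed bad"
      unfolding bad_def vimage_def by (intro closed_Un closed_lattice closed_UN) auto
    show "z \<in> bad" if "v \<in> \<Omega>" "z + v \<in> bad" for z v
    proof -
      have "\<alpha> (Suc i) * z \<in> \<Omega>" if "i < s'" "\<alpha> (Suc i) * (z + v) \<in> \<Omega>" for i
        using that add_mem_iff[OF endomorphism_mult_mem[OF \<alpha>(1) \<open>v \<in> \<Omega>\<close>]] by (simp add: distrib_left)
      then show ?thesis using that add_mem_iff unfolding bad_def by auto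
    qed
    fix g A B assume mem: "(g, A, B) \<in> set (es @ us @ vs)"
    show "g holomorphic_on - bad"
    proof (rule cases[OF mem])
      fix i assume i: "i < r" "g = (\<lambda>z. exp (t (Suc i) * z))"
      show ?thesis unfolding i by (intro holomorphic_intros)
    next
      fix i assume i: "i < s" "g = serre \<Omega> (u (Suc i))"
      show ?thesis unfolding i(2)
        by (rule holomorphic_on_subset[OF serre_holomorphic[OF u(1)[OF i(1)]]]) (auto simp: bad_def)
    next
      fix i assume i: "i < s'" "g = (\<lambda>z. serre \<Omega> (u (Suc i)) (\<alpha> (Suc i) * z))"
      then have "i < s" using u(2) by simp
      show ?thesis unfolding i(2)
        using holomorphic_on_compose_gen[OF _ serre_holomorphic[OF u(1)[OF \<open>i < s\<close>]], of "\<lambda>z. \<alpha> (Suc i) * z" "- bad"] i(1)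
        by (auto simp: o_def bad_def intro: holomorphic_intros)
    qed
    show "countable {z. z \<notin> bad \<and> g z = 0}"
    proof (rule cases[OF mem])
      fix i assume i: "i < r" "g = (\<lambda>z. exp (t (Suc i) * z))"
      show ?thesis unfolding i by simp
    next
      fix i assume i: "i < s" "g = serre \<Omega> (u (Suc i))"
      have "{z. z \<notin> bad \<and> g z = 0} \<subseteq> {z. z \<notin> \<Omega> \<and> serre \<Omega> (u (Suc i)) z = 0}"
        unfolding i(2) by (auto simp: bad_def)
      also have "\<dots> \<subseteq> (\<lambda>w. w - u (Suc i)) ` \<Omega>" by (rule serre_zeros[OF u(1)[OF i(1)]])
      finally show ?thesis by (rule countable_subset[OF _ countable_image[OF countable_lattice]])
    next
      fix i assume i: "i < s'" "g = (\<lambda>z. serre \<Omega> (u (Suc i)) (\<alpha> (Suc i) * z))"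
      then have "i < s" using u(2) by simp
      have "{z. z \<notin> bad \<and> g z = 0} \<subseteq> {z. \<alpha> (Suc i) * z \<in> {z. z \<notin> \<Omega> \<and> serre \<Omega> (u (Suc i)) z = 0}}"
        using i by (auto simp: bad_def)
      also have "\<dots> \<subseteq> {z. \<alpha> (Suc i) * z \<in> (\<lambda>w. w - u (Suc i)) ` \<Omega>}"
        using serre_zeros[OF u(1)[OF \<open>i < s\<close>]] by blast
      also have "\<dots> \<subseteq> (\<lambda>w. w / \<alpha> (Suc i)) ` (\<lambda>w. w - u (Suc i)) ` \<Omega>"
        by (rule preimage[OF \<alpha>(2)[OF i(1)]])
      finally show ?thesis by (rule countable_subset[OF _ countable_image[OF countable_image[OF countable_lattice]]])
    qed
    show "g (z + v) = exp (A * \<eta> v + B * v) * g z" if "z \<notin> bad" "v \<in> \<Omega>" for z v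
    proof (rule cases[OF mem])
      fix i assume i: "i < r" "g = (\<lambda>z. exp (t (Suc i) * z))" "A = 0" "B = t (Suc i)"
      show ?thesis unfolding i by (simp add: distrib_left exp_add)
    next
      fix i assume i: "i < s" "g = serre \<Omega> (u (Suc i))" "A = u (Suc i)" "B = - \<zeta> (u (Suc i))"
      show ?thesis unfolding i using serre_add[OF that(2)] by simp
    next
      fix i assume i: "i < s'" "g = (\<lambda>z. serre \<Omega> (u (Suc i)) (\<alpha> (Suc i) * z))" "A = \<alpha>' (Suc i) * u (Suc i)"
        "B = \<kappa> (Suc i) * u (Suc i) - \<zeta> (u (Suc i)) * \<alpha> (Suc i)"
      have e: "u (Suc i) * (\<alpha>' (Suc i) * \<eta> v + \<kappa> (Suc i) * v) - \<zeta> (u (Suc i)) * (\<alpha> (Suc i) * v) =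
          \<alpha>' (Suc i) * u (Suc i) * \<eta> v + (\<kappa> (Suc i) * u (Suc i) - \<zeta> (u (Suc i)) * \<alpha> (Suc i)) * v"
        by (simp add: algebra_simps)
      show ?thesis
        unfolding i(2-4) distrib_left[of "\<alpha> (Suc i)"] serre_add[OF endomorphism_mult_mem[OF \<alpha>(1)[OF i(1)] that(2)]]
          \<alpha>'[OF i(1) that(2)] e ..
    qed
  next
    fix k :: "nat \<Rightarrow> int"
    assume "(\<Sum>j<length (es @ us @ vs). of_int (k j) * fst (snd ((es @ us @ vs) ! j))) \<in> rational_span"
    then have "(\<forall>i<s. k (r + i) = 0) \<and> (\<forall>i<s'. k (r + (s + i)) = 0)" unfolding sumA by (rule ind)
    then show "(\<Sum>j<length (es @ us @ vs). of_int (k j) * fst (snd ((es @ us @ vs) ! j))) = 0" unfolding sumA by simp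
  next
    fix k :: "nat \<Rightarrow> int" and j
    assume A: "(\<Sum>j<length (es @ us @ vs). of_int (k j) * fst (snd ((es @ us @ vs) ! j))) = 0"
      and B: "(\<Sum>j<length (es @ us @ vs). of_int (k j) * snd (snd ((es @ us @ vs) ! j))) = 0"
      and j: "j < length (es @ us @ vs)"
    from A have "(\<Sum>i<s. of_int (k (r + i)) * u (Suc i)) + (\<Sum>i<s'. of_int (k (r + (s + i))) * (\<alpha>' (Suc i) * u (Suc i))) \<in> rational_span"
      unfolding sumA using zero_mem_rational_span by simp
    then have k: "(\<forall>i<s. k (r + i) = 0) \<and> (\<forall>i<s'. k (r + (s + i)) = 0)" by (rule ind)
    \<comment> \<open>With the exponents of all Serre functions equal to 0, the \<open>B\<close>
      part is a relation between the frequencies \<open>t\<close> alone.\<close>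
    with B have "(\<Sum>i<r. of_int (k i) * t (Suc i)) = 0" unfolding sumB by simp
    then have "k i = 0" if "i < r" for i using t that by blast
    moreover have "j < r \<or> (j = r + (j - r) \<and> j - r < s) \<or> (j = r + (s + (j - r - s)) \<and> j - r - s < s')"
      using j by (auto simp: len)
    ultimately show "k j = 0" using k by metis
  next
    show "fs = [\<lambda>z. z, weierstrass_wp \<Omega>, weierstrass_zeta \<Omega>, weierstrass_sigma \<Omega>] @ map fst (es @ us @ vs)"
      by (simp add: fs es_def us_def vs_def o_def)
  qed
qed

end

lemma Rats_uminus_divide: "x \<in> \<rat> \<Longrightarrow> y \<in> \<rat> \<Longrightarrow> y \<noteq> 0 \<Longrightarrow> - x / y \<in> \<rat>" for x y :: complex
  by (rule Rats_divide) auto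

theorem corollary2p3:
  fixes \<omega>1 \<omega>2 :: complex and \<Omega> K S :: "complex set"
    and r s :: nat and t u \<alpha> :: "nat \<Rightarrow> complex"
  assumes lattice: "ring.independent CC \<real> [\<omega>1, \<omega>2]" "\<Omega> = period_lattice \<omega>1 \<omega>2"
    and K: "finite S" "K = generate_field CC S"
    and t: "ring.independent CC \<rat> (map t [1..<Suc r])"
  shows
    "(ring.independent CC \<rat> (\<omega>1 # \<omega>2 # map u [1..<Suc s]) \<longrightarrow>
        (let fs = [\<lambda>z. z, weierstrass_wp \<Omega>, weierstrass_zeta \<Omega>, weierstrass_sigma \<Omega>]
                  @ map (\<lambda>j z. exp (t j * z)) [1..<Suc r]
                  @ map (\<lambda>j z. serre \<Omega> (u j) z) [1..<Suc s]
         in AE z :: complex ^ 'n in lebesgue.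
              algebraically_independent
                (generate_field CC (K \<union> {invariant_g2 \<Omega>, invariant_g3 \<Omega>}))
                (UNIV \<times> {..<length fs}) (\<lambda>(i, l). (fs ! l) (z $ i))))
     \<and>
     (complex_multiplication \<Omega> \<and>
      (\<forall>j\<in>{1..s}. \<alpha> j \<in> endomorphisms \<Omega> - \<int>) \<and>
      ring.independent CC (endomorphism_field \<Omega>) (\<omega>1 # map u [1..<Suc s]) \<longrightarrow>
        (let fs = [\<lambda>z. z, weierstrass_wp \<Omega>, weierstrass_zeta \<Omega>, weierstrass_sigma \<Omega>]
                  @ map (\<lambda>j z. exp (t j * z)) [1..<Suc r]
                  @ map (\<lambda>j z. serre \<Omega> (u j) z) [1..<Suc s]
                  @ map (\<lambda>j z. serre \<Omega> (u j) (\<alpha> j * z)) [1..<Suc s]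
         in AE z :: complex ^ 'n in lebesgue.
              algebraically_independent
                (generate_field CC (K \<union> {invariant_g2 \<Omega>, invariant_g3 \<Omega>}))
                (UNIV \<times> {..<length fs}) (\<lambda>(i, l). (fs ! l) (z $ i))))"
proof -
  interpret complex_lattice \<omega>1 \<omega>2 \<Omega>
    by standard (use lattice independent_pair_over_reals in auto)
  let ?F = "generate_field CC (K \<union> {invariant_g2 \<Omega>, invariant_g3 \<Omega>})"
  have F: "countable ?F"
    using K by (intro countable_generate_field countable_Un) (auto intro: countable_generate_field countable_finite)
  have t_ind: "k i = 0" if "(\<Sum>i<r. of_int (k i) * t (Suc i)) = 0" "i < r" for k :: "nat \<Rightarrow> int" and i
  proof -
    have "\<forall>i<length (map t [1..<Suc r]). (of_int (k i) :: complex) = 0"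
      by (rule independent_imp_coeffs_zero[OF t Rats_uminus_divide]) (use that in \<open>auto simp del: upt_Suc\<close>)
    then show ?thesis using that(2) by simp
  qed
  have part1: "AE z :: complex ^ 'n in lebesgue. algebraically_independent ?F (UNIV \<times> {..<length fs}) (\<lambda>(i, l). (fs ! l) (z $ i))"
    if ind: "ring.independent CC \<rat> (\<omega>1 # \<omega>2 # map u [1..<Suc s])"
      and fs: "fs = [\<lambda>z. z, weierstrass_wp \<Omega>, weierstrass_zeta \<Omega>, weierstrass_sigma \<Omega>]
                  @ map (\<lambda>j z. exp (t j * z)) [1..<Suc r]
                  @ map (\<lambda>j z. serre \<Omega> (u j) z) [1..<Suc s]" for fs
  proof -
    have zero: "\<forall>i<s. k i = 0" if sp: "(\<Sum>i<s. of_int (k i) * u (Suc i)) \<in> rational_span" for k :: "nat \<Rightarrow> int"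
    proof -
      obtain p q where pq: "(\<Sum>i<s. of_int (k i) * u (Suc i)) = of_rat p * \<omega>1 + of_rat q * \<omega>2"
        using sp unfolding rational_span_def by blast
      \<comment> \<open>The two periods are moved to the left side of \<open>pq\<close>, so the
        coefficients of the \<open>u\<close> start at position 2.\<close>
      define c :: "nat \<Rightarrow> complex" where "c = (\<lambda>i. if i = 0 then - of_rat p else if i = 1 then - of_rat q else of_int (k (i - 2)))"
      have "\<forall>i<length (\<omega>1 # \<omega>2 # map u [1..<Suc s]). c i = 0"
      proof (rule independent_imp_coeffs_zero[OF ind Rats_uminus_divide])
        show "(\<Sum>i<length (\<omega>1 # \<omega>2 # map u [1..<Suc s]). c i * (\<omega>1 # \<omega>2 # map u [1..<Suc s]) ! i) = 0"
          using pq by (simp add: sum.lessThan_Suc_shift c_def del: sum.lessThan_Suc upt_Suc)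
      qed (auto simp: c_def)
      then have "\<forall>i<s. c (i + 2) = 0" by simp
      then show ?thesis by (simp add: c_def)
    qed
    have u: "u (Suc i) \<notin> \<Omega>" if "i < s" for i
    proof
      assume "u (Suc i) \<in> \<Omega>"
      moreover have "(\<Sum>j<s. of_int (if j = i then 1 else 0) * u (Suc j)) = (\<Sum>j<s. if j = i then u (Suc j) else 0)"
        by (intro sum.cong) auto
      ultimately have "(\<Sum>j<s. of_int (if j = i then 1 else 0) * u (Suc j)) \<in> rational_span"
        using lattice_subset_rational_span that by auto
      from zero[OF this] show False using that by auto
    qed
    show ?thesis
    \<comment> \<open>With \<open>s' = 0\<close> there is no \<open>f_u(\<alpha> z)\<close>, and the
      values given for \<open>\<alpha>'\<close> and \<open>\<kappa>\<close> are
      placeholders.\<close>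
    proof (rule AE_independent_serre[where t = t and u = u and r = r and s = s and s' = 0 and \<alpha> = \<alpha> and \<alpha>' = \<alpha> and \<kappa> = \<alpha>, OF F])
      show "k i = 0" if "(\<Sum>i<r. of_int (k i) * t (Suc i)) = 0" "i < r" for k :: "nat \<Rightarrow> int" and i
        using t_ind[of k i] that by blast
      show "u (Suc i) \<notin> \<Omega>" if "i < s" for i by (rule u[OF that])
      show "fs = [\<lambda>z. z, weierstrass_wp \<Omega>, weierstrass_zeta \<Omega>, weierstrass_sigma \<Omega>]
                  @ map (\<lambda>j z. exp (t j * z)) [1..<Suc r]
                  @ map (\<lambda>j z. serre \<Omega> (u j) z) [1..<Suc s]
                  @ map (\<lambda>j z. serre \<Omega> (u j) (\<alpha> j * z)) [1..<Suc 0]"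
        by (simp add: fs)
    qed (use zero in auto)
  qed
  have part2: "AE z :: complex ^ 'n in lebesgue. algebraically_independent ?F (UNIV \<times> {..<length fs}) (\<lambda>(i, l). (fs ! l) (z $ i))"
    if cm: "complex_multiplication \<Omega>" and \<alpha>: "\<forall>j\<in>{1..s}. \<alpha> j \<in> endomorphisms \<Omega> - \<int>"
      and ind: "ring.independent CC (endomorphism_field \<Omega>) (\<omega>1 # map u [1..<Suc s])"
      and fs: "fs = [\<lambda>z. z, weierstrass_wp \<Omega>, weierstrass_zeta \<Omega>, weierstrass_sigma \<Omega>]
                  @ map (\<lambda>j z. exp (t j * z)) [1..<Suc r]
                  @ map (\<lambda>j z. serre \<Omega> (u j) z) [1..<Suc s]
                  @ map (\<lambda>j z. serre \<Omega> (u j) (\<alpha> j * z)) [1..<Suc s]" for fs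
  proof -
    have \<alpha>E: "\<alpha> (Suc i) \<in> endomorphisms \<Omega>" "\<alpha> (Suc i) \<notin> \<int>" if "i < s" for i
      using \<alpha> that by auto
    have "\<exists>\<beta> \<kappa> T. \<beta> = of_int T - \<alpha> j \<and> (\<forall>v\<in>\<Omega>. \<eta> (\<alpha> j * v) = \<beta> * \<eta> v + \<kappa> * v)" if "j \<in> {1..s}" for j
    proof -
      have "\<alpha> j \<in> endomorphisms \<Omega>" using \<alpha> that by auto
      from endomorphism_conjugate[OF this] show ?thesis by metis
    qed
    then obtain \<beta> \<kappa> and T :: "nat \<Rightarrow> int" where
      \<beta>: "\<And>j. j \<in> {1..s} \<Longrightarrow> \<beta> j = of_int (T j) - \<alpha> j \<and> (\<forall>v\<in>\<Omega>. \<eta> (\<alpha> j * v) = \<beta> j * \<eta> v + \<kappa> j * v)"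
      by metis
    obtain \<theta> where \<theta>: "\<theta> \<in> endomorphism_field \<Omega>" "\<omega>2 = \<theta> * \<omega>1" using gen2_in_field_multiple[OF cm] .
    have zeroE: "\<forall>i<s. c i = 0" if c: "\<And>i. i < s \<Longrightarrow> c i \<in> endomorphisms \<Omega>" and sp: "(\<Sum>i<s. c i * u (Suc i)) \<in> rational_span" for c
    proof -
      obtain p q where pq: "(\<Sum>i<s. c i * u (Suc i)) = of_rat p * \<omega>1 + of_rat q * \<omega>2"
        using sp unfolding rational_span_def by blast
      \<comment> \<open>Writing \<open>\<omega>2\<close> as \<open>\<theta> * \<omega>1\<close>
        merges both periods into a single coefficient of \<open>\<omega>1\<close> from the
        endomorphism field.\<close>
      define d where "d = (\<lambda>i. if i = 0 then of_rat (- p) + of_rat (- q) * \<theta> else c (i - 1))"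
      have "\<forall>i<length (\<omega>1 # map u [1..<Suc s]). d i = 0"
      proof (rule independent_imp_coeffs_zero[OF ind endomorphism_field_uminus_divide])
        show "(\<Sum>i<length (\<omega>1 # map u [1..<Suc s]). d i * (\<omega>1 # map u [1..<Suc s]) ! i) = 0"
          using pq \<theta>(2) by (simp add: sum.lessThan_Suc_shift d_def of_rat_minus algebra_simps del: sum.lessThan_Suc upt_Suc)
        show "d i \<in> endomorphism_field \<Omega>" if "i < length (\<omega>1 # map u [1..<Suc s])" for i
          using that c[THEN endomorphism_in_field, of "i - 1"] \<theta>(1)
          by (auto simp: d_def simp del: upt_Suc intro!: endomorphism_field_add endomorphism_field_mult of_rat_endomorphism_field)
      qed auto
      then have "\<forall>i<s. d (Suc i) = 0" by simp
      then show ?thesis by (simp add: d_def)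
    qed
    have u: "u (Suc i) \<notin> \<Omega>" if "i < s" for i
    proof
      assume "u (Suc i) \<in> \<Omega>"
      moreover have "(\<Sum>j<s. of_int (if j = i then 1 else 0) * u (Suc j)) = (\<Sum>j<s. if j = i then u (Suc j) else 0)"
        by (intro sum.cong) auto
      ultimately have "(\<Sum>j<s. of_int (if j = i then 1 else 0) * u (Suc j)) \<in> rational_span"
        using lattice_subset_rational_span that by auto
      from zeroE[OF of_int_endomorphism this] show False using that by auto
    qed
    show ?thesis
    proof (rule AE_independent_serre[where t = t and u = u and r = r and s = s and s' = s and \<alpha> = \<alpha> and \<alpha>' = \<beta> and \<kappa> = \<kappa>, OF F])
      show "k i = 0" if "(\<Sum>i<r. of_int (k i) * t (Suc i)) = 0" "i < r" for k :: "nat \<Rightarrow> int" and i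
        using t_ind[of k i] that by blast
      show "u (Suc i) \<notin> \<Omega>" if "i < s" for i by (rule u[OF that])
      show "\<alpha> (Suc i) \<noteq> 0" if "i < s" for i using \<alpha>E(2)[OF that] by auto
      show "\<eta> (\<alpha> (Suc i) * v) = \<beta> (Suc i) * \<eta> v + \<kappa> (Suc i) * v" if "i < s" "v \<in> \<Omega>" for i v
        using \<beta>[of "Suc i"] that by auto
      fix k l :: "nat \<Rightarrow> int"
      assume "(\<Sum>i<s. of_int (k i) * u (Suc i)) + (\<Sum>i<s. of_int (l i) * (\<beta> (Suc i) * u (Suc i))) \<in> rational_span"
      then have sp: "(\<Sum>i<s. (of_int (k i) + of_int (l i) * \<beta> (Suc i)) * u (Suc i)) \<in> rational_span"
        by (simp add: distrib_right sum.distrib mult.assoc)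
      \<comment> \<open>The trace \<open>T\<close> trades the conjugate for \<open>\<alpha>\<close>
        itself. This shows that the coefficient is an endomorphism and, if it vanishes with
        \<open>l i \<noteq> 0\<close>, that \<open>\<alpha>\<close> is rational, hence real and so
        an integer.\<close>
      have eq: "of_int (k i) + of_int (l i) * \<beta> (Suc i) = of_int (k i + l i * T (Suc i)) + of_int (- l i) * \<alpha> (Suc i)" if "i < s" for i
      proof -
        have "\<beta> (Suc i) = of_int (T (Suc i)) - \<alpha> (Suc i)" using \<beta>[of "Suc i"] that by auto
        then show ?thesis by (simp only: of_int_add of_int_mult of_int_minus) (simp add: algebra_simps)
      qed
      have "of_int (k i) + of_int (l i) * \<beta> (Suc i) \<in> endomorphisms \<Omega>" if "i < s" for i
        unfolding eq[OF that] by (intro endomorphism_add endomorphism_mult of_int_endomorphism \<alpha>E that)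
      from zeroE[OF this sp] have z: "of_int (k i + l i * T (Suc i)) = of_int (l i) * \<alpha> (Suc i)" if "i < s" for i
        using eq that by simp
      have l0: "l i = 0" if "i < s" for i
      proof (rule ccontr)
        assume nz: "l i \<noteq> 0"
        have "\<alpha> (Suc i) = of_int (k i + l i * T (Suc i)) / of_int (l i)"
          unfolding z[OF that] using nz by simp
        also have "\<dots> = of_real (of_int (k i + l i * T (Suc i)) / of_int (l i))"
          by (simp only: of_real_divide of_real_of_int_eq)
        finally have real: "\<alpha> (Suc i) = of_real (of_int (k i + l i * T (Suc i)) / of_int (l i))" .
        from real_endomorphism_integer[OF \<alpha>E(1)[OF that] real] show False using \<alpha>E(2)[OF that] by blast
      qed
      moreover have "k i = 0" if "i < s" for i using z[OF that] l0[OF that] by simp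
      ultimately show "(\<forall>i<s. k i = 0) \<and> (\<forall>i<s. l i = 0)" by blast
    qed (use \<alpha>E fs in auto)
  qed
  show ?thesis
    unfolding Let_def using part1[OF _ refl] part2[OF _ _ _ refl] by blast
qed

end
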